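(* Let $D$ be a rotationally invariant subdomain of $\Omega$ containing the origin $(0,0)$, and let $f \in \mathcal{H}(D)$ be such that $\Delta_{zw} f=\lambda f$ for some $\lambda \in \mathbb{C}$ of the form $\lambda=4\mu(\mu-1)$ with $\operatorname{Re} \mu \ge 1/2$. Then there are uniquely determined coefficients $c_n \in \mathbb{C}$ such that $$f=\sum_{n=-\infty}^{\infty} c_n P_n^{\mu}:=\sum_{n = 0}^\infty c_n P_n^{\mu}+\sum_{n = 1}^\infty c_{-n}P_{-n}^{\mu}.$$ Here, both series converge absolutely and locally uniformly in $D$.
   Context: $\widehat{\mathbb{C}}=\mathbb{C}\cup\{\infty\}$, $\mathbb{D}$ is the open unit disk, $\mathbb{D}^2=\mathbb{D}\times\mathbb{D}$. With the conventions $z\cdot\infty=\infty\cdot z=\infty$ for $z\in\widehat{\mathbb{C}}\setminus\{0\}$ and $0\cdot\infty=\infty\cdot 0=1$, put $\Omega=\{(z,w)\in\widehat{\mathbb{C}}^2: z\cdot w\neq 1\}$, an open complex submanifold of $\widehat{\mathbb{C}}^2$ with the standard chart on $\Omega\cap\mathbb{C}^2$ and the flip chart $(u,v)\mapsto(1/v,1/u)$ on $\Omega\cap(\widehat{\mathbb{C}}\setminus\{0\})^2$; the operator $\Delta_{zw}=4(1-zw)^2\partial_z\partial_w$ is given by this formula in both charts. $\mathcal{H}(D)$ is the space of holomorphic functions on $D$. A subdomain $D\subseteq\Omega$ is rotationally invariant if $(\eta z,w/\eta)\in D$ for all $(z,w)\in D$ and all $\eta\in\partial\mathbb{D}$. For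 $\mu\in\mathbb{C}$, $n\in\mathbb{Z}$, the $n$-th Poisson Fourier mode of order $\mu$ is $$P_n^\mu(z,w)=\frac{(1-zw)^{\mu}}{2\pi}\int_0^{2\pi}\frac{e^{-int}}{(1-ze^{-it})^\mu(1-we^{it})^\mu}\,dt,\qquad (z,w)\in\mathbb{D}^2,$$ with principal branches of the powers; it has a holomorphic extension to $\Omega_*=\{(z,w)\in\mathbb{C}^2: zw\in\mathbb{C}\setminus[1,\infty)\}$, again denoted $P_n^\mu$.
   Formalization: Where D is not contained in Ω_*, the term c_n P_n^μ on D means the holomorphic function on D that agrees with c_n P_n^μ on the component of D∩Ω_* containing the origin; its existence is part of the conclusion. For D inside Ω_* it is literally c_n P_n^μ. *)

theory Defs
  imports "HOL-Analysis.Analysis"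
begin

section \<open>The Riemann sphere and the manifold \<open>\<Omega>\<close>\<close>

text \<open>The Riemann sphere is the one-point compactification of the plane; \<open>None\<close> is the point
  at infinity.\<close>

type_synonym csphere = "complex option"

definition sphere_top :: "csphere topology" where
  "sphere_top = Alexandroff_compactification euclidean"

definition sphere2_top :: "(csphere \<times> csphere) topology" where
  "sphere2_top = prod_topology sphere_top sphere_top"

text \<open>Multiplication with the convention \<open>0 \<cdot> \<infinity> = \<infinity> \<cdot> 0 = 1\<close>.\<close>

fun sphere_mult :: "csphere \<Rightarrow> csphere \<Rightarrow> csphere" where
  "sphere_mult (Some z) (Some w) = Some (z * w)"
| "sphere_mult (Some z) None = (if z = 0 then Some 1 else None)"
| "sphere_mult None (Some w) = (if w = 0 then Some 1 else None)"
| "sphere_mult None None = None"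

fun sphere_inverse :: "csphere \<Rightarrow> csphere" where
  "sphere_inverse (Some z) = (if z = 0 then None else Some (inverse z))"
| "sphere_inverse None = Some 0"

definition Omega :: "(csphere \<times> csphere) set" where
  "Omega = {(z, w). sphere_mult z w \<noteq> Some 1}"

definition Omega_top :: "(csphere \<times> csphere) topology" where
  "Omega_top = subtopology sphere2_top Omega"

definition flip :: "csphere \<times> csphere \<Rightarrow> csphere \<times> csphere" where
  "flip p = (sphere_inverse (snd p), sphere_inverse (fst p))"

text \<open>\<open>std_par\<close> and \<open>flip_par\<close> are the inverses (parametrizations) of the standard chart and of
  the flip chart. Since \<open>flip\<close> is an involution, \<open>flip_par\<close> maps \<open>(a, b)\<close> to \<open>(1/b, 1/a)\<close>.
  \<open>std_coord\<close> is meaningful only on pairs of finite points, \<open>flip_coord\<close> only on pairs of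
  nonzero points; every point of \<open>Omega\<close> is of one of these two kinds.\<close>

definition std_par :: "complex \<times> complex \<Rightarrow> csphere \<times> csphere" where
  "std_par q = (Some (fst q), Some (snd q))"

definition flip_par :: "complex \<times> complex \<Rightarrow> csphere \<times> csphere" where
  "flip_par q = flip (std_par q)"

definition std_coord :: "csphere \<times> csphere \<Rightarrow> complex \<times> complex" where
  "std_coord p = (the (fst p), the (snd p))"

definition flip_coord :: "csphere \<times> csphere \<Rightarrow> complex \<times> complex" where
  "flip_coord p = std_coord (flip p)"

definition subdomain_Omega :: "(csphere \<times> csphere) set \<Rightarrow> bool" where
  "subdomain_Omega D \<longleftrightarrow> D \<noteq> {} \<and> openin Omega_top D \<and> connectedin Omega_top D"

definition rotationally_invariant :: "(csphere \<times> csphere) set \<Rightarrow> bool" where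
  "rotationally_invariant D \<longleftrightarrow>
     (\<forall>(z, w) \<in> D. \<forall>\<eta> \<in> sphere 0 1.
        (sphere_mult (Some \<eta>) z, sphere_mult w (Some (inverse \<eta>))) \<in> D)"


section \<open>Holomorphic functions and the operator \<open>\<Delta>\<^sub>z\<^sub>w\<close>\<close>

text \<open>Complex (Frechet) differentiability in two variables: the derivative is complex linear.\<close>

definition holomorphic2_on :: "(complex \<times> complex \<Rightarrow> complex) \<Rightarrow> (complex \<times> complex) set \<Rightarrow> bool"
  (infixl \<open>holomorphic2'_on\<close> 50) where
  "g holomorphic2_on S \<longleftrightarrow>
     (\<forall>q\<in>S. \<exists>A B. (g has_derivative (\<lambda>(h, k). A * h + B * k)) (at q within S))"

definition holomorphic_Omega_on ::
  "(csphere \<times> csphere \<Rightarrow> complex) \<Rightarrow> (csphere \<times> csphere) set \<Rightarrow> bool"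
  (infixl \<open>holomorphic'_Omega'_on\<close> 50) where
  "f holomorphic_Omega_on D \<longleftrightarrow>
     (f \<circ> std_par) holomorphic2_on {q. std_par q \<in> D} \<and>
     (f \<circ> flip_par) holomorphic2_on {q. flip_par q \<in> D}"

definition Delta_chart :: "(complex \<times> complex \<Rightarrow> complex) \<Rightarrow> complex \<times> complex \<Rightarrow> complex" where
  "Delta_chart g q =
     4 * (1 - fst q * snd q)\<^sup>2 * deriv (\<lambda>z. deriv (\<lambda>w. g (z, w)) (snd q)) (fst q)"

text \<open>For holomorphic functions the expression \<open>Delta_chart\<close> is invariant under the change of
  charts \<open>(z, w) \<mapsto> (1/w, 1/z)\<close>, so using the standard chart on the overlap is no restriction.\<close>

definition Delta :: "(csphere \<times> csphere \<Rightarrow> complex) \<Rightarrow> csphere \<times> csphere \<Rightarrow> complex" where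
  "Delta f p =
     (if p \<in> range std_par then Delta_chart (f \<circ> std_par) (std_coord p)
      else Delta_chart (f \<circ> flip_par) (flip_coord p))"


section \<open>Poisson Fourier modes\<close>

definition Omega_star :: "(complex \<times> complex) set" where
  "Omega_star = {(z, w). z * w \<notin> of_real ` {1..}}"

definition poisson_mode_disk :: "complex \<Rightarrow> int \<Rightarrow> complex \<Rightarrow> complex \<Rightarrow> complex" where
  "poisson_mode_disk \<mu> n z w =
     (1 - z * w) powr \<mu> / (2 * of_real pi) *
     integral {0..2 * pi}
       (\<lambda>t. exp (- \<i> * of_int n * of_real t) /
            ((1 - z * exp (- \<i> * of_real t)) powr \<mu> * (1 - w * exp (\<i> * of_real t)) powr \<mu>))"

text \<open>The holomorphic extension from the bidisk to \<open>Omega_star\<close>. It is unique on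
  \<open>Omega_star\<close>, which is star-shaped about the origin; values elsewhere are irrelevant.\<close>

definition poisson_mode :: "complex \<Rightarrow> int \<Rightarrow> complex \<times> complex \<Rightarrow> complex" where
  "poisson_mode \<mu> n =
     (SOME g. g holomorphic2_on Omega_star \<and>
        (\<forall>z \<in> ball 0 1. \<forall>w \<in> ball 0 1. g (z, w) = poisson_mode_disk \<mu> n z w))"

text \<open>A subdomain \<open>D\<close> of \<open>Omega\<close> need not be contained in \<open>Omega_star\<close>, where the modes are
  defined; moreover \<open>D\<close> may wind around \<open>zw = 1\<close>, so that \<open>D \<inter> Omega_star\<close> is disconnected and
  the continuation along \<open>D\<close> differs from the mode itself on components not containing the origin.
  The term \<open>c P\<^sub>n\<close> on \<open>D\<close> is therefore the (unique) holomorphic function \<open>g\<close> on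
  \<open>D\<close> that equals \<open>c P\<^sub>n\<close> on the component of \<open>D \<inter> Omega_star\<close> containing the origin.
  If \<open>D \<subseteq> Omega_star\<close>, that component is all of \<open>D\<close>, and \<open>g\<close> is literally \<open>c P\<^sub>n\<close>.\<close>

definition poisson_term_on ::
  "(csphere \<times> csphere) set \<Rightarrow> complex \<Rightarrow> int \<Rightarrow> complex \<Rightarrow> (csphere \<times> csphere \<Rightarrow> complex) \<Rightarrow> bool" where
  "poisson_term_on D \<mu> n c g \<longleftrightarrow>
     g holomorphic_Omega_on D \<and>
     (\<forall>q \<in> connected_component_set ({q. std_par q \<in> D} \<inter> Omega_star) (0, 0).
        g (std_par q) = c * poisson_mode \<mu> n q)"


section \<open>Absolute and locally uniform convergence\<close>

definition abs_loc_unif_convergent_on ::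
  "(nat \<Rightarrow> csphere \<times> csphere \<Rightarrow> complex) \<Rightarrow> (csphere \<times> csphere) set \<Rightarrow> bool" where
  "abs_loc_unif_convergent_on F D \<longleftrightarrow>
     (\<forall>p\<in>D. summable (\<lambda>k. norm (F k p))) \<and>
     (\<forall>p\<in>D. \<exists>U. openin Omega_top U \<and> p \<in> U \<and> U \<subseteq> D \<and>
        uniform_limit U (\<lambda>N x. \<Sum>k<N. F k x) (\<lambda>x. \<Sum>k. F k x) sequentially)"

end

theory Submission
  imports Defs "HOL-Complex_Analysis.Complex_Analysis"
begin

text \<open>For fixed \<open>p\<close> in \<open>D\<close> the function \<open>\<eta> \<mapsto> f (\<eta> z, w / \<eta>)\<close> is holomorphic near the unit circle. Its
  Laurent coefficients decay geometrically, locally uniformly in \<open>p\<close>, and sum to \<open>f p\<close>. The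
  coefficient at \<open>\<eta>\<^sup>-\<^sup>n\<close> is the rotational mean of \<open>\<eta>\<^sup>n f (\<eta> z, w / \<eta>)\<close>; it is again an eigenfunction, and it is a
  monomial on each coordinate axis. The mode \<open>P\<^sub>n\<close> is the same mean of the eigenfunction
  \<open>((1 - z w) / ((1 - z) (1 - w)))\<^sup>\<mu>\<close>. An eigenfunction vanishing on both axes vanishes near the origin,
  since \<open>\<partial>\<^sub>z \<partial>\<^sub>w\<close> is inverted by a double integral that is a contraction on small bidisks.
  Hence this mean of \<open>f\<close> is a multiple of \<open>P\<^sub>n\<close>. The coefficients are unique because the series
  restricts to a power series on each axis.

  The extension of \<open>P\<^sub>n\<close> to \<open>Omega_star\<close> is \<open>w\<^sup>n H (z w)\<close> or \<open>z\<^sup>-\<^sup>n H (z w)\<close> up to a constant, where \<open>H\<close>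
  solves a hypergeometric equation on the plane slit along \<open>[1, \<infinity>)\<close> and is obtained by Picard
  iteration along rays.\<close>

section \<open>Holomorphic functions of two variables\<close>

text \<open>The obstacle is global: \<open>D\<close> may contain points with infinite coordinates
  and may wind around zw = 1, so the modes give no formula for the terms on all of \<open>D\<close>.
  Averaging \<open>f\<close> itself over rotations avoids any continuation: the mean is defined on
  the whole of \<open>D\<close>, and the rotation has the same formula in both charts. Only near the
  origin is the mean compared with a mode; the identity theorem then carries the equality over the
  component of the origin. The axes suffice for the comparison because they are the characteristics
  of \<partial>z\<partial>w, so that values on them are the natural (Goursat) data. The condition on
  Re \<mu> keeps the axis coefficient \<open>pochhammer \<mu> k / fact k\<close> of the mode
  nonzero, so that c_n can be defined by a division. The extension of the modes is constructed
  explicitly because \<open>poisson_mode\<close> is given by choice and carries no information until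
  a candidate exists.\<close>

lemma holomorphic_on_atI:
  "(\<And>x. x \<in> S \<Longrightarrow> f field_differentiable at x) \<Longrightarrow> f holomorphic_on S"
  by (simp add: holomorphic_on_def field_differentiable_at_within)

text \<open>Cauchy's formula on one fixed circle about z0 writes \<open>deriv (\<phi> p) z\<close>
  as an integral whose integrand is jointly continuous in p, z and the curve parameter; such
  integrals depend continuously on p and z.\<close>

lemma continuous_on_deriv_param:
  fixes \<phi> :: "'p::t2_space \<Rightarrow> complex \<Rightarrow> complex"
  assumes "open U"
    and cont: "continuous_on (A \<times> U) (\<lambda>(p, z). \<phi> p z)"
    and hol: "\<And>p. p \<in> A \<Longrightarrow> \<phi> p holomorphic_on U"
  shows "continuous_on (A \<times> U) (\<lambda>(p, z). deriv (\<phi> p) z)"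
  unfolding continuous_on_eq_continuous_within
proof safe
  fix p0 z0 assume p0: "p0 \<in> A" and z0: "z0 \<in> U"
  obtain r where r: "r > 0" "cball z0 r \<subseteq> U"
    using assms(1) z0 open_contains_cball by blast
  have form: "deriv (\<phi> p) z = integral {0..1} (\<lambda>t. \<phi> p (circlepath z0 r t) / (circlepath z0 r t - z)^2 *
      (2 * of_real pi * \<i> * r * exp (2 * of_real pi * \<i> * t))) / (2 * of_real pi * \<i>)"
    if "p \<in> A" "z \<in> ball z0 r" for p z
  proof -
    have "((\<lambda>u. \<phi> p u / (u - z) ^ Suc 1) has_contour_integral
        2 * pi * \<i> / fact 1 * (deriv ^^ 1) (\<phi> p) z) (circlepath z0 r)"
      using that r hol[OF that(1)]
      by (intro Cauchy_has_contour_integral_higher_derivative_circlepath)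
         (auto intro!: holomorphic_on_imp_continuous_on elim!: holomorphic_on_subset dest: subsetD[OF ball_subset_cball])
    then have "contour_integral (circlepath z0 r) (\<lambda>u. \<phi> p u / (u - z)^2) = 2 * pi * \<i> * deriv (\<phi> p) z"
      by (simp add: contour_integral_unique power2_eq_square)
    then show ?thesis
      by (simp add: contour_integral_integral vector_derivative_circlepath)
  qed
  have ne: "circlepath z0 r t \<noteq> z" if "z \<in> ball z0 r" for t z
    using that r by (auto simp: circlepath dist_norm norm_mult)
  have inU: "circlepath z0 r t \<in> U" for t
    using r by (auto simp: circlepath dist_norm norm_mult intro!: subsetD[OF r(2)])
  have 1: "continuous_on ((A \<times> ball z0 r) \<times> cbox 0 1) (\<lambda>x. \<phi> (fst (fst x)) (circlepath z0 r (snd x)))"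
    using inU by (intro continuous_on_compose_Pair[OF cont]) (auto intro!: continuous_intros simp: circlepath)
  have 2: "continuous_on ((A \<times> ball z0 r) \<times> cbox 0 1) (\<lambda>x. circlepath z0 r (snd x) - snd (fst x))"
    unfolding circlepath by (intro continuous_intros)
  have "continuous_on ((A \<times> ball z0 r) \<times> cbox 0 1) (\<lambda>(x, t). \<phi> (fst x) (circlepath z0 r t) / (circlepath z0 r t - snd x)^2 *
      (2 * of_real pi * \<i> * r * exp (2 * of_real pi * \<i> * t)))"
    unfolding case_prod_unfold
    by (intro continuous_intros 1 2) (use ne in auto)
  from integral_continuous_on_param[OF this]
  have "continuous_on (A \<times> ball z0 r) (\<lambda>x. integral (cbox 0 1) (\<lambda>t. \<phi> (fst x) (circlepath z0 r t) / (circlepath z0 r t - snd x)^2 *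
      (2 * of_real pi * \<i> * r * exp (2 * of_real pi * \<i> * t))) / (2 * of_real pi * \<i>))"
    by (intro continuous_intros) auto
  then have "continuous_on (A \<times> ball z0 r) (\<lambda>(p, z). deriv (\<phi> p) z)"
    by (rule continuous_on_eq) (auto simp: form)
  then have "continuous (at (p0, z0) within A \<times> ball z0 r) (\<lambda>(p, z). deriv (\<phi> p) z)"
    using p0 r by (auto simp: continuous_on_eq_continuous_within)
  moreover have "at (p0, z0) within A \<times> ball z0 r = at (p0, z0) within A \<times> U"
    using r by (intro at_within_nhd[of _ "UNIV \<times> ball z0 r"]) (auto intro!: open_Times)
  ultimately show "continuous (at (p0, z0) within A \<times> U) (\<lambda>(p, z). deriv (\<phi> p) z)" by simp
qed

text \<open>The Leibniz rule asks for a jointly continuous derivative of the integrand. Holomorphy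
  in z provides it through \<open>continuous_on_deriv_param\<close>, with the integration variable
  as parameter.\<close>

lemma has_field_derivative_integral_param:
  fixes \<phi> :: "real \<Rightarrow> complex \<Rightarrow> complex"
  assumes "open U" "z0 \<in> U"
    and cont: "continuous_on (U \<times> {a..b}) (\<lambda>(z, t). \<phi> t z)"
    and hol: "\<And>t. t \<in> {a..b} \<Longrightarrow> \<phi> t holomorphic_on U"
  shows "((\<lambda>z. integral {a..b} (\<lambda>t. \<phi> t z)) has_field_derivative
     integral {a..b} (\<lambda>t. deriv (\<phi> t) z0)) (at z0)"
proof -
  obtain r where r: "r > 0" "ball z0 r \<subseteq> U"
    using assms(1,2) openE by blast
  have sw: "continuous_on ({a..b} \<times> U) (\<lambda>(t, z). \<phi> t z)"
    unfolding case_prod_unfold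
    by (rule continuous_on_compose_Pair[OF cont]) (auto intro!: continuous_intros)
  have d: "continuous_on ({a..b} \<times> U) (\<lambda>(t, z). deriv (\<phi> t) z)"
    by (rule continuous_on_deriv_param[OF assms(1) sw hol])
  have c: "continuous_on (ball z0 r \<times> cbox a b) (\<lambda>(z, t). deriv (\<phi> t) z)"
    unfolding case_prod_unfold
    using r by (intro continuous_on_compose_Pair[OF d, where g = snd and h = fst]
        continuous_on_fst[OF continuous_on_id] continuous_on_snd[OF continuous_on_id]) auto
  have "((\<lambda>z. integral (cbox a b) (\<lambda>t. \<phi> t z)) has_field_derivative
     integral (cbox a b) (\<lambda>t. deriv (\<phi> t) z0)) (at z0 within ball z0 r)"
  proof (rule leibniz_rule_field_derivative[OF _ _ c])
    show "((\<lambda>x. \<phi> t x) has_field_derivative deriv (\<phi> t) x) (at x within ball z0 r)"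
      if "x \<in> ball z0 r" "t \<in> cbox a b" for x t
      by (rule has_field_derivative_at_within, rule holomorphic_derivI[OF hol assms(1)])
         (use that r in auto)
    show "(\<lambda>t. \<phi> t x) integrable_on cbox a b" if "x \<in> ball z0 r" for x
      using that r
      by (intro integrable_continuous continuous_on_compose_Pair[OF cont]) (auto intro!: continuous_intros)
  qed (use r in auto)
  then show ?thesis
    using r at_within_open[of z0 "ball z0 r"] by simp
qed

section \<open>Partial derivatives, and families depending continuously on a real parameter\<close>

definition D1 :: "(complex \<times> complex \<Rightarrow> complex) \<Rightarrow> complex \<times> complex \<Rightarrow> complex" where
  "D1 f q = deriv (\<lambda>z. f (z, snd q)) (fst q)"

definition D2 :: "(complex \<times> complex \<Rightarrow> complex) \<Rightarrow> complex \<times> complex \<Rightarrow> complex" where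
  "D2 f q = deriv (\<lambda>w. f (fst q, w)) (snd q)"

text \<open>Joint continuity with separate holomorphy is easier to check than complex Frechet
  differentiability and is preserved by \<open>D2\<close>. A single function is treated as the
  constant family over {0}.\<close>

definition holomorphic2_family ::
  "(complex \<times> complex) set \<Rightarrow> real set \<Rightarrow> (real \<Rightarrow> complex \<times> complex \<Rightarrow> complex) \<Rightarrow> bool" where
  "holomorphic2_family S T F \<longleftrightarrow>
     continuous_on (S \<times> T) (\<lambda>(q, t). F t q) \<and>
     (\<forall>t\<in>T. \<forall>q\<in>S. (\<lambda>z. F t (z, snd q)) field_differentiable at (fst q) \<and>
                   (\<lambda>w. F t (fst q, w)) field_differentiable at (snd q))"

lemma holomorphic2_familyD:
  assumes "holomorphic2_family S T F"
  shows "continuous_on (S \<times> T) (\<lambda>(q, t). F t q)"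
    and "t \<in> T \<Longrightarrow> (a, b) \<in> S \<Longrightarrow> (\<lambda>z. F t (z, b)) field_differentiable at a"
    and "t \<in> T \<Longrightarrow> (a, b) \<in> S \<Longrightarrow> (\<lambda>w. F t (a, w)) field_differentiable at b"
  using assms by (force simp: holomorphic2_family_def case_prod_unfold)+

lemma open_Times_ball:
  fixes S :: "('a::metric_space \<times> 'b::metric_space) set"
  assumes "open S" "(a, b) \<in> S"
  obtains r where "r > 0" "cball a r \<times> cball b r \<subseteq> S"
proof -
  obtain A B where "open A" "open B" "a \<in> A" "b \<in> B" "A \<times> B \<subseteq> S"
    using assms open_prod_elim[OF assms] by (metis SigmaE2)
  moreover obtain r1 r2 where "r1 > 0" "r2 > 0" "cball a r1 \<subseteq> A" "cball b r2 \<subseteq> B"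
    using calculation open_contains_cball by metis
  moreover have "cball a (min r1 r2) \<subseteq> cball a r1" "cball b (min r1 r2) \<subseteq> cball b r2"
    by auto
  ultimately have "cball a (min r1 r2) \<times> cball b (min r1 r2) \<subseteq> S" "min r1 r2 > 0"
    by (meson Sigma_mono subset_trans, simp)
  then show ?thesis using that by blast
qed

text \<open>The delicate point is differentiability of the w-derivative in z. Cauchy's formula in w
  turns \<open>D2\<close> at w = b into an integral over a circle about b that does not move with z,
  and this integral can be differentiated in z under the sign.\<close>

lemma holomorphic2_family_D2:
  assumes "open S" and F: "holomorphic2_family S T F"
  shows "holomorphic2_family S T (\<lambda>t. D2 (F t))"
proof -
  have loc: "continuous_on ((ball a r \<times> T) \<times> ball b r) (\<lambda>(x, w). deriv (\<lambda>w. F (snd x) (fst x, w)) w)"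
       "\<And>x. x \<in> ball a r \<times> T \<Longrightarrow> (\<lambda>w. F (snd x) (fst x, w)) holomorphic_on ball b r"
    if r: "ball a r \<times> ball b r \<subseteq> S" for a b r
  proof -
    show 1: "(\<lambda>w. F (snd x) (fst x, w)) holomorphic_on ball b r" if x: "x \<in> ball a r \<times> T" for x
    proof (rule holomorphic_on_atI)
      fix w assume "w \<in> ball b r"
      with x r have "(fst x, w) \<in> S" "snd x \<in> T" by (force, force)
      then show "(\<lambda>w. F (snd x) (fst x, w)) field_differentiable at w"
        by (intro holomorphic2_familyD(3)[OF F])
    qed
    have "continuous_on ((ball a r \<times> T) \<times> ball b r) (\<lambda>x. F (snd (fst x)) (fst (fst x), snd x))"
      using r by (intro continuous_on_compose_Pair[OF holomorphic2_familyD(1)[OF F]])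
         (auto intro!: continuous_intros)
    then show "continuous_on ((ball a r \<times> T) \<times> ball b r) (\<lambda>(x, w). deriv (\<lambda>w. F (snd x) (fst x, w)) w)"
      by (intro continuous_on_deriv_param 1) (auto simp: case_prod_unfold)
  qed
  show ?thesis
    unfolding holomorphic2_family_def
  proof (intro conjI ballI)
    show "continuous_on (S \<times> T) (\<lambda>(q, t). D2 (F t) q)"
      unfolding continuous_on_eq_continuous_within
    proof safe
      fix a b t assume q: "(a, b) \<in> S" and t: "t \<in> T"
      obtain r where r: "r > 0" "cball a r \<times> cball b r \<subseteq> S"
        using open_Times_ball[OF assms(1) q] .
      then have r': "ball a r \<times> ball b r \<subseteq> S" by auto
      have "continuous_on ((ball a r \<times> ball b r) \<times> T) (\<lambda>y. deriv (\<lambda>w. F (snd y) (fst (fst y), w)) (snd (fst y)))"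
        by (rule continuous_on_compose_Pair[OF loc(1)[OF r'],
              where g = "\<lambda>y. (fst (fst y), snd y)" and h = "\<lambda>y. snd (fst y)", simplified fst_conv snd_conv])
           (auto intro!: continuous_intros)
      then have "continuous (at ((a, b), t) within (ball a r \<times> ball b r) \<times> T) (\<lambda>(q, t). D2 (F t) q)"
        using t r by (auto simp: continuous_on_eq_continuous_within case_prod_unfold D2_def)
      moreover have "at ((a, b), t) within (ball a r \<times> ball b r) \<times> T = at ((a, b), t) within S \<times> T"
        using r r' by (intro at_within_nhd[of _ "(ball a r \<times> ball b r) \<times> UNIV"]) (auto intro!: open_Times)
      ultimately show "continuous (at ((a, b), t) within S \<times> T) (\<lambda>(q, t). D2 (F t) q)" by simp
    qed
  next
    fix t q assume t: "t \<in> T" and q: "q \<in> S"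
    obtain a b where ab: "q = (a, b)" by force
    obtain r where r: "r > 0" "cball a r \<times> cball b r \<subseteq> S"
      using open_Times_ball[OF assms(1)] q ab by metis
    then have r': "ball a r \<times> ball b r \<subseteq> S" by auto
    have h: "(\<lambda>w. F t (z, w)) holomorphic_on ball b r" if "z \<in> ball a r" for z
      using loc(2)[OF r', of "(z, t)"] that t by simp
    have "deriv (\<lambda>w. F t (a, w)) holomorphic_on ball b r"
      using h r by (intro holomorphic_deriv) auto
    then have "deriv (\<lambda>w. F t (a, w)) field_differentiable at b"
      by (rule holomorphic_on_imp_differentiable_at) (use r in auto)
    then show "(\<lambda>w. D2 (F t) (fst q, w)) field_differentiable at (snd q)"
      by (simp add: D2_def ab)
    \<comment> \<open>The integrand of Cauchy's formula pulled back along \<open>circlepath\<close>,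
      velocity included; the factor 1/(2 \<pi> i) is kept outside.\<close>
    define \<phi> where "\<phi> = (\<lambda>\<tau> z. F t (z, circlepath b r \<tau>) / (circlepath b r \<tau> - b)^2 *
      (2 * of_real pi * \<i> * r * exp (2 * of_real pi * \<i> * \<tau>)))"
    have cp: "circlepath b r \<tau> \<in> cball b r" "circlepath b r \<tau> \<noteq> b" for \<tau>
      using r by (auto simp: circlepath dist_norm norm_mult)
    have form: "deriv (\<lambda>w. F t (z, w)) b = integral {0..1} (\<lambda>\<tau>. \<phi> \<tau> z) / (2 * of_real pi * \<i>)"
      if z: "z \<in> ball a r" for z
    proof -
      have "(\<lambda>w. F t (z, w)) field_differentiable at w" if "w \<in> cball b r" for w
        using r z that t by (intro holomorphic2_familyD(3)[OF F]) auto
      then have "continuous_on (cball b r) (\<lambda>w. F t (z, w))"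
        by (meson continuous_at_imp_continuous_on field_differentiable_imp_continuous_at)
      then have "((\<lambda>u. F t (z, u) / (u - b) ^ Suc 1) has_contour_integral
          2 * pi * \<i> / fact 1 * (deriv ^^ 1) (\<lambda>w. F t (z, w)) b) (circlepath b r)"
        using h[OF z] r
        by (intro Cauchy_has_contour_integral_higher_derivative_circlepath) auto
      then have "contour_integral (circlepath b r) (\<lambda>u. F t (z, u) / (u - b)^2) = 2 * pi * \<i> * deriv (\<lambda>w. F t (z, w)) b"
        by (simp add: contour_integral_unique power2_eq_square)
      then show ?thesis
        by (simp add: contour_integral_integral vector_derivative_circlepath \<phi>_def)
    qed
    have "((\<lambda>z. integral {0..1} (\<lambda>\<tau>. \<phi> \<tau> z)) has_field_derivative
      integral {0..1} (\<lambda>\<tau>. deriv (\<phi> \<tau>) a)) (at a)"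
    proof (rule has_field_derivative_integral_param[of "ball a r"])
      have "continuous_on (ball a r \<times> {0..1}) (\<lambda>x. F t (fst x, circlepath b r (snd x)))"
        using r t cp
        by (intro continuous_on_compose_Pair[OF holomorphic2_familyD(1)[OF F]])
           (auto intro!: continuous_intros simp: circlepath)
      moreover have "continuous_on (ball a r \<times> {0..1}) (\<lambda>x. circlepath b r (snd x))"
        unfolding circlepath by (intro continuous_intros)
      ultimately show "continuous_on (ball a r \<times> {0..1}) (\<lambda>(z, \<tau>). \<phi> \<tau> z)"
        unfolding \<phi>_def case_prod_unfold
        by (intro continuous_intros) (use cp in auto)
      fix \<tau> :: real
      have "(\<lambda>z. F t (z, circlepath b r \<tau>)) holomorphic_on ball a r"
        using r t cp by (intro holomorphic_on_atI holomorphic2_familyD(2)[OF F]) auto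
      then show "\<phi> \<tau> holomorphic_on ball a r"
        unfolding \<phi>_def using cp by (intro holomorphic_intros) auto
    qed (use r in auto)
    from has_field_derivative_transform_within_open[OF DERIV_cdivide[OF this, of "2 * of_real pi * \<i>"] open_ball[of a r],
        of "\<lambda>z. deriv (\<lambda>w. F t (z, w)) b"]
    have "(\<lambda>z. deriv (\<lambda>w. F t (z, w)) b) field_differentiable at a"
      using r form unfolding field_differentiable_def by auto
    then show "(\<lambda>z. D2 (F t) (z, snd q)) field_differentiable at (fst q)"
      by (simp add: D2_def ab)
  qed
qed

text \<open>Osgood's lemma. \<open>D2 f\<close> is continuous by
  \<open>holomorphic2_family_D2\<close>, and one partial derivative at the point together with a
  continuous second one yields the total derivative.\<close>

lemma holomorphic2_onI:
  assumes "open S" and F: "holomorphic2_family S {0} (\<lambda>_. f)"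
  shows "f holomorphic2_on S"
  unfolding holomorphic2_on_def
proof
  fix q assume q: "q \<in> S"
  obtain a b where ab: "q = (a, b)" by force
  obtain r where r: "r > 0" "cball a r \<times> cball b r \<subseteq> S"
    using open_Times_ball[OF assms(1)] q ab by metis
  have D: "((\<lambda>z. f (z, w)) has_field_derivative D1 f (z, w)) (at z)"
          "((\<lambda>w. f (z, w)) has_field_derivative D2 f (z, w)) (at w)" if "(z, w) \<in> S" for z w
    using holomorphic2_familyD(2,3)[OF F _ that, of 0]
    by (simp_all add: D1_def D2_def DERIV_deriv_iff_field_differentiable)
  have "continuous_on (ball a r \<times> ball b r) (\<lambda>q. D2 f q)"
    using r by (intro continuous_on_compose_Pair[OF holomorphic2_familyD(1)[OF holomorphic2_family_D2[OF assms]],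
          where g = "\<lambda>q. q" and h = "\<lambda>q. 0"]) (auto intro!: continuous_intros)
  then have "continuous_on (ball a r \<times> ball b r) (\<lambda>q. blinfun_mult_right (D2 f q))"
    by (intro bounded_linear.continuous_on[OF bounded_linear_blinfun_mult_right])
  then have c: "continuous (at (a, b) within ball a r \<times> ball b r) (\<lambda>(z, w). blinfun_mult_right (D2 f (z, w)))"
    using r by (auto simp: continuous_on_eq_continuous_within case_prod_unfold)
  have "((\<lambda>(z, w). f (z, w)) has_derivative (\<lambda>(h, k). D1 f (a, b) * h + blinfun_mult_right (D2 f (a, b)) k))
      (at (a, b) within ball a r \<times> ball b r)"
  proof (rule has_derivative_partialsI[OF _ _ c])
    show "((\<lambda>z. f (z, b)) has_derivative (*) (D1 f (a, b))) (at a within ball a r)"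
      using D(1)[of a b] q ab by (simp add: has_field_derivative_def has_derivative_at_withinI)
    show "((\<lambda>w. f (z, w)) has_derivative blinfun_apply (blinfun_mult_right (D2 f (z, w)))) (at w within ball b r)"
      if "z \<in> ball a r" "w \<in> ball b r" for z w
    proof -
      have "((\<lambda>w. f (z, w)) has_field_derivative D2 f (z, w)) (at w)"
        using r that by (intro D(2)) auto
      then show ?thesis
        by (simp add: has_field_derivative_def has_derivative_at_withinI)
    qed
  qed (use r in auto)
  moreover have "ball a r \<times> ball b r \<subseteq> S"
    using r by auto
  then have "at (a, b) within ball a r \<times> ball b r = at (a, b) within S"
    using r by (intro at_within_nhd[of _ "ball a r \<times> ball b r"]) (auto intro!: open_Times)
  ultimately have "(f has_derivative (\<lambda>(h, k). D1 f (a, b) * h + D2 f (a, b) * k)) (at q within S)"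
    by (simp add: ab)
  then show "\<exists>A B. (f has_derivative (\<lambda>(h, k). A * h + B * k)) (at q within S)" by blast
qed

lemma holomorphic2_on_imp_continuous_on:
  "f holomorphic2_on S \<Longrightarrow> continuous_on S f"
  unfolding holomorphic2_on_def continuous_on_eq_continuous_within
  using has_derivative_continuous by blast

text \<open>Restriction to a holomorphic curve; it reduces coordinate slices, complex lines and
  rotation orbits to one variable.\<close>

lemma holomorphic2_on_compose:
  assumes f: "f holomorphic2_on S" and "open S" and "(g x, h x) \<in> S"
    and g: "(g has_field_derivative g') (at x)" and h: "(h has_field_derivative h') (at x)"
  shows "(\<lambda>x. f (g x, h x)) field_differentiable at x"
proof -
  obtain A B where "(f has_derivative (\<lambda>(h, k). A * h + B * k)) (at (g x, h x))"
    using f assms(2,3) unfolding holomorphic2_on_def by (metis at_within_open)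
  moreover have "((\<lambda>x. (g x, h x)) has_derivative (\<lambda>k. (g' * k, h' * k))) (at x)"
    using g h unfolding has_field_derivative_def by (rule has_derivative_Pair)
  ultimately have "((\<lambda>x. f (g x, h x)) has_derivative (\<lambda>k. A * (g' * k) + B * (h' * k))) (at x)"
    using has_derivative_compose[of "\<lambda>x. (g x, h x)" _ x UNIV f] by fastforce
  then have "((\<lambda>x. f (g x, h x)) has_field_derivative (A * g' + B * h')) (at x)"
    unfolding has_field_derivative_def
    by (rule has_derivative_eq_rhs) (simp add: algebra_simps fun_eq_iff)
  then show ?thesis unfolding field_differentiable_def by blast
qed

lemma holomorphic2_on_family:
  assumes "open S" "f holomorphic2_on S"
  shows "holomorphic2_family S T (\<lambda>_. f)"
  unfolding holomorphic2_family_def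
proof (intro conjI ballI)
  show "continuous_on (S \<times> T) (\<lambda>(q, t). f q)"
    unfolding case_prod_unfold
    by (rule continuous_on_compose2[OF holomorphic2_on_imp_continuous_on[OF assms(2)]])
       (auto intro!: continuous_intros)
next
  fix q assume "q \<in> S"
  then have q: "(fst q, snd q) \<in> S" by simp
  show "(\<lambda>z. f (z, snd q)) field_differentiable at (fst q)"
    by (rule holomorphic2_on_compose[OF assms(2,1) q DERIV_ident DERIV_const])
  show "(\<lambda>w. f (fst q, w)) field_differentiable at (snd q)"
    by (rule holomorphic2_on_compose[OF assms(2,1) q DERIV_const DERIV_ident])
qed

lemma holomorphic2_on_D2: "open S \<Longrightarrow> f holomorphic2_on S \<Longrightarrow> D2 f holomorphic2_on S"
  by (rule holomorphic2_onI[OF _ holomorphic2_family_D2[OF _ holomorphic2_on_family]])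

lemma holomorphic2_on_DERIV:
  assumes "open S" "f holomorphic2_on S" "(z, w) \<in> S"
  shows "((\<lambda>z. f (z, w)) has_field_derivative D1 f (z, w)) (at z)"
    and "((\<lambda>w. f (z, w)) has_field_derivative D2 f (z, w)) (at w)"
  using holomorphic2_familyD(2,3)[OF holomorphic2_on_family[OF assms(1,2), of "{0}"] _ assms(3), of 0]
  by (simp_all add: D1_def D2_def DERIV_deriv_iff_field_differentiable)

lemma holomorphic2_family_integral:
  assumes S: "open S" and F: "holomorphic2_family S {a..b} F"
  defines "G \<equiv> \<lambda>q. integral {a..b} (\<lambda>t. F t q)"
  shows "G holomorphic2_on S"
    and "q \<in> S \<Longrightarrow> D1 G q = integral {a..b} (\<lambda>t. D1 (F t) q)"
    and "q \<in> S \<Longrightarrow> D2 G q = integral {a..b} (\<lambda>t. D2 (F t) q)"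
proof -
  have *: "((\<lambda>z. G (z, w)) has_field_derivative integral {a..b} (\<lambda>t. D1 (F t) (z, w))) (at z) \<and>
     ((\<lambda>w. G (z, w)) has_field_derivative integral {a..b} (\<lambda>t. D2 (F t) (z, w))) (at w)"
    if zw: "(z, w) \<in> S" for z w
  proof -
    obtain r where r: "r > 0" "cball z r \<times> cball w r \<subseteq> S"
      using open_Times_ball[OF S zw] .
    have "((\<lambda>z. integral {a..b} (\<lambda>t. F t (z, w))) has_field_derivative
      integral {a..b} (\<lambda>t. deriv (\<lambda>z. F t (z, w)) z)) (at z)"
    proof (rule has_field_derivative_integral_param[of "ball z r"])
      show "continuous_on (ball z r \<times> {a..b}) (\<lambda>(z, t). F t (z, w))"
        unfolding case_prod_unfold using r
        by (intro continuous_on_compose_Pair[OF holomorphic2_familyD(1)[OF F]])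
           (auto intro!: continuous_intros)
      show "(\<lambda>z. F t (z, w)) holomorphic_on ball z r" if "t \<in> {a..b}" for t
        using r that by (intro holomorphic_on_atI holomorphic2_familyD(2)[OF F]) auto
    qed (use r in auto)
    moreover have "((\<lambda>w. integral {a..b} (\<lambda>t. F t (z, w))) has_field_derivative
      integral {a..b} (\<lambda>t. deriv (\<lambda>w. F t (z, w)) w)) (at w)"
    proof (rule has_field_derivative_integral_param[of "ball w r"])
      show "continuous_on (ball w r \<times> {a..b}) (\<lambda>(w, t). F t (z, w))"
        unfolding case_prod_unfold using r
        by (intro continuous_on_compose_Pair[OF holomorphic2_familyD(1)[OF F]])
           (auto intro!: continuous_intros)
      show "(\<lambda>w. F t (z, w)) holomorphic_on ball w r" if "t \<in> {a..b}" for t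
        using r that by (intro holomorphic_on_atI holomorphic2_familyD(3)[OF F]) auto
    qed (use r in auto)
    ultimately show ?thesis by (simp add: G_def D1_def D2_def)
  qed
  show "G holomorphic2_on S"
  proof (rule holomorphic2_onI[OF S], unfold holomorphic2_family_def, intro conjI ballI)
    have "continuous_on S (\<lambda>q. integral (cbox a b) (\<lambda>t. F t q))"
      using holomorphic2_familyD(1)[OF F] by (intro integral_continuous_on_param) auto
    then show "continuous_on (S \<times> {0::real}) (\<lambda>(q, t). G q)"
      unfolding case_prod_unfold G_def box_real
      by (rule continuous_on_compose2[OF _ continuous_on_fst[OF continuous_on_id]]) auto
  next
    fix q assume "q \<in> S"
    then show "(\<lambda>z. G (z, snd q)) field_differentiable at (fst q)"
      "(\<lambda>w. G (fst q, w)) field_differentiable at (snd q)"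
      using *[of "fst q" "snd q"] unfolding field_differentiable_def by (simp_all, blast+)
  qed
  show "q \<in> S \<Longrightarrow> D1 G q = integral {a..b} (\<lambda>t. D1 (F t) q)"
    "q \<in> S \<Longrightarrow> D2 G q = integral {a..b} (\<lambda>t. D2 (F t) q)"
    using *[of "fst q" "snd q"] unfolding D1_def[of G] D2_def[of G]
    by (simp_all add: DERIV_imp_deriv)
qed

section \<open>Rotational means of eigenfunctions\<close>

text \<open>The parameter is any nonzero complex number, not only a unit one, because the Laurent
  expansion runs over an annulus.\<close>

definition rot2 :: "complex \<Rightarrow> complex \<times> complex \<Rightarrow> complex \<times> complex" where
  "rot2 \<eta> q = (\<eta> * fst q, snd q / \<eta>)"

text \<open>With the weight \<open>cis (n * t)\<close>, a positive n selects the power w^n on the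
  axis z = 0, since the rotation divides the second coordinate. This is the index convention of the
  modes.\<close>

definition fourier_mean :: "int \<Rightarrow> (complex \<times> complex \<Rightarrow> complex) \<Rightarrow> complex \<times> complex \<Rightarrow> complex" where
  "fourier_mean n \<phi> q = integral {0..2 * pi} (\<lambda>t. cis (n * t) * \<phi> (rot2 (cis t) q)) / (2 * of_real pi)"

text \<open>The factor 4 of the operator is divided out, so \<kappa> stands for \<lambda>/4 =
  \<mu>(\<mu> - 1).\<close>

definition eigen2 :: "complex \<Rightarrow> (complex \<times> complex) set \<Rightarrow> (complex \<times> complex \<Rightarrow> complex) \<Rightarrow> bool" where
  "eigen2 \<kappa> S \<phi> \<longleftrightarrow> \<phi> holomorphic2_on S \<and>
     (\<forall>q\<in>S. (1 - fst q * snd q)\<^sup>2 * D1 (D2 \<phi>) q = \<kappa> * \<phi> q)"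

section \<open>Averaging over rotations commutes with the operator\<close>

lemma D1_cong:
  assumes "open S" "q \<in> S" "\<And>q. q \<in> S \<Longrightarrow> f q = g q"
  shows "D1 f q = D1 g q"
  unfolding D1_def
proof (rule deriv_cong_ev)
  obtain r where r: "r > 0" "cball (fst q) r \<times> cball (snd q) r \<subseteq> S"
    using open_Times_ball[of S "fst q" "snd q"] assms(1,2) by auto
  have "\<forall>\<^sub>F z in nhds (fst q). z \<in> ball (fst q) r"
    using r by (intro eventually_nhds_in_open) auto
  then show "\<forall>\<^sub>F z in nhds (fst q). f (z, snd q) = g (z, snd q)"
    by eventually_elim (use r in \<open>auto intro!: assms(3)\<close>)
qed simp

lemma continuous_on_cis_compose [continuous_intros]:
  "continuous_on S f \<Longrightarrow> continuous_on S (\<lambda>x. cis (f x))"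
  unfolding cis_conv_exp by (intro continuous_intros)

text \<open>The weight c is left general so that the lemma can be applied twice: differentiating in
  w replaces c by c / cis t, and the family with this new weight is then differentiated in
  z.\<close>

lemma holomorphic2_family_rot2:
  assumes S: "open S" and f: "f holomorphic2_on S"
    and inv: "\<And>t q. t \<in> T \<Longrightarrow> q \<in> S \<Longrightarrow> rot2 (cis t) q \<in> S"
    and c: "continuous_on T c"
  shows "holomorphic2_family S T (\<lambda>t q. c t * f (rot2 (cis t) q))"
    and "t \<in> T \<Longrightarrow> q \<in> S \<Longrightarrow> D1 (\<lambda>q. c t * f (rot2 (cis t) q)) q = c t * cis t * D1 f (rot2 (cis t) q)"
    and "t \<in> T \<Longrightarrow> q \<in> S \<Longrightarrow> D2 (\<lambda>q. c t * f (rot2 (cis t) q)) q = c t / cis t * D2 f (rot2 (cis t) q)"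
proof -
  have D: "((\<lambda>z. c t * f (rot2 (cis t) (z, snd q))) has_field_derivative c t * cis t * D1 f (rot2 (cis t) q)) (at (fst q))"
    "((\<lambda>w. c t * f (rot2 (cis t) (fst q, w))) has_field_derivative c t / cis t * D2 f (rot2 (cis t) q)) (at (snd q))"
    if "t \<in> T" "q \<in> S" for t q
  proof -
    have q: "(cis t * fst q, snd q / cis t) \<in> S"
      using inv[OF that] by (simp add: rot2_def)
    have 1: "((\<lambda>z. cis t * z) has_field_derivative cis t) (at (fst q))"
      by (auto intro!: derivative_eq_intros)
    have 2: "((\<lambda>w. w / cis t) has_field_derivative 1 / cis t) (at (snd q))"
      by (auto intro!: derivative_eq_intros)
    show "((\<lambda>z. c t * f (rot2 (cis t) (z, snd q))) has_field_derivative c t * cis t * D1 f (rot2 (cis t) q)) (at (fst q))"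
      using DERIV_cmult[OF DERIV_chain2[OF holomorphic2_on_DERIV(1)[OF S f q] 1], of "c t"]
      by (simp add: rot2_def mult_ac)
    show "((\<lambda>w. c t * f (rot2 (cis t) (fst q, w))) has_field_derivative c t / cis t * D2 f (rot2 (cis t) q)) (at (snd q))"
      using DERIV_cmult[OF DERIV_chain2[OF holomorphic2_on_DERIV(2)[OF S f q] 2], of "c t"]
      by (simp add: rot2_def mult_ac)
  qed
  show "t \<in> T \<Longrightarrow> q \<in> S \<Longrightarrow> D1 (\<lambda>q. c t * f (rot2 (cis t) q)) q = c t * cis t * D1 f (rot2 (cis t) q)"
    using D(1) unfolding D1_def[of "\<lambda>q. c t * f (rot2 (cis t) q)"] by (rule DERIV_imp_deriv)
  show "t \<in> T \<Longrightarrow> q \<in> S \<Longrightarrow> D2 (\<lambda>q. c t * f (rot2 (cis t) q)) q = c t / cis t * D2 f (rot2 (cis t) q)"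
    using D(2) unfolding D2_def[of "\<lambda>q. c t * f (rot2 (cis t) q)"] by (rule DERIV_imp_deriv)
  show "holomorphic2_family S T (\<lambda>t q. c t * f (rot2 (cis t) q))"
    unfolding holomorphic2_family_def
  proof (intro conjI ballI)
    have "continuous_on (S \<times> T) (\<lambda>x. rot2 (cis (snd x)) (fst x))"
      unfolding rot2_def by (intro continuous_intros) auto
    then have "continuous_on (S \<times> T) (\<lambda>x. f (rot2 (cis (snd x)) (fst x)))"
      by (rule continuous_on_compose2[OF holomorphic2_on_imp_continuous_on[OF f]]) (use inv in auto)
    moreover have "continuous_on (S \<times> T) (\<lambda>x. c (snd x))"
      by (rule continuous_on_compose2[OF c continuous_on_snd[OF continuous_on_id]]) auto
    ultimately show "continuous_on (S \<times> T) (\<lambda>(q, t). c t * f (rot2 (cis t) q))"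
      unfolding case_prod_unfold by (intro continuous_intros)
  qed (use D field_differentiable_def in blast)+
qed

lemma rot2_invariant_prod: "fst (rot2 (cis t) q) * snd (rot2 (cis t) q) = fst q * snd q"
  by (simp add: rot2_def)

lemma fourier_mean_eq:
  "fourier_mean n \<phi> q = integral {0..2 * pi} (\<lambda>t. cis (n * t) / (2 * of_real pi) * \<phi> (rot2 (cis t) q))"
proof -
  have "integral {0..2 * pi} (\<lambda>t. cis (n * t) / (2 * of_real pi) * \<phi> (rot2 (cis t) q)) =
    integral {0..2 * pi} (\<lambda>t. (1 / (2 * of_real pi)) * (cis (n * t) * \<phi> (rot2 (cis t) q)))"
    by (simp add: field_simps)
  also have "\<dots> = fourier_mean n \<phi> q"
    unfolding fourier_mean_def by (subst integral_mult_right) (simp add: field_simps)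
  finally show ?thesis by simp
qed

text \<open>The factors cis t from \<open>D1\<close> and 1 / cis t from \<open>D2\<close> cancel, so
  the mixed derivative of a rotated function is the rotated mixed derivative.\<close>

lemma
  assumes S: "open S" and f: "\<phi> holomorphic2_on S"
    and inv: "\<And>t q. q \<in> S \<Longrightarrow> rot2 (cis t) q \<in> S"
  shows holomorphic2_on_fourier_mean: "fourier_mean n \<phi> holomorphic2_on S"
    and D1_D2_fourier_mean: "q \<in> S \<Longrightarrow> D1 (D2 (fourier_mean n \<phi>)) q = fourier_mean n (D1 (D2 \<phi>)) q"
proof -
  define c where "c = (\<lambda>t. cis (real_of_int n * t) / (2 * of_real pi))"
  define F where "F = (\<lambda>t q. c t * \<phi> (rot2 (cis t) q))"
  have c: "continuous_on {0..2*pi} c"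
    unfolding c_def by (intro continuous_intros) auto
  have F: "holomorphic2_family S {0..2*pi} F"
    unfolding F_def by (rule holomorphic2_family_rot2[OF S f inv c])
  have G: "fourier_mean n \<phi> = (\<lambda>q. integral {0..2*pi} (\<lambda>t. F t q))"
    by (simp add: fourier_mean_eq F_def c_def fun_eq_iff)
  show "fourier_mean n \<phi> holomorphic2_on S"
    unfolding G by (rule holomorphic2_family_integral(1)[OF S F])
  have f2: "D2 \<phi> holomorphic2_on S"
    by (rule holomorphic2_on_D2[OF S f])
  have c2: "continuous_on {0..2*pi} (\<lambda>t. c t / cis t)"
    by (intro continuous_intros c) auto
  show "D1 (D2 (fourier_mean n \<phi>)) q = fourier_mean n (D1 (D2 \<phi>)) q" if q: "q \<in> S"
  proof -
    have "D1 (D2 (fourier_mean n \<phi>)) q = D1 (\<lambda>q. integral {0..2*pi} (\<lambda>t. D2 (F t) q)) q"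
      using holomorphic2_family_integral(3)[OF S F] by (intro D1_cong[OF S q]) (simp add: G)
    also have "\<dots> = integral {0..2*pi} (\<lambda>t. D1 (D2 (F t)) q)"
      by (rule holomorphic2_family_integral(2)[OF S holomorphic2_family_D2[OF S F] q])
    also have "\<dots> = integral {0..2*pi} (\<lambda>t. c t * D1 (D2 \<phi>) (rot2 (cis t) q))"
    proof (rule integral_cong)
      fix t assume t: "t \<in> {0..2*pi}"
      have "D1 (D2 (F t)) q = D1 (\<lambda>q. c t / cis t * D2 \<phi> (rot2 (cis t) q)) q"
        using holomorphic2_family_rot2(3)[OF S f inv c t]
        by (intro D1_cong[OF S q]) (simp add: F_def)
      also have "\<dots> = c t / cis t * cis t * D1 (D2 \<phi>) (rot2 (cis t) q)"
        by (rule holomorphic2_family_rot2(2)[OF S f2 inv c2 t q])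
      finally show "D1 (D2 (F t)) q = c t * D1 (D2 \<phi>) (rot2 (cis t) q)" by simp
    qed
    finally show ?thesis by (simp add: fourier_mean_eq c_def)
  qed
qed

text \<open>The product zw is invariant under rotation, so (1 - zw)^2 is constant along the orbit
  and passes through the integral.\<close>

lemma eigen2_fourier_mean:
  assumes S: "open S" and f: "eigen2 \<kappa> S \<phi>"
    and inv: "\<And>t q. q \<in> S \<Longrightarrow> rot2 (cis t) q \<in> S"
  shows "eigen2 \<kappa> S (fourier_mean n \<phi>)"
  unfolding eigen2_def
proof (intro conjI ballI)
  have h: "\<phi> holomorphic2_on S"
    and e: "\<And>q. q \<in> S \<Longrightarrow> (1 - fst q * snd q)\<^sup>2 * D1 (D2 \<phi>) q = \<kappa> * \<phi> q"
    using f by (auto simp: eigen2_def)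
  show "fourier_mean n \<phi> holomorphic2_on S"
    by (rule holomorphic2_on_fourier_mean[OF S h inv])
  fix q assume q: "q \<in> S"
  have "(1 - fst q * snd q)\<^sup>2 * D1 (D2 (fourier_mean n \<phi>)) q
    = integral {0..2*pi} (\<lambda>t. (1 - fst q * snd q)\<^sup>2 * (cis (n * t) / (2 * of_real pi) * D1 (D2 \<phi>) (rot2 (cis t) q)))"
    by (simp add: D1_D2_fourier_mean[OF S h inv q] fourier_mean_eq)
  also have "\<dots> = integral {0..2*pi} (\<lambda>t. \<kappa> * (cis (n * t) / (2 * of_real pi) * \<phi> (rot2 (cis t) q)))"
    using e[OF inv[OF q]] by (intro integral_cong) (simp add: rot2_invariant_prod mult_ac)
  also have "\<dots> = \<kappa> * fourier_mean n \<phi> q"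
    by (simp add: fourier_mean_eq)
  finally show "(1 - fst q * snd q)\<^sup>2 * D1 (D2 (fourier_mean n \<phi>)) q = \<kappa> * fourier_mean n \<phi> q" .
qed

text \<open>Orthogonality of characters: among the Taylor terms of u only the power z^(-n) survives
  the mean. Cauchy's formula on the unit circle proves it without interchanging a series and an
  integral.\<close>

lemma integral_cis_Taylor:
  assumes u: "u holomorphic_on ball 0 r" and z: "z \<in> ball 0 r"
  shows "integral {0..2*pi} (\<lambda>t. cis (n * t) * u (cis t * z)) =
    (if n \<le> 0 then 2 * of_real pi * ((deriv ^^ nat (- n)) u 0 / fact (nat (- n))) * z ^ nat (- n) else 0)"
proof -
  define V where "V = {\<eta>. \<eta> * z \<in> ball 0 r}"
  have "V = (\<lambda>\<eta>. \<eta> * z) -` ball 0 r" by (auto simp: V_def)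
  then have V: "open V" by (auto intro!: open_vimage continuous_intros)
  have sub: "cball 0 1 \<subseteq> V"
  proof
    fix \<eta> :: complex assume "\<eta> \<in> cball 0 1"
    then have "norm (\<eta> * z) \<le> norm z" by (simp add: norm_mult mult_left_le_one_le)
    then show "\<eta> \<in> V" using z by (simp add: V_def)
  qed
  \<comment> \<open>Splitting n = m - k with one part zero treats both signs at once: \<eta>^m joins
    the numerator, \<eta>^k the denominator of Cauchy's formula.\<close>
  define m where "m = nat n"
  define k where "k = nat (- n)"
  define v where "v = (\<lambda>\<eta>. \<eta> ^ m * u (\<eta> * z))"
  have hu: "(\<lambda>\<eta>. u (\<eta> * z)) holomorphic_on V"
    by (rule holomorphic_on_compose_gen[OF _ u, of "\<lambda>\<eta>. \<eta> * z", unfolded o_def])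
       (auto simp: V_def intro!: holomorphic_intros)
  then have hv: "v holomorphic_on V"
    unfolding v_def by (intro holomorphic_intros)
  have "((\<lambda>\<eta>. v \<eta> / (\<eta> - 0) ^ Suc k) has_contour_integral 2 * pi * \<i> / fact k * (deriv ^^ k) v 0) (circlepath 0 1)"
    using sub hv
    by (intro Cauchy_has_contour_integral_higher_derivative_circlepath)
       (auto intro!: holomorphic_on_imp_continuous_on elim!: holomorphic_on_subset dest: subsetD[OF ball_subset_cball])
  then have "2 * pi * \<i> / fact k * (deriv ^^ k) v 0 = contour_integral (part_circlepath 0 1 0 (2*pi)) (\<lambda>\<eta>. v \<eta> / \<eta> ^ Suc k)"
    by (simp add: contour_integral_unique circlepath_def)
  also have "\<dots> = integral {0..2*pi} (\<lambda>t. v (cis t) / cis t ^ Suc k * \<i> * cis t)"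
    by (subst contour_integral_part_circlepath_eq) auto
  also have "\<dots> = integral {0..2*pi} (\<lambda>t. \<i> * (cis (n * t) * u (cis t * z)))"
  proof (rule integral_cong)
    fix t :: real
    have "cis (n * t) = cis t ^ m / cis t ^ k"
    proof (cases "n \<ge> 0")
      case True
      then have "real_of_int n = real m" "k = 0" by (auto simp: m_def k_def)
      then show ?thesis by (simp add: Complex.DeMoivre)
    next
      case False
      then have "real_of_int n = - real k" "m = 0" by (auto simp: m_def k_def)
      then show ?thesis by (simp add: Complex.DeMoivre divide_inverse)
    qed
    then show "v (cis t) / cis t ^ Suc k * \<i> * cis t = \<i> * (cis (n * t) * u (cis t * z))"
      by (simp add: v_def)
  qed
  finally have main: "integral {0..2*pi} (\<lambda>t. cis (n * t) * u (cis t * z)) = 2 * pi / fact k * (deriv ^^ k) v 0"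
    by (simp add: field_simps)
  show ?thesis
  proof (cases "n \<le> 0")
    case True
    then have "m = 0" by (simp add: m_def)
    then have "(deriv ^^ k) v 0 = (deriv ^^ k) (\<lambda>\<eta>. u (z * \<eta>)) 0"
      by (simp add: v_def mult.commute)
    also have "\<dots> = z ^ k * (deriv ^^ k) u (z * 0)"
      using V_def z by (intro higher_deriv_compose_linear[OF u V])
        (auto simp: mult.commute intro: le_less_trans[OF norm_ge_zero])
    finally show ?thesis using True main by (simp add: k_def field_simps)
  next
    case False
    then have "k = 0" "m > 0" by (auto simp: m_def k_def)
    \<comment> \<open>Here the formula evaluates v at 0, where the factor \<eta>^m vanishes.\<close>
    then show ?thesis using False main by (simp add: v_def)
  qed
qed

lemma integral_reflect_period:
  fixes g :: "real \<Rightarrow> complex"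
  assumes "continuous_on {0..a} g"
  shows "integral {0..a} (\<lambda>t. g (a - t)) = integral {0..a} g"
proof (cases "0 \<le> a")
  case True
  have "(g has_integral integral {0..a} g) (cbox 0 a)"
    using assms by (auto intro!: integrable_integral integrable_continuous_interval)
  from has_integral_affinity[OF this, of "-1" a]
  have "((\<lambda>t. g (a - t)) has_integral integral {0..a} g) ((\<lambda>x. - x + a) ` {0..a})"
    by simp
  moreover have "(\<lambda>x. - x + a) ` {0..a} = {0..a}"
    using image_affinity_atLeastAtMost[of "-1" a 0 a] True by simp
  ultimately show ?thesis by (simp add: integral_unique)
qed simp

lemma fourier_mean_fst:
  assumes "(\<lambda>z. \<phi> (z, 0)) holomorphic_on ball 0 r" "z \<in> ball 0 r"
  shows "fourier_mean n \<phi> (z, 0) =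
    (if n \<le> 0 then (deriv ^^ nat (- n)) (\<lambda>z. \<phi> (z, 0)) 0 / fact (nat (- n)) * z ^ nat (- n) else 0)"
  unfolding fourier_mean_def using integral_cis_Taylor[OF assms] by (simp add: rot2_def)

lemma cis_minus_2pi: "cis (2 * pi - t) = cis (- t)" "cis (real_of_int n * (2 * pi - t)) = cis (- (n * t))"
proof -
  have "real_of_int n * (2 * pi - t) = 2 * pi * real_of_int n + - (n * t)"
    by (simp add: algebra_simps)
  then show "cis (real_of_int n * (2 * pi - t)) = cis (- (n * t))"
    by (simp only: cis_mult[symmetric] cis_multiple_2pi[OF Ints_of_int] mult_1)
  have "2 * pi - t = 2 * pi * 1 + - t" by simp
  then show "cis (2 * pi - t) = cis (- t)"
    by (simp only: cis_mult[symmetric] cis_multiple_2pi[OF Ints_1] mult_1)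
qed

text \<open>On this axis the rotation divides by cis t; the substitution t -> 2\<pi> - t makes it a
  multiplication and changes n to -n.\<close>

lemma fourier_mean_snd:
  assumes u: "(\<lambda>w. \<phi> (0, w)) holomorphic_on ball 0 r" and w: "w \<in> ball 0 r"
  shows "fourier_mean n \<phi> (0, w) =
    (if n \<ge> 0 then (deriv ^^ nat n) (\<lambda>w. \<phi> (0, w)) 0 / fact (nat n) * w ^ nat n else 0)"
proof -
  define g where "g = (\<lambda>t. cis (real_of_int (- n) * t) * \<phi> (0, cis t * w))"
  have "continuous_on {0..2*pi} (\<lambda>t. \<phi> (0, cis t * w))"
    by (rule continuous_on_compose2[OF holomorphic_on_imp_continuous_on[OF u], of _ "\<lambda>t. cis t * w"])
       (use w in \<open>auto intro!: continuous_intros simp: norm_mult\<close>)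
  then have "continuous_on {0..2*pi} g"
    unfolding g_def by (intro continuous_intros)
  from integral_reflect_period[OF this]
  have "integral {0..2*pi} (\<lambda>t. cis (n * t) * \<phi> (rot2 (cis t) (0, w))) = integral {0..2*pi} g"
    unfolding g_def cis_minus_2pi rot2_def by (simp add: divide_inverse mult_ac)
  then show ?thesis
    unfolding fourier_mean_def using integral_cis_Taylor[OF u w, of "- n"] by (simp add: g_def)
qed

text \<open>Uniqueness for the Goursat problem. If M is the maximum of |\<phi>| on a small closed
  bidisk of radius s, the equation bounds the mixed derivative by 2|\<kappa>|M. Two mean value
  estimates, starting on the axes, take the place of the double integral and give M \<le>
  2|\<kappa>| s^2 M.\<close>

lemma eigen2_zero:
  assumes "r > 0" and f: "eigen2 \<kappa> (ball 0 r \<times> ball 0 r) \<phi>"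
    and z0: "\<And>z. z \<in> ball 0 r \<Longrightarrow> \<phi> (z, 0) = 0" and w0: "\<And>w. w \<in> ball 0 r \<Longrightarrow> \<phi> (0, w) = 0"
  obtains s where "s > 0" "s \<le> r" "\<And>z w. z \<in> ball 0 s \<Longrightarrow> w \<in> ball 0 s \<Longrightarrow> \<phi> (z, w) = 0"
proof -
  define S :: "(complex \<times> complex) set" where "S = ball 0 r \<times> ball 0 r"
  have S: "open S" by (simp add: S_def open_Times)
  have h: "\<phi> holomorphic2_on S"
    and e: "\<And>q. q \<in> S \<Longrightarrow> (1 - fst q * snd q)\<^sup>2 * D1 (D2 \<phi>) q = \<kappa> * \<phi> q"
    using f by (auto simp: eigen2_def S_def)
  \<comment> \<open>r/2 keeps the closed bidisk inside S; 1/2 gives |1 - zw| \<ge> 3/4, whose square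
    exceeds 1/2; the last bound gives 2|\<kappa>|s \<le> 1, hence 2|\<kappa>|s^2 \<le> 1/2.\<close>
  define s where "s = min (r / 2) (min (1 / 2) (1 / (1 + 2 * norm \<kappa>)))"
  have pos: "1 + 2 * norm \<kappa> > 0" by (intro add_pos_nonneg) auto
  have s: "s > 0" "s < r" "s \<le> 1 / 2" "s \<le> 1 / (1 + 2 * norm \<kappa>)"
    using assms(1) pos by (auto simp: s_def)
  define K :: "(complex \<times> complex) set" where "K = cball 0 s \<times> cball 0 s"
  have KS: "K \<subseteq> S" using s by (auto simp: K_def S_def)
  have "compact K" "K \<noteq> {}" using s by (auto simp: K_def compact_Times)
  moreover have "continuous_on K (\<lambda>q. norm (\<phi> q))"
    using holomorphic2_on_imp_continuous_on[OF h] KS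
    by (intro continuous_intros) (auto intro: continuous_on_subset)
  ultimately obtain p where p: "p \<in> K" "\<And>q. q \<in> K \<Longrightarrow> norm (\<phi> q) \<le> norm (\<phi> p)"
    by (meson continuous_attains_sup)
  define M where "M = norm (\<phi> p)"
  have bd: "norm (D1 (D2 \<phi>) q) \<le> 2 * norm \<kappa> * M" if q: "q \<in> K" for q
  proof -
    have "norm (fst q) \<le> 1/2" "norm (snd q) \<le> 1/2"
      using q s by (auto simp: K_def)
    then have "norm (fst q * snd q) \<le> 1/2 * (1/2)"
      unfolding norm_mult by (intro mult_mono) auto
    then have "norm (1 - fst q * snd q) \<ge> 3 / 4"
      using norm_triangle_ineq2[of 1 "fst q * snd q"] by simp
    then have "(3/4)\<^sup>2 \<le> (norm (1 - fst q * snd q))\<^sup>2"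
      by (intro power_mono) auto
    then have "1 / 2 * norm (D1 (D2 \<phi>) q) \<le> (norm (1 - fst q * snd q))\<^sup>2 * norm (D1 (D2 \<phi>) q)"
      by (intro mult_right_mono) (auto simp: power2_eq_square)
    also have "\<dots> = norm \<kappa> * norm (\<phi> q)"
      using e[of q] q KS by (metis norm_mult norm_power subsetD)
    also have "\<dots> \<le> norm \<kappa> * M"
      using p(2)[OF q] by (intro mult_left_mono) (auto simp: M_def)
    finally show ?thesis by simp
  qed
  have b1: "norm (D2 \<phi> (z, w)) \<le> 2 * norm \<kappa> * M * s" if "z \<in> cball 0 s" "w \<in> cball 0 s" for z w
  proof -
    have "norm (D2 \<phi> (z, w) - D2 \<phi> (0, w)) \<le> 2 * norm \<kappa> * M * norm (z - 0)"
    proof (rule field_differentiable_bound[of "cball 0 s" "\<lambda>z. D2 \<phi> (z, w)" "\<lambda>z. D1 (D2 \<phi>) (z, w)"])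
      show "((\<lambda>z. D2 \<phi> (z, w)) has_field_derivative D1 (D2 \<phi>) (z, w)) (at z within cball 0 s)"
        if "z \<in> cball 0 s" for z
        by (rule has_field_derivative_at_within, rule holomorphic2_on_DERIV(1)[OF S holomorphic2_on_D2[OF S h]])
           (use that \<open>w \<in> cball 0 s\<close> KS in \<open>auto simp: K_def\<close>)
    qed (use that s bd in \<open>auto simp: K_def\<close>)
    \<comment> \<open>\<phi>(0, _) vanishes on a whole neighbourhood of w, so its derivative there
      is that of the zero function.\<close>
    moreover have "D2 \<phi> (0, w) = D2 (\<lambda>_. 0) (0, w)"
    proof -
      have "w \<in> ball 0 r" using that s by auto
      moreover have "\<forall>\<^sub>F w in nhds w. w \<in> ball 0 r"
        by (rule eventually_nhds_in_open[OF open_ball]) (use that s in auto)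
      then have "\<forall>\<^sub>F w in nhds w. \<phi> (0, w) = 0"
        by eventually_elim (use w0 in auto)
      then show ?thesis
        unfolding D2_def fst_conv snd_conv by (rule deriv_cong_ev) simp
    qed
    then have "D2 \<phi> (0, w) = 0" by (simp add: D2_def)
    moreover have "2 * norm \<kappa> * M * norm (z - 0) \<le> 2 * norm \<kappa> * M * s"
      using that by (intro mult_left_mono) (auto simp: M_def)
    ultimately show ?thesis by simp
  qed
  have b2: "norm (\<phi> (z, w)) \<le> 2 * norm \<kappa> * M * s * s" if "z \<in> cball 0 s" "w \<in> cball 0 s" for z w
  proof -
    have "norm (\<phi> (z, w) - \<phi> (z, 0)) \<le> 2 * norm \<kappa> * M * s * norm (w - 0)"
    proof (rule field_differentiable_bound[of "cball 0 s" "\<lambda>w. \<phi> (z, w)" "\<lambda>w. D2 \<phi> (z, w)"])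
      show "((\<lambda>w. \<phi> (z, w)) has_field_derivative D2 \<phi> (z, w)) (at w within cball 0 s)"
        if "w \<in> cball 0 s" for w
        by (rule has_field_derivative_at_within, rule holomorphic2_on_DERIV(2)[OF S h])
           (use that \<open>z \<in> cball 0 s\<close> KS in \<open>auto simp: K_def\<close>)
    qed (use that s b1 in auto)
    moreover have "\<phi> (z, 0) = 0" using z0 that s by auto
    moreover have "2 * norm \<kappa> * M * s * norm (w - 0) \<le> 2 * norm \<kappa> * M * s * s"
      using that s by (intro mult_left_mono) (auto simp: M_def)
    ultimately show ?thesis by simp
  qed
  have "M \<le> 2 * norm \<kappa> * M * s * s"
    using p(1) b2[of "fst p" "snd p"] by (auto simp: K_def M_def)
  moreover have "2 * norm \<kappa> * s * s \<le> 1 / 2"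
  proof -
    have "2 * norm \<kappa> * s \<le> 1"
      using s(4) pos s(1) by (simp add: field_simps)
    then have "2 * norm \<kappa> * s * s \<le> 1 * (1 / 2)"
      using s by (intro mult_mono) auto
    then show ?thesis by simp
  qed
  then have "M * (2 * norm \<kappa> * s * s) \<le> M * (1 / 2)"
    by (intro mult_left_mono) (auto simp: M_def)
  ultimately have "M \<le> M / 2" by (simp add: mult_ac)
  then have "M = 0" unfolding M_def by (smt (verit) field_sum_of_halves norm_ge_zero)
  then have "\<phi> (z, w) = 0" if "z \<in> ball 0 s" "w \<in> ball 0 s" for z w
    using p(2)[of "(z, w)"] that by (auto simp: K_def M_def)
  then show ?thesis using that[of s] s by simp
qed

section \<open>Comparison of two eigenfunctions and the identity theorem\<close>

lemma eigen2_subset: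
  "eigen2 \<kappa> S \<phi> \<Longrightarrow> T \<subseteq> S \<Longrightarrow> eigen2 \<kappa> T \<phi>"
  unfolding eigen2_def holomorphic2_on_def by (meson has_derivative_subset subsetD)

lemma D1_D2_diff_cmult:
  assumes S: "open S" and f: "f holomorphic2_on S" and g: "g holomorphic2_on S" and q: "q \<in> S"
  shows "D1 (D2 (\<lambda>q. f q - c * g q)) q = D1 (D2 f) q - c * D1 (D2 g) q"
proof -
  have "D2 (\<lambda>q. f q - c * g q) p = D2 f p - c * D2 g p" if "p \<in> S" for p
  proof -
    have p: "(fst p, snd p) \<in> S" using that by simp
    have "((\<lambda>w. f (fst p, w) - c * g (fst p, w)) has_field_derivative D2 f p - c * D2 g p) (at (snd p))"
      using DERIV_diff[OF holomorphic2_on_DERIV(2)[OF S f p] DERIV_cmult[OF holomorphic2_on_DERIV(2)[OF S g p], of c]]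
      by simp
    then show ?thesis
      unfolding D2_def[of "\<lambda>q. f q - c * g q"] by (rule DERIV_imp_deriv)
  qed
  then have "D1 (D2 (\<lambda>q. f q - c * g q)) q = D1 (\<lambda>q. D2 f q - c * D2 g q) q"
    by (rule D1_cong[OF S q])
  also have "\<dots> = D1 (D2 f) q - c * D1 (D2 g) q"
  proof -
    have p: "(fst q, snd q) \<in> S" using q by simp
    have "((\<lambda>z. D2 f (z, snd q) - c * D2 g (z, snd q)) has_field_derivative D1 (D2 f) q - c * D1 (D2 g) q) (at (fst q))"
      using DERIV_diff[OF holomorphic2_on_DERIV(1)[OF S holomorphic2_on_D2[OF S f] p]
          DERIV_cmult[OF holomorphic2_on_DERIV(1)[OF S holomorphic2_on_D2[OF S g] p], of c]]
      by simp
    then show ?thesis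
      unfolding D1_def[of "\<lambda>q. D2 f q - c * D2 g q"] by (rule DERIV_imp_deriv)
  qed
  finally show ?thesis .
qed

lemma holomorphic2_on_diff_cmult:
  assumes "f holomorphic2_on S" "g holomorphic2_on S"
  shows "(\<lambda>q. f q - c * g q) holomorphic2_on S"
  unfolding holomorphic2_on_def
proof
  fix q assume "q \<in> S"
  then obtain A B A' B' where "(f has_derivative (\<lambda>(h, k). A * h + B * k)) (at q within S)"
    "(g has_derivative (\<lambda>(h, k). A' * h + B' * k)) (at q within S)"
    using assms unfolding holomorphic2_on_def by metis
  from has_derivative_diff[OF this(1) has_derivative_mult_right[OF this(2), of c]]
  have "((\<lambda>q. f q - c * g q) has_derivative (\<lambda>(h, k). (A - c * A') * h + (B - c * B') * k)) (at q within S)"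
    by (rule has_derivative_eq_rhs) (auto simp: fun_eq_iff algebra_simps)
  then show "\<exists>A B. ((\<lambda>q. f q - c * g q) has_derivative (\<lambda>(h, k). A * h + B * k)) (at q within S)" by blast
qed

lemma eigen2_eq_near_0:
  assumes "r > 0" and f: "eigen2 \<kappa> (ball 0 r \<times> ball 0 r) f" and g: "eigen2 \<kappa> (ball 0 r \<times> ball 0 r) g"
    and "\<And>z. z \<in> ball 0 r \<Longrightarrow> f (z, 0) = c * g (z, 0)" "\<And>w. w \<in> ball 0 r \<Longrightarrow> f (0, w) = c * g (0, w)"
  obtains s where "s > 0" "s \<le> r" "\<And>z w. z \<in> ball 0 s \<Longrightarrow> w \<in> ball 0 s \<Longrightarrow> f (z, w) = c * g (z, w)"
proof -
  have S: "open (ball 0 r \<times> ball 0 r :: (complex \<times> complex) set)" by (simp add: open_Times)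
  have "eigen2 \<kappa> (ball 0 r \<times> ball 0 r) (\<lambda>q. f q - c * g q)"
    unfolding eigen2_def
  proof (intro conjI ballI)
    show "(\<lambda>q. f q - c * g q) holomorphic2_on ball 0 r \<times> ball 0 r"
      using f g by (intro holomorphic2_on_diff_cmult) (auto simp: eigen2_def)
    fix q :: "complex \<times> complex" assume q: "q \<in> ball 0 r \<times> ball 0 r"
    have "D1 (D2 (\<lambda>q. f q - c * g q)) q = D1 (D2 f) q - c * D1 (D2 g) q"
      using f g q by (intro D1_D2_diff_cmult[OF S]) (auto simp: eigen2_def)
    then have "(1 - fst q * snd q)\<^sup>2 * D1 (D2 (\<lambda>q. f q - c * g q)) q =
      (1 - fst q * snd q)\<^sup>2 * D1 (D2 f) q - c * ((1 - fst q * snd q)\<^sup>2 * D1 (D2 g) q)"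
      by (simp only: right_diff_distrib mult.left_commute)
    also have "\<dots> = \<kappa> * f q - c * (\<kappa> * g q)"
      using f g q unfolding eigen2_def by metis
    finally show "(1 - fst q * snd q)\<^sup>2 * D1 (D2 (\<lambda>q. f q - c * g q)) q = \<kappa> * (f q - c * g q)"
      by (simp add: algebra_simps)
  qed
  from eigen2_zero[OF assms(1) this] assms(4,5)
  obtain s where "s > 0" "s \<le> r" "\<And>z w. z \<in> ball 0 s \<Longrightarrow> w \<in> ball 0 s \<Longrightarrow> f (z, w) - c * g (z, w) = 0"
    by (metis (no_types, lifting) diff_self)
  then show ?thesis using that by simp
qed

text \<open>Agreement near a point spreads over any ball in S: two points of the ball lie on a
  complex line, whose part inside the ball is convex, and there the one-variable identity theorem
  applies. Connectedness does the rest.\<close>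

lemma holomorphic2_identity:
  assumes S: "open S" "connected S" and f: "f holomorphic2_on S" and g: "g holomorphic2_on S"
    and p: "p \<in> S" "\<forall>\<^sub>F q in nhds p. f q = g q" and q: "q \<in> S"
  shows "f q = g q"
proof -
  \<comment> \<open>Agreement of germs rather than of values: only this property propagates.\<close>
  define P where "P = (\<lambda>q. \<forall>\<^sub>F x in nhds q. f x = g x)"
  have "P q"
  proof (rule connected_induction_simple[OF S(2) p(1) q])
    show "P p" using p by (simp add: P_def)
    fix a assume a: "a \<in> S"
    then obtain r where r: "r > 0" "ball a r \<subseteq> S"
      using S(1) openE by blast
    have eq: "f y = g y" if x: "x \<in> ball a r" "P x" and y: "y \<in> ball a r" for x y
    proof -
      \<comment> \<open>The complex line with L 0 = x and L 1 = y. Being real affine, it pulls the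
        ball back to a convex set of parameters.\<close>
      define L where "L = (\<lambda>t. (fst x + t * (fst y - fst x), snd x + t * (snd y - snd x)))"
      define A where "A = L -` ball a r"
      have contL: "continuous_on UNIV L"
        unfolding L_def by (intro continuous_intros)
      then have A: "open A" unfolding A_def by (intro open_vimage) auto
      have L: "L ((1 - u) *\<^sub>R s + u *\<^sub>R t) = (1 - u) *\<^sub>R L s + u *\<^sub>R L t" for u s t
        by (simp add: L_def scaleR_conv_of_real algebra_simps)
      have "convex A"
        unfolding convex_alt
        using convexD_alt[OF convex_ball, of _ a r] by (auto simp: A_def L)
      then have conn: "connected A" by (rule convex_connected)
      have L01: "L 0 = x" "L 1 = y" by (auto simp: L_def)
      obtain U where U: "open U" "x \<in> U" "\<And>q. q \<in> U \<Longrightarrow> f q = g q"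
        using x(2) unfolding P_def eventually_nhds by blast
      have hol: "(\<lambda>t. h (L t)) holomorphic_on A" if "h holomorphic2_on S" for h
      proof (rule holomorphic_on_atI)
        fix t assume "t \<in> A"
        then have "L t \<in> S" using r by (auto simp: A_def)
        then show "(\<lambda>t. h (L t)) field_differentiable at t"
          unfolding L_def by (intro holomorphic2_on_compose[OF that S(1)]) (auto intro!: derivative_eq_intros)
      qed
      have "f (L 1) = g (L 1)"
      proof (rule analytic_continuation_open[of "A \<inter> L -` U" A "\<lambda>t. f (L t)" "\<lambda>t. g (L t)"])
        show "open (A \<inter> L -` U)"
          using A U(1) contL by (intro open_Int open_vimage) auto
        show "A \<inter> L -` U \<noteq> {}"
          using x U L01 by (auto simp: A_def intro!: exI[of _ 0])
      qed (use A conn hol f g U y L01 in \<open>auto simp: A_def\<close>)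
      then show ?thesis by (simp add: L01)
    qed
    have Pxy: "P y" if "x \<in> ball a r" "y \<in> ball a r" "P x" for x y
      unfolding P_def using eventually_nhds_in_open[OF open_ball that(2)]
      by eventually_elim (rule eq[OF that(1,3)])
    show "\<exists>T. openin (top_of_set S) T \<and> a \<in> T \<and> (\<forall>x\<in>T. \<forall>y\<in>T. P x \<longrightarrow> P y)"
    proof (intro exI conjI ballI impI)
      show "openin (top_of_set S) (ball a r)" using r S(1) by (simp add: openin_open_eq)
    qed (use r in simp, rule Pxy)
  qed
  then show ?thesis
    unfolding P_def by (rule eventually_nhds_x_imp_x)
qed

section \<open>Solutions on the slit domain\<close>

text \<open>The home of x = zw for (z, w) in \<open>Omega_star\<close>. It is star-shaped about 0,
  as integration along rays requires.\<close>

definition slit_plane :: "complex set" where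
  "slit_plane = - of_real ` {1..}"

lemma Omega_star_slit: "q \<in> Omega_star \<longleftrightarrow> fst q * snd q \<in> slit_plane"
  by (auto simp: Omega_star_def slit_plane_def case_prod_unfold)

lemma open_slit_plane: "open slit_plane"
proof -
  have "of_real ` {1..} = {x. Im x = 0 \<and> Re x \<ge> 1}"
    by (auto simp: complex_eq_iff image_iff intro: exI[of _ "Re _"])
  moreover have "closed {x. Im x = 0 \<and> Re x \<ge> 1}"
    by (intro closed_Collect_conj closed_Collect_eq closed_Collect_le continuous_intros)
  ultimately show ?thesis by (simp add: slit_plane_def open_Compl)
qed

lemma slit_plane_scale:
  assumes "x \<in> slit_plane" "0 \<le> s" "s \<le> 1"
  shows "of_real s * x \<in> slit_plane"
proof (rule ccontr)
  assume "of_real s * x \<notin> slit_plane"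
  then obtain r :: real where r: "r \<ge> 1" "of_real s * x = of_real r"
    by (auto simp: slit_plane_def)
  then have "s \<noteq> 0" by auto
  then have "x = of_real (r / s)" using r by (simp add: field_simps)
  moreover have "r / s \<ge> 1" using r assms \<open>s \<noteq> 0\<close> by (simp add: field_simps)
  ultimately have "x \<in> of_real ` {1..}" by (metis atLeast_iff image_eqI)
  then show False using assms(1) by (simp add: slit_plane_def)
qed

lemma slit_plane_0: "0 \<in> slit_plane" and slit_plane_1: "1 \<notin> slit_plane"
  by (auto simp: slit_plane_def image_iff)

lemma open_Omega_star: "open Omega_star"
proof -
  have "Omega_star = (\<lambda>q. fst q * snd q) -` slit_plane"
    by (auto simp: Omega_star_slit)
  moreover have "open ((\<lambda>q :: complex \<times> complex. fst q * snd q) -` slit_plane)"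
    by (intro open_vimage open_slit_plane continuous_intros)
  ultimately show ?thesis by simp
qed

text \<open>The average \<open>moment n \<phi> x = x\<^sup>-\<^sup>n\<^sup>-\<^sup>1 \<integral>\<^sub>0\<^sup>x y\<^sup>n \<phi>(y) dy\<close> solves
  \<open>x u' + (n + 1) u = \<phi>\<close> without a singularity at the origin.\<close>

definition moment :: "nat \<Rightarrow> (complex \<Rightarrow> complex) \<Rightarrow> complex \<Rightarrow> complex" where
  "moment n \<phi> x = integral {0..1} (\<lambda>s. of_real s ^ n * \<phi> (of_real s * x))"

lemma moment_DERIV:
  assumes "\<phi> holomorphic_on slit_plane" "x \<in> slit_plane"
  shows "(moment n \<phi> has_field_derivative moment (Suc n) (deriv \<phi>) x) (at x)"
proof -
  have hol: "(\<lambda>z. of_real s ^ n * \<phi> (of_real s * z)) holomorphic_on slit_plane" if "s \<in> {0..1}" for s :: real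
    using that slit_plane_scale
    by (intro holomorphic_intros holomorphic_on_compose_gen[OF _ assms(1), of "\<lambda>z. of_real s * z", unfolded o_def]) auto
  have "continuous_on (slit_plane \<times> {0..1}) (\<lambda>x. of_real (snd x) ^ n * \<phi> (of_real (snd x) * fst x))"
    by (intro continuous_intros continuous_on_compose2[OF holomorphic_on_imp_continuous_on[OF assms(1)], of _ "\<lambda>x. of_real (snd x) * fst x"])
       (auto intro!: slit_plane_scale)
  then have "((\<lambda>z. integral {0..1} (\<lambda>s. of_real s ^ n * \<phi> (of_real s * z))) has_field_derivative
     integral {0..1} (\<lambda>s. deriv (\<lambda>z. of_real s ^ n * \<phi> (of_real s * z)) x)) (at x)"
    by (intro has_field_derivative_integral_param[OF open_slit_plane assms(2) _ hol]) (auto simp: case_prod_unfold)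
  moreover have "integral {0..1} (\<lambda>s. deriv (\<lambda>z. of_real s ^ n * \<phi> (of_real s * z)) x) = moment (Suc n) (deriv \<phi>) x"
    unfolding moment_def
  proof (rule integral_cong)
    fix s :: real assume s: "s \<in> {0..1}"
    have "(\<phi> has_field_derivative deriv \<phi> (of_real s * x)) (at (of_real s * x))"
      using s slit_plane_scale[OF assms(2)] by (intro holomorphic_derivI[OF assms(1) open_slit_plane]) auto
    from DERIV_cmult[OF DERIV_chain2[OF this DERIV_cmult_Id], of "of_real s ^ n"]
    show "deriv (\<lambda>z. of_real s ^ n * \<phi> (of_real s * z)) x = of_real s ^ Suc n * deriv \<phi> (of_real s * x)"
      by (simp add: DERIV_imp_deriv mult_ac)
  qed
  ultimately show ?thesis by (simp add: moment_def[abs_def])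
qed

lemma moment_holomorphic:
  "\<phi> holomorphic_on slit_plane \<Longrightarrow> moment n \<phi> holomorphic_on slit_plane"
  using moment_DERIV by (meson field_differentiable_def holomorphic_on_atI)

text \<open>Integrate over [0,1] the s-derivative of s^(n+1) \<phi>(s x), which vanishes at s = 0
  and equals \<phi> x at s = 1.\<close>

lemma moment_ode:
  assumes h: "\<phi> holomorphic_on slit_plane" and x: "x \<in> slit_plane"
  shows "x * deriv (moment n \<phi>) x + of_nat (Suc n) * moment n \<phi> x = \<phi> x"
proof -
  define F where "F = (\<lambda>s::real. of_real s ^ Suc n * \<phi> (of_real s * x))"
  define f where "f = (\<lambda>s::real. of_nat (Suc n) * (of_real s ^ n * \<phi> (of_real s * x)) +
      x * (of_real s ^ Suc n * deriv \<phi> (of_real s * x)))"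
  have c: "continuous_on {0..1} (\<lambda>s::real. g (of_real s * x))" if "g holomorphic_on slit_plane" for g
    by (rule continuous_on_compose2[OF holomorphic_on_imp_continuous_on[OF that]])
       (use slit_plane_scale[OF x] in \<open>auto intro!: continuous_intros\<close>)
  have "(f has_integral F 1 - F 0) {0..1}"
  proof (rule fundamental_theorem_of_calculus)
    fix s :: real assume s: "s \<in> {0..1}"
    have "(\<phi> has_field_derivative deriv \<phi> (of_real s * x)) (at (of_real s * x))"
      using s slit_plane_scale[OF x] by (intro holomorphic_derivI[OF h open_slit_plane]) auto
    then have "((\<lambda>y. y ^ Suc n * \<phi> (y * x)) has_field_derivative f s) (at (of_real s))"
      unfolding f_def
      by (auto intro!: derivative_eq_intros DERIV_chain2[where f = \<phi>]) (cases n; simp add: algebra_simps)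
    then show "(F has_vector_derivative f s) (at s within {0..1})"
      unfolding F_def by (rule has_vector_derivative_real_field)
  qed simp
  then have "integral {0..1} f = \<phi> x"
    by (simp add: F_def integral_unique)
  moreover have "integral {0..1} f = of_nat (Suc n) * moment n \<phi> x + x * moment (Suc n) (deriv \<phi>) x"
    unfolding f_def moment_def
    by (subst integral_add)
       (auto intro!: integrable_continuous_interval continuous_intros c h holomorphic_deriv open_slit_plane
             simp del: of_nat_Suc power_Suc)
  ultimately show ?thesis
    by (simp add: DERIV_imp_deriv[OF moment_DERIV[OF h x]] add.commute)
qed

text \<open>A bound proportional to s^m along the ray gains 1/(m+1) by averaging, which is the
  source of the factorial in \<open>picard_bound\<close>. The weight s^n is estimated by 1.\<close>

lemma moment_bound:
  assumes h: "\<phi> holomorphic_on slit_plane" and x: "x \<in> slit_plane"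
    and bd: "\<And>s::real. s \<in> {0..1} \<Longrightarrow> norm (\<phi> (of_real s * x)) \<le> A * s ^ m"
  shows "norm (moment n \<phi> x) \<le> A / (m + 1)"
proof -
  have c: "continuous_on {0..1} (\<lambda>s::real. \<phi> (of_real s * x))"
    by (rule continuous_on_compose2[OF holomorphic_on_imp_continuous_on[OF h]])
       (use slit_plane_scale[OF x] in \<open>auto intro!: continuous_intros\<close>)
  have i: "((\<lambda>s. A * s ^ m) has_integral A * (1 / (m + 1))) {0..1::real}"
  proof -
    have "((\<lambda>s. s ^ m) has_integral 1 ^ Suc m / (m + 1) - 0 ^ Suc m / (m + 1)) {0..1::real}"
      by (rule fundamental_theorem_of_calculus)
         (auto intro!: derivative_eq_intros simp flip: has_real_derivative_iff_has_vector_derivative simp del: power_Suc)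
    then show ?thesis by (intro has_integral_mult_right) simp
  qed
  have "norm (moment n \<phi> x) \<le> integral {0..1} (\<lambda>s. A * s ^ m)"
    unfolding moment_def
  proof (rule integral_norm_bound_integral)
    show "(\<lambda>s. of_real s ^ n * \<phi> (of_real s * x)) integrable_on {0..1}"
      by (intro integrable_continuous_interval continuous_intros c)
    show "(\<lambda>s. A * s ^ m) integrable_on {0..1}" using i by blast
    fix s :: real assume s: "s \<in> {0..1}"
    have "norm (of_real s ^ n * \<phi> (of_real s * x)) \<le> 1 * norm (\<phi> (of_real s * x))"
      unfolding norm_mult norm_power using s by (intro mult_right_mono) (auto simp: power_le_one)
    then show "norm (of_real s ^ n * \<phi> (of_real s * x)) \<le> A * s ^ m"
      using bd[OF s] by simp
  qed
  then show ?thesis unfolding integral_unique[OF i] by simp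
qed

text \<open>With u = H', the equation reads x u' + (n+1) u = \<kappa> H / (1 - x)^2, so u =
  \<open>moment n\<close> of the right-hand side, and H = 1 + x \<open>moment 0\<close> u. The
  function \<open>picard \<kappa> n m\<close> is the m-th term of the resulting Neumann series, not
  its partial sum.\<close>

primrec picard :: "complex \<Rightarrow> nat \<Rightarrow> nat \<Rightarrow> complex \<Rightarrow> complex" where
  "picard \<kappa> n 0 = (\<lambda>x. 1)"
| "picard \<kappa> n (Suc m) = (\<lambda>x. x * moment 0 (moment n (\<lambda>y. \<kappa> * picard \<kappa> n m y / (1 - y)\<^sup>2)) x)"

lemma holomorphic_slit_div:
  "h holomorphic_on slit_plane \<Longrightarrow> (\<lambda>y. \<kappa> * h y / (1 - y)\<^sup>2) holomorphic_on slit_plane"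
  using slit_plane_1 by (auto intro!: holomorphic_intros)

lemma picard_holomorphic: "picard \<kappa> n m holomorphic_on slit_plane"
proof (induction m)
  case (Suc m)
  then show ?case
    by (auto intro!: holomorphic_intros moment_holomorphic holomorphic_slit_div)
qed (simp add: holomorphic_on_const)

lemma picard_Suc_deriv:
  assumes "x \<in> slit_plane"
  shows "(picard \<kappa> n (Suc m) has_field_derivative moment n (\<lambda>y. \<kappa> * picard \<kappa> n m y / (1 - y)\<^sup>2) x) (at x)"
proof -
  let ?u = "moment n (\<lambda>y. \<kappa> * picard \<kappa> n m y / (1 - y)\<^sup>2)"
  have u: "?u holomorphic_on slit_plane"
    by (intro moment_holomorphic holomorphic_slit_div picard_holomorphic)
  have "(moment 0 ?u has_field_derivative deriv (moment 0 ?u) x) (at x)"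
    by (rule holomorphic_derivI[OF moment_holomorphic[OF u] open_slit_plane assms])
  from DERIV_mult[OF DERIV_ident this]
  have "(picard \<kappa> n (Suc m) has_field_derivative x * deriv (moment 0 ?u) x + moment 0 ?u x) (at x)"
    by (simp add: add.commute mult.commute)
  then show ?thesis using moment_ode[OF u assms, of 0] by simp
qed

text \<open>C controls the coefficient on the segment from 0 to x only. The induction runs over all
  points of that segment at once, since the averages at a point use the preceding term along the ray
  below it.\<close>

lemma picard_bound:
  assumes x: "x \<in> slit_plane"
    and C: "\<And>s::real. s \<in> {0..1} \<Longrightarrow> norm (\<kappa> / (1 - of_real s * x)\<^sup>2) \<le> C"
  shows "norm (picard \<kappa> n m x) \<le> (C * norm x) ^ m / fact m"
proof -
  have C0: "C \<ge> 0" using C[of 0] by (smt (verit) atLeastAtMost_iff norm_ge_zero)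
  have "norm (picard \<kappa> n m (of_real s * x)) \<le> (C * norm (of_real s * x)) ^ m / fact m" if "s \<in> {0..1}" for s :: real
    using that
  proof (induction m arbitrary: s)
    case (Suc m)
    let ?g = "\<lambda>y. \<kappa> * picard \<kappa> n m y / (1 - y)\<^sup>2"
    have hg: "?g holomorphic_on slit_plane"
      by (intro holomorphic_slit_div picard_holomorphic)
    have 1: "norm (moment n ?g (of_real t * x)) \<le> C * (C * norm (of_real t * x)) ^ m / fact m" if t: "t \<in> {0..1}" for t :: real
    proof -
      have "norm (moment n ?g (of_real t * x)) \<le> C * (C * norm (of_real t * x)) ^ m / fact m / (m + 1)"
      proof (rule moment_bound[OF hg])
        show "of_real t * x \<in> slit_plane" using t by (auto intro!: slit_plane_scale x)
        fix r :: real assume r: "r \<in> {0..1}"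
        have rt: "r * t \<in> {0..1}" using r t by (auto simp: mult_le_one)
        have "norm (?g (of_real (r * t) * x)) = norm (\<kappa> / (1 - of_real (r * t) * x)\<^sup>2) * norm (picard \<kappa> n m (of_real (r * t) * x))"
          by (simp add: norm_mult norm_divide)
        also have "\<dots> \<le> C * ((C * norm (of_real (r * t) * x)) ^ m / fact m)"
          by (intro mult_mono C Suc.IH rt C0) auto
        also have "\<dots> = C * (C * norm (of_real t * x)) ^ m / fact m * r ^ m"
          using r by (simp add: norm_mult power_mult_distrib mult_ac)
        finally show "norm (?g (of_real r * (of_real t * x))) \<le> C * (C * norm (of_real t * x)) ^ m / fact m * r ^ m"
          by (simp add: mult.assoc)
      qed
      \<comment> \<open>The gain 1/(m+1) of the inner average is given away; the outer average
        supplies the one that the factorial needs.\<close>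
      also have "\<dots> \<le> C * (C * norm (of_real t * x)) ^ m / fact m / 1"
        using C0 by (intro divide_left_mono) auto
      finally show ?thesis by simp
    qed
    have "norm (moment 0 (moment n ?g) (of_real s * x)) \<le> C * (C * norm (of_real s * x)) ^ m / fact m / (m + 1)"
    proof (rule moment_bound[OF moment_holomorphic[OF hg]])
      show "of_real s * x \<in> slit_plane" using Suc.prems by (auto intro!: slit_plane_scale x)
      fix r :: real assume r: "r \<in> {0..1}"
      have rt: "r * s \<in> {0..1}" using r Suc.prems by (auto simp: mult_le_one)
      show "norm (moment n ?g (of_real r * (of_real s * x))) \<le> C * (C * norm (of_real s * x)) ^ m / fact m * r ^ m"
        using 1[OF rt] r by (simp add: norm_mult power_mult_distrib mult_ac)
    qed
    then have "norm (of_real s * x) * norm (moment 0 (moment n ?g) (of_real s * x))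
      \<le> norm (of_real s * x) * (C * (C * norm (of_real s * x)) ^ m / fact m / (m + 1))"
      by (intro mult_left_mono) auto
    then show ?case
      by (simp add: norm_mult mult_ac add.commute)
  qed simp
  from this[of 1] show ?thesis by simp
qed

lemma picard_uniform_limit:
  assumes "x0 \<in> slit_plane"
  shows "\<exists>d>0. cball x0 d \<subseteq> slit_plane \<and>
    uniform_limit (cball x0 d) (\<lambda>N x. \<Sum>m<N. picard \<kappa> n m x) (\<lambda>x. \<Sum>m. picard \<kappa> n m x) sequentially"
proof -
  obtain d where d: "d > 0" "cball x0 d \<subseteq> slit_plane"
    using assms open_slit_plane open_contains_cball by blast
  \<comment> \<open>The union of the segments from 0 to the points of the disk: compact and inside
    the slit plane, so one constant C serves the whole disk.\<close>
  define K where "K = (\<lambda>p. complex_of_real (fst p) * snd p) ` ({0..1} \<times> cball x0 d)"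
  have "compact K"
    unfolding K_def by (intro compact_continuous_image compact_Times continuous_intros) auto
  have K: "K \<subseteq> slit_plane"
    using d slit_plane_scale by (auto simp: K_def)
  have "continuous_on K (\<lambda>y. \<kappa> / (1 - y)\<^sup>2)"
    using K slit_plane_1 by (intro continuous_intros) auto
  then have "bounded ((\<lambda>y. \<kappa> / (1 - y)\<^sup>2) ` K)"
    using \<open>compact K\<close> by (intro compact_imp_bounded compact_continuous_image)
  then obtain C where C: "\<And>y. y \<in> K \<Longrightarrow> norm (\<kappa> / (1 - y)\<^sup>2) \<le> C"
    by (auto simp: bounded_iff)
  have KI: "complex_of_real s * x \<in> K" if "s \<in> {0..1}" "x \<in> cball x0 d" for s x
    unfolding K_def by (rule image_eqI[of _ _ "(s, x)"]) (use that in auto)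
  have C0: "C \<ge> 0"
    by (rule order_trans[OF norm_ge_zero C[OF KI[of 0 x0]]]) (use d in auto)
  define R where "R = norm x0 + d"
  have "uniform_limit (cball x0 d) (\<lambda>N x. \<Sum>m<N. picard \<kappa> n m x) (\<lambda>x. \<Sum>m. picard \<kappa> n m x) sequentially"
  proof (rule Weierstrass_m_test)
    fix m x assume x: "x \<in> cball x0 d"
    have "norm x \<le> R" using x norm_triangle_ineq2[of x x0] by (simp add: R_def dist_norm norm_minus_commute)
    have "norm (picard \<kappa> n m x) \<le> (C * norm x) ^ m / fact m"
      using x d by (intro picard_bound C KI) auto
    also have "\<dots> \<le> (C * R) ^ m / fact m"
      using \<open>norm x \<le> R\<close> C0 by (intro divide_right_mono power_mono mult_left_mono) auto
    finally show "norm (picard \<kappa> n m x) \<le> (C * R) ^ m / fact m" .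
  next
    show "summable (\<lambda>m. (C * R) ^ m / fact m)"
      using summable_exp[of "C * R"] by (simp add: divide_inverse mult.commute)
  qed
  then show ?thesis using d by blast
qed

text \<open>This is the eigenvalue equation for w^n H(zw) with x = zw. Locally uniform convergence
  of the Neumann series carries the first two derivatives of the partial sums to the limit.\<close>

lemma hypergeometric_ode_solution:
  obtains H where "H holomorphic_on slit_plane" "H 0 = 1"
    "\<And>x. x \<in> slit_plane \<Longrightarrow>
       (1 - x)\<^sup>2 * (x * deriv (deriv H) x + of_nat (Suc n) * deriv H x) = \<kappa> * H x"
proof -
  define H where "H = (\<lambda>x. \<Sum>m. picard \<kappa> n m x)"
  define HN where "HN = (\<lambda>N x. \<Sum>m<N. picard \<kappa> n m x)"
  have holN: "HN N holomorphic_on slit_plane" for N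
    unfolding HN_def by (intro holomorphic_intros picard_holomorphic)
  have lim: "\<exists>d>0. cball x d \<subseteq> slit_plane \<and> uniform_limit (cball x d) HN H sequentially"
    if "x \<in> slit_plane" for x
    using picard_uniform_limit[OF that] by (simp add: H_def HN_def)
  have hol: "H holomorphic_on slit_plane"
    by (rule holomorphic_uniform_sequence[OF open_slit_plane holN lim])
  have "H 0 = (\<Sum>m. if m = 0 then 1 else 0)"
    unfolding H_def
  proof (rule suminf_cong)
    show "picard \<kappa> n m 0 = (if m = 0 then 1 else 0)" for m by (cases m) auto
  qed
  also have "\<dots> = 1" by (subst suminf_finite[of "{0}"]) auto
  finally have "H 0 = 1" .
  have ode: "(1 - x)\<^sup>2 * (x * deriv (deriv H) x + of_nat (Suc n) * deriv H x) = \<kappa> * H x"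
    if x: "x \<in> slit_plane" for x
  proof -
    obtain d where d: "d > 0" "cball x d \<subseteq> slit_plane" "uniform_limit (cball x d) HN H sequentially"
      using lim[OF x] by blast
    then have "uniform_limit (ball x d) HN H sequentially"
      by (auto intro: uniform_limit_on_subset)
    have holb: "HN N holomorphic_on ball x d" for N
      by (rule holomorphic_on_subset[OF holN]) (use d in auto)
    have tend: "(\<lambda>N. (deriv ^^ k) (HN N) x) \<longlonglongrightarrow> (deriv ^^ k) H x" for k
      by (rule higher_deriv_complex_uniform_limit[OF \<open>uniform_limit (ball x d) HN H sequentially\<close>])
         (use d holb in auto)
    define u where "u = (\<lambda>m. moment n (\<lambda>y. \<kappa> * picard \<kappa> n m y / (1 - y)\<^sup>2))"
    have hu: "u m holomorphic_on slit_plane" for m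
      unfolding u_def by (intro moment_holomorphic holomorphic_slit_div picard_holomorphic)
    have d1: "deriv (HN (Suc N)) y = (\<Sum>m<N. u m y)" if "y \<in> slit_plane" for N y
    proof -
      have "HN (Suc N) = (\<lambda>x. 1 + (\<Sum>m<N. picard \<kappa> n (Suc m) x))"
        unfolding HN_def by (subst sum.lessThan_Suc_shift) (simp del: picard.simps(2))
      moreover have "((\<lambda>x. 1 + (\<Sum>m<N. picard \<kappa> n (Suc m) x)) has_field_derivative 0 + (\<Sum>m<N. u m y)) (at y)"
        unfolding u_def by (intro DERIV_add DERIV_const DERIV_sum picard_Suc_deriv that)
      ultimately show ?thesis by (simp add: DERIV_imp_deriv)
    qed
    have d2: "deriv (deriv (HN (Suc N))) x = (\<Sum>m<N. deriv (u m) x)" for N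
    proof -
      have "\<forall>\<^sub>F y in nhds x. deriv (HN (Suc N)) y = (\<Sum>m<N. u m y)"
        using eventually_nhds_in_open[OF open_slit_plane x] by eventually_elim (rule d1)
      then have "deriv (deriv (HN (Suc N))) x = deriv (\<lambda>y. \<Sum>m<N. u m y) x"
        by (rule deriv_cong_ev) simp
      also have "\<dots> = (\<Sum>m<N. deriv (u m) x)"
        by (intro DERIV_imp_deriv DERIV_sum holomorphic_derivI[OF hu open_slit_plane x])
      finally show ?thesis .
    qed
    \<comment> \<open>The index shift: N + 1 terms on the left produce N terms on the right, and
      both sides tend to expressions in H.\<close>
    have eq: "(1 - x)\<^sup>2 * (x * deriv (deriv (HN (Suc N))) x + of_nat (Suc n) * deriv (HN (Suc N)) x) = \<kappa> * HN N x" for N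
    proof -
      have "x * deriv (u m) x + of_nat (Suc n) * u m x = \<kappa> * picard \<kappa> n m x / (1 - x)\<^sup>2" for m
        unfolding u_def by (rule moment_ode[OF holomorphic_slit_div[OF picard_holomorphic] x])
      then have "x * (\<Sum>m<N. deriv (u m) x) + of_nat (Suc n) * (\<Sum>m<N. u m x) = (\<Sum>m<N. \<kappa> * picard \<kappa> n m x / (1 - x)\<^sup>2)"
        unfolding sum_distrib_left sum.distrib[symmetric] by simp
      also have "\<dots> = \<kappa> * HN N x / (1 - x)\<^sup>2"
        by (simp add: HN_def sum_distrib_left sum_divide_distrib)
      finally show ?thesis
        using x slit_plane_1 by (auto simp: d1[OF x] d2)
    qed
    have "(\<lambda>N. (1 - x)\<^sup>2 * (x * (deriv ^^ 2) (HN (Suc N)) x + of_nat (Suc n) * (deriv ^^ 1) (HN (Suc N)) x))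
      \<longlonglongrightarrow> (1 - x)\<^sup>2 * (x * (deriv ^^ 2) H x + of_nat (Suc n) * (deriv ^^ 1) H x)"
      by (intro tendsto_intros LIMSEQ_Suc[OF tend])
    moreover have "(\<lambda>N. \<kappa> * (deriv ^^ 0) (HN N) x) \<longlonglongrightarrow> \<kappa> * (deriv ^^ 0) H x"
      by (intro tendsto_intros tend)
    ultimately show ?thesis
      using eq by (auto simp: numeral_2_eq_2 intro: LIMSEQ_unique)
  qed
  show ?thesis by (rule that[OF hol \<open>H 0 = 1\<close> ode])
qed

section \<open>Eigenfunctions built from solutions of the hypergeometric equation\<close>

lemma eigen2I:
  assumes S: "open S" and c: "continuous_on S f"
    and D1: "\<And>z w. (z, w) \<in> S \<Longrightarrow> ((\<lambda>z. f (z, w)) has_field_derivative fz (z, w)) (at z)"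
    and D2: "\<And>z w. (z, w) \<in> S \<Longrightarrow> ((\<lambda>w. f (z, w)) has_field_derivative fw (z, w)) (at w)"
    and D12: "\<And>z w. (z, w) \<in> S \<Longrightarrow> ((\<lambda>z. fw (z, w)) has_field_derivative fzw (z, w)) (at z)"
    and e: "\<And>z w. (z, w) \<in> S \<Longrightarrow> (1 - z * w)\<^sup>2 * fzw (z, w) = \<kappa> * f (z, w)"
  shows "eigen2 \<kappa> S f"
  unfolding eigen2_def
proof (intro conjI ballI)
  show "f holomorphic2_on S"
  proof (rule holomorphic2_onI[OF S], unfold holomorphic2_family_def, intro conjI ballI)
    show "continuous_on (S \<times> {0::real}) (\<lambda>(q, t). f q)"
      unfolding case_prod_unfold
      by (rule continuous_on_compose2[OF c continuous_on_fst[OF continuous_on_id]]) auto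
    fix q assume "q \<in> S"
    then have q: "(fst q, snd q) \<in> S" by simp
    show "(\<lambda>z. f (z, snd q)) field_differentiable at (fst q)"
      using D1[OF q] unfolding field_differentiable_def by blast
    show "(\<lambda>w. f (fst q, w)) field_differentiable at (snd q)"
      using D2[OF q] unfolding field_differentiable_def by blast
  qed
  fix q assume q: "q \<in> S"
  have "D1 (D2 f) q = D1 fw q"
    using D2 by (intro D1_cong[OF S q]) (auto simp: D2_def[of f] DERIV_imp_deriv)
  also have "\<dots> = fzw q"
    using D12[of "fst q" "snd q"] q by (simp add: D1_def DERIV_imp_deriv)
  finally show "(1 - fst q * snd q)\<^sup>2 * D1 (D2 f) q = \<kappa> * f q"
    using e[of "fst q" "snd q"] q by simp
qed

text \<open>With x = zw the mixed derivative is w^n, respectively z^n, times x H'' + (n+1) H'. The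
  two forms serve the modes of nonnegative and nonpositive index.\<close>

lemma eigen2_radial:
  assumes H: "H holomorphic_on slit_plane"
    and ode: "\<And>x. x \<in> slit_plane \<Longrightarrow>
       (1 - x)\<^sup>2 * (x * deriv (deriv H) x + of_nat (Suc n) * deriv H x) = \<kappa> * H x"
  shows "eigen2 \<kappa> Omega_star (\<lambda>q. snd q ^ n * H (fst q * snd q))"
    and "eigen2 \<kappa> Omega_star (\<lambda>q. fst q ^ n * H (fst q * snd q))"
proof -
  have c: "continuous_on Omega_star (\<lambda>q. H (fst q * snd q))"
    by (rule continuous_on_compose2[OF holomorphic_on_imp_continuous_on[OF H]])
       (auto intro!: continuous_intros simp: Omega_star_slit)
  have H': "deriv H holomorphic_on slit_plane"
    by (rule holomorphic_deriv[OF H open_slit_plane])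
  have dH: "((\<lambda>z. H (z * w)) has_field_derivative w * deriv H (z * w)) (at z)"
    "((\<lambda>w. H (z * w)) has_field_derivative z * deriv H (z * w)) (at w)"
    "((\<lambda>z. deriv H (z * w)) has_field_derivative w * deriv (deriv H) (z * w)) (at z)"
    if "(z, w) \<in> Omega_star" for z w
  proof -
    have x: "z * w \<in> slit_plane" using that by (simp add: Omega_star_slit)
    note d = holomorphic_derivI[OF H open_slit_plane x] holomorphic_derivI[OF H' open_slit_plane x]
    have m: "((\<lambda>z. z * w) has_field_derivative w) (at z)" "((\<lambda>w. z * w) has_field_derivative z) (at w)"
      by (auto intro!: derivative_eq_intros)
    show "((\<lambda>z. H (z * w)) has_field_derivative w * deriv H (z * w)) (at z)"
      "((\<lambda>w. H (z * w)) has_field_derivative z * deriv H (z * w)) (at w)"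
      "((\<lambda>z. deriv H (z * w)) has_field_derivative w * deriv (deriv H) (z * w)) (at z)"
      using DERIV_chain2[where g = "\<lambda>z. z * w", OF d(1) m(1)] DERIV_chain2[where g = "\<lambda>w. z * w", OF d(1) m(2)]
        DERIV_chain2[where g = "\<lambda>z. z * w", OF d(2) m(1)]
      by (simp_all add: mult.commute)
  qed
  \<comment> \<open>At n = 0 the exponent \<open>n - 1\<close> truncates to 0, but the factor
    \<open>of_nat n\<close> vanishes, so no case distinction is needed later.\<close>
  have pw: "of_nat n * x ^ (n - 1) * x = of_nat n * x ^ n" for x :: complex
    by (cases n) auto
  show "eigen2 \<kappa> Omega_star (\<lambda>q. snd q ^ n * H (fst q * snd q))"
  proof (rule eigen2I[OF open_Omega_star, where
        fz = "\<lambda>q. snd q ^ n * (snd q * deriv H (fst q * snd q))" and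
        fw = "\<lambda>q. of_nat n * snd q ^ (n - 1) * H (fst q * snd q) + snd q ^ n * (fst q * deriv H (fst q * snd q))" and
        fzw = "\<lambda>q. snd q ^ n * (fst q * snd q * deriv (deriv H) (fst q * snd q) + of_nat (Suc n) * deriv H (fst q * snd q))"],
      goal_cases)
    case 1
    show ?case by (intro continuous_intros c)
  next
    case (2 z w)
    show ?case unfolding fst_conv snd_conv by (intro DERIV_cmult dH 2)
  next
    case (3 z w)
    show ?case unfolding fst_conv snd_conv
      by (rule derivative_eq_intros refl dH(2) 3)+ (simp add: mult_ac)
  next
    case (4 z w)
    have a: "((\<lambda>z. of_nat n * w ^ (n - 1) * H (z * w) + w ^ n * (z * deriv H (z * w))) has_field_derivative
      of_nat n * w ^ (n - 1) * (w * deriv H (z * w)) + w ^ n * (1 * deriv H (z * w) + w * deriv (deriv H) (z * w) * z)) (at z)"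
      by (intro DERIV_add DERIV_cmult DERIV_mult DERIV_ident dH 4)
    have b: "of_nat n * w ^ (n - 1) * (w * deriv H (z * w)) = of_nat n * w ^ n * deriv H (z * w)"
      using pw[of w] by (metis mult.assoc)
    show ?case unfolding fst_conv snd_conv
      by (rule DERIV_cong[OF a], unfold b) (simp add: algebra_simps)
  next
    case (5 z w)
    then show ?case using ode[of "z * w"] by (simp add: Omega_star_slit mult_ac)
  qed
  show "eigen2 \<kappa> Omega_star (\<lambda>q. fst q ^ n * H (fst q * snd q))"
  proof (rule eigen2I[OF open_Omega_star, where
        fz = "\<lambda>q. of_nat n * fst q ^ (n - 1) * H (fst q * snd q) + fst q ^ n * (snd q * deriv H (fst q * snd q))" and
        fw = "\<lambda>q. fst q ^ Suc n * deriv H (fst q * snd q)" and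
        fzw = "\<lambda>q. fst q ^ n * (fst q * snd q * deriv (deriv H) (fst q * snd q) + of_nat (Suc n) * deriv H (fst q * snd q))"],
      goal_cases)
    case 1
    show ?case by (intro continuous_intros c)
  next
    case (2 z w)
    show ?case unfolding fst_conv snd_conv
      by (rule derivative_eq_intros refl dH(1) 2)+ (simp add: mult_ac)
  next
    case (3 z w)
    show ?case unfolding fst_conv snd_conv
      using DERIV_cmult[OF dH(2)[OF 3], of "z ^ n"] by (simp add: mult_ac)
  next
    case (4 z w)
    show ?case unfolding fst_conv snd_conv
      by (rule derivative_eq_intros refl dH(3) 4)+ (simp add: algebra_simps)
  next
    case (5 z w)
    then show ?case using ode[of "z * w"] by (simp add: Omega_star_slit mult_ac)
  qed
qed

section \<open>The Poisson Fourier modes\<close>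

abbreviation bidisk :: "(complex \<times> complex) set" where
  "bidisk \<equiv> ball 0 1 \<times> ball 0 1"

text \<open>Three separate principal powers, as in the integrand of
  \<open>poisson_mode_disk\<close>; on the bidisk none of the three bases meets the branch
  cut.\<close>

definition poisson_kernel :: "complex \<Rightarrow> complex \<times> complex \<Rightarrow> complex" where
  "poisson_kernel \<mu> q = (1 - fst q * snd q) powr \<mu> / ((1 - fst q) powr \<mu> * (1 - snd q) powr \<mu>)"

lemma one_minus_disk:
  fixes z :: complex
  assumes "norm z < 1"
  shows "1 - z \<notin> \<real>\<^sub>\<le>\<^sub>0" "1 - z \<noteq> 0"
proof -
  have "Re z < 1" using assms complex_Re_le_cmod[of z] by linarith
  then show "1 - z \<notin> \<real>\<^sub>\<le>\<^sub>0" "1 - z \<noteq> 0" by (auto simp: complex_nonpos_Reals_iff)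
qed

text \<open>Writing x powr \<mu> / x instead of x powr (\<mu> - 1) lets the power be treated as an
  opaque nonzero constant in the rational identities that follow.\<close>

lemma powr_DERIV:
  fixes x z \<mu> :: complex
  assumes "x \<notin> \<real>\<^sub>\<le>\<^sub>0" "(g has_field_derivative g') (at z)" "g z = x"
  shows "((\<lambda>z. g z powr \<mu>) has_field_derivative \<mu> * (x powr \<mu> / x) * g') (at z)"
proof -
  have "((\<lambda>x. x powr \<mu>) has_field_derivative \<mu> * x powr (\<mu> - 1)) (at (g z))"
    using has_field_derivative_powr[of x \<mu>] assms(1,3) by simp
  from DERIV_chain2[OF this assms(2)] show ?thesis
    using assms(1) by (auto simp: powr_diff)
qed

lemma continuous_on_powr_const:
  fixes \<mu> :: complex
  assumes "continuous_on S f" "\<And>x. x \<in> S \<Longrightarrow> f x \<notin> \<real>\<^sub>\<le>\<^sub>0"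
  shows "continuous_on S (\<lambda>x. f x powr \<mu>)"
proof -
  have "(\<lambda>x. x powr \<mu>) holomorphic_on (- \<real>\<^sub>\<le>\<^sub>0)"
    using has_field_derivative_powr
    by (intro holomorphic_on_atI) (auto simp: field_differentiable_def)
  then show ?thesis
    by (rule continuous_on_compose2[OF holomorphic_on_imp_continuous_on assms(1)])
       (use assms(2) in auto)
qed

lemma norm_mult_bidisk: "q \<in> bidisk \<Longrightarrow> norm (fst q * snd q) < 1"
  using mult_strict_mono'[of "norm (fst q)" 1 "norm (snd q)" 1] by (auto simp: norm_mult)

text \<open>The logarithmic derivative of the kernel P in w is \<mu>(1 - z) / ((1 - zw)(1 - w)),
  symmetrically in z. The product of the two is \<mu>^2 / (1 - zw)^2, and the z-derivative of the
  first is -\<mu> / (1 - zw)^2; so the mixed derivative of P is (\<mu>^2 - \<mu>) P / (1 -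
  zw)^2.\<close>

lemma eigen2_poisson_kernel: "eigen2 (\<mu> * (\<mu> - 1)) bidisk (poisson_kernel \<mu>)"
proof (rule eigen2I[where
      fz = "\<lambda>q. \<mu> * poisson_kernel \<mu> q * (1 - snd q) / ((1 - fst q * snd q) * (1 - fst q))" and
      fw = "\<lambda>q. \<mu> * poisson_kernel \<mu> q * (1 - fst q) / ((1 - fst q * snd q) * (1 - snd q))" and
      fzw = "\<lambda>q. \<mu> * (\<mu> - 1) * poisson_kernel \<mu> q / (1 - fst q * snd q)\<^sup>2"])
  show "open bidisk" by (simp add: open_Times)
  show "continuous_on bidisk (poisson_kernel \<mu>)"
  proof -
    have *: "1 - fst q \<notin> \<real>\<^sub>\<le>\<^sub>0" "1 - snd q \<notin> \<real>\<^sub>\<le>\<^sub>0" "1 - fst q * snd q \<notin> \<real>\<^sub>\<le>\<^sub>0"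
      "1 - fst q \<noteq> 0" "1 - snd q \<noteq> 0" if "q \<in> bidisk" for q
      using one_minus_disk norm_mult_bidisk[OF that] that by (auto simp del: norm_mult)
    then have "(1 - fst q) powr \<mu> * (1 - snd q) powr \<mu> \<noteq> 0" if "q \<in> bidisk" for q
      using that by simp
    with * show ?thesis
      unfolding poisson_kernel_def
      by (intro continuous_on_divide continuous_on_mult continuous_on_powr_const continuous_on_diff
          continuous_on_const continuous_on_fst continuous_on_snd continuous_on_id) auto
  qed
  fix z w assume q: "(z, w) \<in> bidisk"
  have *: "1 - z \<notin> \<real>\<^sub>\<le>\<^sub>0" "1 - z \<noteq> 0" "1 - w \<notin> \<real>\<^sub>\<le>\<^sub>0" "1 - w \<noteq> 0"
    "1 - z * w \<notin> \<real>\<^sub>\<le>\<^sub>0" "1 - z * w \<noteq> 0"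
    using q one_minus_disk[of z] one_minus_disk[of w] one_minus_disk[of "z * w"] norm_mult_bidisk[OF q]
    by (simp_all add: dist_norm)
  \<comment> \<open>Naming the powers leaves only rational identities to be verified.\<close>
  define X Y Z where "X = (1 - z * w) powr \<mu>" and "Y = (1 - z) powr \<mu>" and "Z = (1 - w) powr \<mu>"
  have nz: "X \<noteq> 0" "Y \<noteq> 0" "Z \<noteq> 0" using * by (auto simp: X_def Y_def Z_def powr_eq_0_iff)
  have d: "((\<lambda>z. (1 - z * w) powr \<mu>) has_field_derivative \<mu> * (X / (1 - z * w)) * (- w)) (at z)"
    "((\<lambda>w. (1 - z * w) powr \<mu>) has_field_derivative \<mu> * (X / (1 - z * w)) * (- z)) (at w)"
    "((\<lambda>z. (1 - z) powr \<mu>) has_field_derivative \<mu> * (Y / (1 - z)) * (- 1)) (at z)"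
    "((\<lambda>w. (1 - w) powr \<mu>) has_field_derivative \<mu> * (Z / (1 - w)) * (- 1)) (at w)"
    unfolding X_def Y_def Z_def
    by (rule powr_DERIV; (rule * refl | auto intro!: derivative_eq_intros))+
  show dz: "((\<lambda>z. poisson_kernel \<mu> (z, w)) has_field_derivative
    \<mu> * poisson_kernel \<mu> (z, w) * (1 - snd (z, w)) / ((1 - fst (z, w) * snd (z, w)) * (1 - fst (z, w)))) (at z)"
  proof -
    have "((\<lambda>z. (1 - z * w) powr \<mu> / ((1 - z) powr \<mu> * Z)) has_field_derivative
       (\<mu> * (X / (1 - z * w)) * (- w) * (Y * Z) - X * (\<mu> * (Y / (1 - z)) * (- 1) * Z)) / ((Y * Z) * (Y * Z))) (at z)"
      using nz unfolding X_def[symmetric] Y_def[symmetric]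
      by (intro DERIV_cong[OF DERIV_divide[OF d(1) DERIV_cmult_right[OF d(3), of Z]]])
         (auto simp: X_def Y_def mult_ac)
    moreover have "(\<mu> * (X / (1 - z * w)) * (- w) * (Y * Z) - X * (\<mu> * (Y / (1 - z)) * (- 1) * Z)) / ((Y * Z) * (Y * Z))
      = \<mu> * (X / (Y * Z)) * (1 - w) / ((1 - z * w) * (1 - z))"
      using nz *(2,4,6) by (simp add: divide_simps) (simp add: algebra_simps)
    ultimately show ?thesis
      by (simp add: poisson_kernel_def X_def Y_def Z_def)
  qed
  show "((\<lambda>w. poisson_kernel \<mu> (z, w)) has_field_derivative
    \<mu> * poisson_kernel \<mu> (z, w) * (1 - fst (z, w)) / ((1 - fst (z, w) * snd (z, w)) * (1 - snd (z, w)))) (at w)"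
  proof -
    have "((\<lambda>w. (1 - z * w) powr \<mu> / (Y * (1 - w) powr \<mu>)) has_field_derivative
       (\<mu> * (X / (1 - z * w)) * (- z) * (Y * Z) - X * (Y * (\<mu> * (Z / (1 - w)) * (- 1)))) / ((Y * Z) * (Y * Z))) (at w)"
      using nz
      by (intro DERIV_cong[OF DERIV_divide[OF d(2) DERIV_cmult[OF d(4), of Y]]])
         (auto simp: X_def Z_def mult_ac)
    moreover have "(\<mu> * (X / (1 - z * w)) * (- z) * (Y * Z) - X * (Y * (\<mu> * (Z / (1 - w)) * (- 1)))) / ((Y * Z) * (Y * Z))
      = \<mu> * (X / (Y * Z)) * (1 - z) / ((1 - z * w) * (1 - w))"
      using nz *(2,4,6) by (simp add: divide_simps) (simp add: algebra_simps)
    ultimately show ?thesis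
      by (simp add: poisson_kernel_def X_def Y_def Z_def)
  qed
  show "((\<lambda>z. \<mu> * poisson_kernel \<mu> (z, w) * (1 - fst (z, w)) / ((1 - fst (z, w) * snd (z, w)) * (1 - snd (z, w))))
    has_field_derivative \<mu> * (\<mu> - 1) * poisson_kernel \<mu> (z, w) / (1 - fst (z, w) * snd (z, w))\<^sup>2) (at z)"
  proof -
    define P where "P = poisson_kernel \<mu> (z, w)"
    have r: "((\<lambda>z. (1 - z) / ((1 - z * w) * (1 - w))) has_field_derivative
      (- 1 * ((1 - z * w) * (1 - w)) - (1 - z) * (- w * (1 - w))) / (((1 - z * w) * (1 - w)) * ((1 - z * w) * (1 - w)))) (at z)"
      using * by (intro DERIV_divide) (auto intro!: derivative_eq_intros)
    have "((\<lambda>z. \<mu> * (poisson_kernel \<mu> (z, w) * ((1 - z) / ((1 - z * w) * (1 - w))))) has_field_derivative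
      \<mu> * (\<mu> * P * (1 - w) / ((1 - z * w) * (1 - z)) * ((1 - z) / ((1 - z * w) * (1 - w)))
       + (- 1 * ((1 - z * w) * (1 - w)) - (1 - z) * (- w * (1 - w))) / (((1 - z * w) * (1 - w)) * ((1 - z * w) * (1 - w))) * P)) (at z)"
      unfolding P_def using dz by (intro DERIV_cmult DERIV_mult r) simp
    moreover have "\<mu> * (\<mu> * P * (1 - w) / ((1 - z * w) * (1 - z)) * ((1 - z) / ((1 - z * w) * (1 - w)))
       + (- 1 * ((1 - z * w) * (1 - w)) - (1 - z) * (- w * (1 - w))) / (((1 - z * w) * (1 - w)) * ((1 - z * w) * (1 - w))) * P)
      = \<mu> * (\<mu> - 1) * P / (1 - z * w)\<^sup>2"
      using *(2,4,6) by (simp add: divide_simps power2_eq_square) (simp add: algebra_simps)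
    ultimately show ?thesis unfolding P_def by (simp add: mult.assoc)
  qed
  show "(1 - z * w)\<^sup>2 * (\<mu> * (\<mu> - 1) * poisson_kernel \<mu> (z, w) / (1 - fst (z, w) * snd (z, w))\<^sup>2)
     = \<mu> * (\<mu> - 1) * poisson_kernel \<mu> (z, w)"
    using *(6) by simp
qed

lemma rot2_bidisk: "q \<in> bidisk \<Longrightarrow> rot2 (cis t) q \<in> bidisk"
  by (auto simp: rot2_def norm_mult norm_divide)

text \<open>The defining integral rotates z by e^(-it), the mean by e^(it); reversing the circle
  identifies them. The factor (1 - zw)^\<mu> is rotation invariant and leaves the integral.\<close>

lemma poisson_mode_disk_eq:
  assumes "(z, w) \<in> bidisk"
  shows "poisson_mode_disk \<mu> n z w = fourier_mean n (poisson_kernel \<mu>) (z, w)"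
proof -
  define g where "g = (\<lambda>t. cis (real_of_int n * t) * poisson_kernel \<mu> (rot2 (cis t) (z, w)))"
  have "poisson_kernel \<mu> holomorphic2_on bidisk"
    using eigen2_poisson_kernel by (simp add: eigen2_def)
  then have "continuous_on {0..2*pi} (\<lambda>t. poisson_kernel \<mu> (rot2 (cis t) (z, w)))"
    by (rule continuous_on_compose2[OF holomorphic2_on_imp_continuous_on])
       (use rot2_bidisk[OF assms] in \<open>auto intro!: continuous_intros simp: rot2_def\<close>)
  then have "continuous_on {0..2*pi} g"
    unfolding g_def by (intro continuous_intros)
  then have "integral {0..2*pi} g = integral {0..2*pi} (\<lambda>t. g (2 * pi - t))"
    by (rule integral_reflect_period[symmetric])
  also have "\<dots> = integral {0..2*pi} (\<lambda>t. (1 - z * w) powr \<mu> * (exp (- \<i> * of_int n * of_real t) /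
            ((1 - z * exp (- \<i> * of_real t)) powr \<mu> * (1 - w * exp (\<i> * of_real t)) powr \<mu>)))"
  proof (rule integral_cong)
    fix t :: real
    have "w / cis (- t) = w * exp (\<i> * of_real t)" "cis (- t) = exp (- \<i> * of_real t)"
      by (simp_all add: cis_conv_exp exp_minus field_simps)
    moreover have "cis (- (real_of_int n * t)) = exp (- \<i> * of_int n * of_real t)"
      by (simp add: cis_conv_exp mult_ac)
    ultimately show "g (2 * pi - t) = (1 - z * w) powr \<mu> * (exp (- \<i> * of_int n * of_real t) /
            ((1 - z * exp (- \<i> * of_real t)) powr \<mu> * (1 - w * exp (\<i> * of_real t)) powr \<mu>))"
      unfolding g_def cis_minus_2pi poisson_kernel_def rot2_invariant_prod by (simp add: rot2_def mult_ac)
  qed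
  also have "\<dots> = (1 - z * w) powr \<mu> * integral {0..2*pi} (\<lambda>t. exp (- \<i> * of_int n * of_real t) /
            ((1 - z * exp (- \<i> * of_real t)) powr \<mu> * (1 - w * exp (\<i> * of_real t)) powr \<mu>))"
    by (rule integral_mult_right)
  finally have "fourier_mean n (poisson_kernel \<mu>) (z, w) = (1 - z * w) powr \<mu> * integral {0..2*pi} (\<lambda>t. exp (- \<i> * of_int n * of_real t) /
            ((1 - z * exp (- \<i> * of_real t)) powr \<mu> * (1 - w * exp (\<i> * of_real t)) powr \<mu>)) / (2 * of_real pi)"
    unfolding fourier_mean_def g_def by (simp only:)
  then show ?thesis
    unfolding poisson_mode_disk_def by (simp only: times_divide_eq_left)
qed

section \<open>Values of the modes on the coordinate axes\<close>

lemma higher_deriv_powr: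
  fixes z \<mu> :: complex
  assumes "z \<in> ball 0 1"
  shows "(deriv ^^ k) (\<lambda>z. 1 / (1 - z) powr \<mu>) z = pochhammer \<mu> k / ((1 - z) powr \<mu> * (1 - z) ^ k)"
  using assms
proof (induction k arbitrary: z)
  case (Suc k)
  have *: "1 - z \<notin> \<real>\<^sub>\<le>\<^sub>0" "1 - z \<noteq> 0"
    using Suc.prems one_minus_disk[of z] by (simp_all add: dist_norm)
  have nz: "(1 - z) powr \<mu> \<noteq> 0" using * by simp
  have "\<forall>\<^sub>F z in nhds z. z \<in> ball 0 1"
    by (rule eventually_nhds_in_open[OF open_ball Suc.prems])
  then have "\<forall>\<^sub>F z in nhds z. (deriv ^^ k) (\<lambda>z. 1 / (1 - z) powr \<mu>) z = pochhammer \<mu> k / ((1 - z) powr \<mu> * (1 - z) ^ k)"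
    by eventually_elim (rule Suc.IH)
  then have "deriv ((deriv ^^ k) (\<lambda>z. 1 / (1 - z) powr \<mu>)) z = deriv (\<lambda>z. pochhammer \<mu> k / ((1 - z) powr \<mu> * (1 - z) ^ k)) z"
    by (rule deriv_cong_ev) simp
  also have "\<dots> = pochhammer \<mu> (Suc k) / ((1 - z) powr \<mu> * (1 - z) ^ Suc k)"
  proof (rule DERIV_imp_deriv)
    have m: "((\<lambda>z. 1 - z) has_field_derivative - 1) (at z)"
      by (auto intro!: derivative_eq_intros)
    have 1: "((\<lambda>z. (1 - z) powr \<mu>) has_field_derivative \<mu> * ((1 - z) powr \<mu> / (1 - z)) * (- 1)) (at z)"
      by (rule powr_DERIV[OF *(1) m refl])
    have 2: "((\<lambda>z. (1 - z) ^ k) has_field_derivative - of_nat k * ((1 - z) ^ k / (1 - z))) (at z)"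
      using * by (auto intro!: derivative_eq_intros) (cases k; simp)
    have "((\<lambda>z. pochhammer \<mu> k / ((1 - z) powr \<mu> * (1 - z) ^ k)) has_field_derivative
      (0 * ((1 - z) powr \<mu> * (1 - z) ^ k) - pochhammer \<mu> k * (\<mu> * ((1 - z) powr \<mu> / (1 - z)) * (- 1) * (1 - z) ^ k
        + (- of_nat k * ((1 - z) ^ k / (1 - z))) * (1 - z) powr \<mu>)) /
      (((1 - z) powr \<mu> * (1 - z) ^ k) * ((1 - z) powr \<mu> * (1 - z) ^ k))) (at z)"
      using nz * by (intro DERIV_divide DERIV_mult DERIV_const 1 2) simp
    then show "((\<lambda>z. pochhammer \<mu> k / ((1 - z) powr \<mu> * (1 - z) ^ k)) has_field_derivative
      pochhammer \<mu> (Suc k) / ((1 - z) powr \<mu> * (1 - z) ^ Suc k)) (at z)"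
      by (rule DERIV_cong) (use nz * in \<open>simp add: divide_simps pochhammer_Suc, simp add: algebra_simps\<close>)
  qed
  finally show ?case by simp
qed simp

text \<open>The k-th Taylor coefficient of (1 - z)^(-\<mu>) at 0, and hence the factor in front of
  the monomial to which a mode of index k or -k restricts on an axis.\<close>

definition poisson_coeff :: "complex \<Rightarrow> nat \<Rightarrow> complex" where
  "poisson_coeff \<mu> k = pochhammer \<mu> k / fact k"

text \<open>A zero of the Pochhammer symbol would make \<mu> a nonpositive integer. This licenses
  the division in the definition of the coefficients c_n.\<close>

lemma poisson_coeff_nonzero:
  assumes "Re \<mu> > 0"
  shows "poisson_coeff \<mu> k \<noteq> 0"
  using assms by (auto simp: poisson_coeff_def pochhammer_eq_0_iff)

lemma eigen2_fourier_mean_kernel: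
  "eigen2 (\<mu> * (\<mu> - 1)) bidisk (fourier_mean n (poisson_kernel \<mu>))"
  by (rule eigen2_fourier_mean[OF _ eigen2_poisson_kernel rot2_bidisk]) (simp add: open_Times)

lemma poisson_kernel_axes: "poisson_kernel \<mu> (z, 0) = 1 / (1 - z) powr \<mu>" "poisson_kernel \<mu> (0, w) = 1 / (1 - w) powr \<mu>"
  by (simp_all add: poisson_kernel_def)

lemma holomorphic_inverse_powr: "(\<lambda>z. 1 / (1 - z) powr \<mu>) holomorphic_on ball 0 1"
  using one_minus_disk by (intro holomorphic_intros) (auto simp: powr_eq_0_iff)

lemma fourier_mean_kernel_fst:
  assumes "norm z < 1"
  shows "fourier_mean n (poisson_kernel \<mu>) (z, 0) =
    (if n \<le> 0 then poisson_coeff \<mu> (nat (- n)) * z ^ nat (- n) else 0)"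
  using assms higher_deriv_powr[of 0 "nat (- n)" \<mu>]
  by (subst fourier_mean_fst[of _ 1])
     (auto simp: poisson_kernel_axes holomorphic_inverse_powr poisson_coeff_def)

lemma fourier_mean_kernel_snd:
  assumes "norm w < 1"
  shows "fourier_mean n (poisson_kernel \<mu>) (0, w) =
    (if n \<ge> 0 then poisson_coeff \<mu> (nat n) * w ^ nat n else 0)"
  using assms higher_deriv_powr[of 0 "nat n" \<mu>]
  by (subst fourier_mean_snd[of _ 1])
     (auto simp: poisson_kernel_axes holomorphic_inverse_powr poisson_coeff_def)

lemma bidisk_subset_Omega_star: "bidisk \<subseteq> Omega_star"
proof
  fix q assume "q \<in> bidisk"
  from norm_mult_bidisk[OF this] have "norm (fst q * snd q) < 1" .
  then have "fst q * snd q \<noteq> of_real x" if "x \<ge> 1" for x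
    using that by (metis abs_of_nonneg norm_of_real not_less order_trans zero_le_one)
  then have "fst q * snd q \<notin> of_real ` {1..}" by auto
  then show "q \<in> Omega_star" by (auto simp: Omega_star_def case_prod_unfold)
qed

lemma holomorphic2_on_cmult:
  assumes "f holomorphic2_on S"
  shows "(\<lambda>q. c * f q) holomorphic2_on S"
  unfolding holomorphic2_on_def
proof
  fix q assume "q \<in> S"
  then obtain A B where "(f has_derivative (\<lambda>(h, k). A * h + B * k)) (at q within S)"
    using assms unfolding holomorphic2_on_def by metis
  from has_derivative_mult_right[OF this, of c]
  have "((\<lambda>q. c * f q) has_derivative (\<lambda>(h, k). (c * A) * h + (c * B) * k)) (at q within S)"
    by (rule has_derivative_eq_rhs) (auto simp: fun_eq_iff algebra_simps)
  then show "\<exists>A B. ((\<lambda>q. c * f q) has_derivative (\<lambda>(h, k). A * h + B * k)) (at q within S)" by blast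
qed

text \<open>The witness behind the choice in \<open>poisson_mode\<close>. The candidate and the mean
  of the kernel solve the same equation and agree on the axes, hence near the origin, hence on the
  connected bidisk.\<close>

lemma poisson_mode_extension:
  "\<exists>g. g holomorphic2_on Omega_star \<and> (\<forall>z \<in> ball 0 1. \<forall>w \<in> ball 0 1. g (z, w) = poisson_mode_disk \<mu> n z w)"
proof -
  define \<kappa> where "\<kappa> = \<mu> * (\<mu> - 1)"
  define m where "m = nat \<bar>n\<bar>"
  define P where "P = fourier_mean n (poisson_kernel \<mu>)"
  obtain H where H: "H holomorphic_on slit_plane" "H 0 = 1"
    "\<And>x. x \<in> slit_plane \<Longrightarrow> (1 - x)\<^sup>2 * (x * deriv (deriv H) x + of_nat (Suc m) * deriv H x) = \<kappa> * H x"
    using hypergeometric_ode_solution[of m \<kappa>] by blast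
  define Q where "Q = (\<lambda>q. (if n \<ge> 0 then snd q else fst q) ^ m * H (fst q * snd q))"
  define c where "c = poisson_coeff \<mu> m"
  have Q: "eigen2 \<kappa> Omega_star Q"
    using eigen2_radial[OF H(1,3)] by (cases "n \<ge> 0") (auto simp: Q_def)
  have PB: "eigen2 \<kappa> bidisk P"
    using eigen2_fourier_mean_kernel by (simp add: \<kappa>_def P_def)
  have QB: "eigen2 \<kappa> bidisk Q"
    by (rule eigen2_subset[OF Q bidisk_subset_Omega_star])
  \<comment> \<open>On the axes the argument of H is 0 and H 0 = 1, so Q is a pure monomial there,
    and c adjusts its factor.\<close>
  have ax: "P (z, 0) = c * Q (z, 0)" "P (0, z) = c * Q (0, z)" if "z \<in> ball 0 1" for z
    using that H(2)
    by (auto simp: P_def Q_def c_def m_def fourier_mean_kernel_fst fourier_mean_kernel_snd)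
  obtain s where s: "s > 0" "s \<le> 1" "\<And>z w. z \<in> ball 0 s \<Longrightarrow> w \<in> ball 0 s \<Longrightarrow> P (z, w) = c * Q (z, w)"
    using eigen2_eq_near_0[OF zero_less_one PB QB ax] by blast
  have "P q = c * Q q" if q: "q \<in> bidisk" for q
  proof (rule holomorphic2_identity[of bidisk P _ 0])
    show "connected bidisk" by (intro convex_connected convex_Times) auto
    show "P holomorphic2_on bidisk" "(\<lambda>q. c * Q q) holomorphic2_on bidisk"
      using PB QB by (auto simp: eigen2_def intro!: holomorphic2_on_cmult)
    have "\<forall>\<^sub>F q in nhds 0. q \<in> ball 0 s \<times> ball 0 s"
      using s by (intro eventually_nhds_in_open) (auto simp: open_Times zero_prod_def)
    then show "\<forall>\<^sub>F q in nhds 0. P q = c * Q q"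
      by eventually_elim (use s in auto)
  qed (use q in \<open>auto simp: open_Times zero_prod_def\<close>)
  then show ?thesis
    using Q by (intro exI[of _ "\<lambda>q. c * Q q"])
      (auto simp: eigen2_def poisson_mode_disk_eq P_def intro!: holomorphic2_on_cmult)
qed

lemma poisson_mode_holomorphic: "poisson_mode \<mu> n holomorphic2_on Omega_star"
  and poisson_mode_bidisk: "q \<in> bidisk \<Longrightarrow> poisson_mode \<mu> n q = fourier_mean n (poisson_kernel \<mu>) q"
proof -
  have *: "poisson_mode \<mu> n holomorphic2_on Omega_star \<and>
     (\<forall>z \<in> ball 0 1. \<forall>w \<in> ball 0 1. poisson_mode \<mu> n (z, w) = poisson_mode_disk \<mu> n z w)"
    unfolding poisson_mode_def by (rule someI_ex[OF poisson_mode_extension])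
  then show "poisson_mode \<mu> n holomorphic2_on Omega_star" by simp
  show "q \<in> bidisk \<Longrightarrow> poisson_mode \<mu> n q = fourier_mean n (poisson_kernel \<mu>) q"
    using * by (cases q) (auto simp: poisson_mode_disk_eq)
qed

section \<open>Laurent expansion along rotation orbits\<close>

text \<open>The linear homotopy between the two circles moves every point along its ray, hence
  within the annulus.\<close>

lemma contour_integral_circlepath_annulus:
  assumes V: "open V" and g: "g holomorphic_on V"
    and ann: "\<And>\<eta>. a \<le> norm \<eta> \<Longrightarrow> norm \<eta> \<le> b \<Longrightarrow> \<eta> \<in> V"
    and R: "0 < a" "R \<in> {a..b}" "R' \<in> {a..b}"
  shows "contour_integral (circlepath 0 R) g = contour_integral (circlepath 0 R') g"
proof (rule Cauchy_theorem_homotopic_loops[OF _ V g])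
  show "homotopic_loops V (circlepath 0 R) (circlepath 0 R')"
  proof (rule homotopic_loops_linear)
    fix t :: real
    show "closed_segment (circlepath 0 R t) (circlepath 0 R' t) \<subseteq> V"
    proof
      fix x assume "x \<in> closed_segment (circlepath 0 R t) (circlepath 0 R' t)"
      then obtain u where u: "0 \<le> u" "u \<le> 1"
        "x = (1 - u) *\<^sub>R circlepath 0 R t + u *\<^sub>R circlepath 0 R' t"
        by (auto simp: closed_segment_def)
      define r where "r = (1 - u) * R + u * R'"
      have x: "x = of_real r * exp (2 * of_real pi * \<i> * of_real t)"
        by (simp add: u(3) r_def circlepath scaleR_conv_of_real algebra_simps)
      have "r \<in> {a..b}"
        using convexD_alt[OF convex_real_interval(5) R(2,3) u(1,2)] by (simp add: r_def)
      moreover have "norm x = \<bar>r\<bar>" by (simp add: x norm_mult)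
      ultimately show "x \<in> V" using ann[of x] R(1) by auto
    qed
  qed auto
qed auto

lemma sums_contour_integral_circlepath:
  assumes "0 < R" and c: "\<And>k. continuous_on (sphere 0 R) (g k)"
    and bd: "\<And>k \<zeta>. norm \<zeta> = R \<Longrightarrow> norm (g k \<zeta>) \<le> m k" and m: "summable m"
    and G: "\<And>\<zeta>. norm \<zeta> = R \<Longrightarrow> (\<lambda>k. g k \<zeta>) sums G \<zeta>"
  shows "(\<lambda>k. contour_integral (circlepath 0 R) (g k)) sums contour_integral (circlepath 0 R) G"
proof -
  have int: "g k contour_integrable_on circlepath 0 R" for k
    using c assms(1) by (intro contour_integrable_continuous_circlepath) auto
  have "uniform_limit (sphere 0 R) (\<lambda>N \<zeta>. \<Sum>k<N. g k \<zeta>) (\<lambda>\<zeta>. \<Sum>k. g k \<zeta>) sequentially"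
    by (rule Weierstrass_m_test[OF _ m]) (use bd in auto)
  then have "uniform_limit (sphere 0 R) (\<lambda>N \<zeta>. \<Sum>k<N. g k \<zeta>) G sequentially"
    by (rule uniform_limit_cong'[THEN iffD1, rotated 2]) (use sums_unique[OF G] in auto)
  then have "(\<lambda>N. contour_integral (circlepath 0 R) (\<lambda>\<zeta>. \<Sum>k<N. g k \<zeta>)) \<longlonglongrightarrow> contour_integral (circlepath 0 R) G"
    using int assms(1)
    by (intro contour_integral_uniform_limit_circlepath(2)) (auto intro!: always_eventually contour_integrable_sum)
  then show ?thesis
    unfolding sums_def by (subst (asm) contour_integral_sum) (use int in auto)
qed

text \<open>The orbit of q0 under the unit circle is compact, so the openness of S leaves room in
  both arguments: unit rotations may be fattened to an annulus and q0 to a ball, with one bound M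
  for all.\<close>

lemma rotation_tube:
  assumes S: "open S" and f: "continuous_on S f" and inv: "\<And>\<eta>. norm \<eta> = 1 \<Longrightarrow> rot2 \<eta> q0 \<in> S"
  obtains \<rho> \<delta> M where "\<rho> > 1" "\<delta> > 0" "M \<ge> 0"
    "\<And>\<eta> q. 1 / \<rho> \<le> norm \<eta> \<Longrightarrow> norm \<eta> \<le> \<rho> \<Longrightarrow> q \<in> ball q0 \<delta> \<Longrightarrow> rot2 \<eta> q \<in> S"
    "\<And>\<eta> q. 1 / \<rho> \<le> norm \<eta> \<Longrightarrow> norm \<eta> \<le> \<rho> \<Longrightarrow> q \<in> ball q0 \<delta> \<Longrightarrow> norm (f (rot2 \<eta> q) :: complex) \<le> M"
proof -
  \<comment> \<open>\<eta> = 0 is excluded because \<open>rot2\<close> divides by \<eta>.\<close>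
  define X :: "(complex \<times> complex \<times> complex) set" where "X = (- {0}) \<times> UNIV"
  define r where "r = (\<lambda>p :: complex \<times> complex \<times> complex. rot2 (fst p) (snd p))"
  define W where "W = X \<inter> r -` S"
  have rc: "continuous_on X r"
    unfolding r_def rot2_def X_def by (intro continuous_intros) auto
  have "open W"
    unfolding W_def by (rule continuous_open_preimage[OF rc _ S]) (simp add: X_def open_Times open_Compl)
  moreover have "compact (sphere 0 1 \<times> {q0} :: (complex \<times> complex \<times> complex) set)"
    by (intro compact_Times) auto
  moreover have "sphere 0 1 \<times> {q0} \<subseteq> W"
    using inv by (auto simp: W_def X_def r_def)
  ultimately obtain e where e: "e > 0" "(\<Union>x\<in>sphere 0 1 \<times> {q0}. cball x e) \<subseteq> W"
    by (metis compact_subset_open_imp_cball_epsilon_subset)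
  \<comment> \<open>Half of e is spent on \<eta> and half on q. The inner radius is no worse than
    the outer one, since 1/\<rho> \<ge> 1 - e/2.\<close>
  define \<rho> where "\<rho> = 1 + e / 2"
  have \<rho>: "\<rho> > 1" using e by (simp add: \<rho>_def)
  have inv\<rho>: "1 / \<rho> \<ge> 1 - e / 2"
  proof -
    have "(1 - e / 2) * \<rho> \<le> 1" by (simp add: \<rho>_def algebra_simps)
    then show ?thesis using \<rho> by (simp add: field_simps)
  qed
  define K where "K = (cball 0 \<rho> \<inter> {\<eta>::complex. 1 / \<rho> \<le> norm \<eta>}) \<times> cball q0 (e / 2)"
  have "compact K"
    unfolding K_def
    by (intro compact_Times compact_Int_closed compact_cball closed_Collect_le continuous_intros)
  have KW: "K \<subseteq> W"
  proof
    fix p assume "p \<in> K"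
    then obtain \<eta> q where p: "p = (\<eta>, q)" "norm \<eta> \<le> \<rho>" "1 / \<rho> \<le> norm \<eta>" "dist q0 q \<le> e / 2"
      by (auto simp: K_def)
    have n0: "norm \<eta> > 0" using p(3) \<rho> by (metis divide_pos_pos less_le_trans less_trans zero_less_one)
    \<comment> \<open>\<eta>/|\<eta>| is the point of the unit circle nearest to \<eta>, at distance
      |1 - |\<eta>||.\<close>
    have "\<eta> / of_real (norm \<eta>) - \<eta> = (\<eta> / of_real (norm \<eta>)) * of_real (1 - norm \<eta>)"
      using n0 by (simp add: field_simps)
    then have "dist (\<eta> / of_real (norm \<eta>)) \<eta> = \<bar>1 - norm \<eta>\<bar>"
      using n0 by (simp only: dist_norm norm_mult norm_divide norm_of_real) simp
    also have "\<dots> \<le> e / 2"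
      using p(2) order_trans[OF inv\<rho> p(3)] unfolding \<rho>_def by linarith
    finally have "dist (\<eta> / of_real (norm \<eta>), q0) p \<le> e"
      using p(1,4) sqrt_sum_squares_le_sum[of "dist (\<eta> / of_real (norm \<eta>)) \<eta>" "dist q0 q"]
      by (simp add: dist_Pair_Pair)
    moreover have "(\<eta> / of_real (norm \<eta>), q0) \<in> sphere 0 1 \<times> {q0}"
      using n0 by (simp add: norm_divide)
    ultimately show "p \<in> W" using e(2) by (meson UN_I mem_cball subsetD)
  qed
  have "continuous_on K (\<lambda>p. f (r p))"
    by (rule continuous_on_compose2[OF f continuous_on_subset[OF rc]]) (use KW in \<open>auto simp: W_def\<close>)
  then have "bounded ((\<lambda>p. f (r p)) ` K)"
    using \<open>compact K\<close> by (intro compact_imp_bounded compact_continuous_image)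
  then obtain M where M: "\<And>p. p \<in> K \<Longrightarrow> norm (f (r p)) \<le> M"
    by (auto simp: bounded_iff)
  show ?thesis
  proof (rule that[OF \<rho>, of "e / 2" "max M 0"])
    fix \<eta> :: complex and q assume "1 / \<rho> \<le> norm \<eta>" "norm \<eta> \<le> \<rho>" "q \<in> ball q0 (e / 2)"
    then have K: "(\<eta>, q) \<in> K" by (simp add: K_def)
    show "rot2 \<eta> q \<in> S" using KW K by (auto simp: W_def r_def)
    show "norm (f (rot2 \<eta> q)) \<le> max M 0" using M[OF K] by (simp add: r_def)
  qed (use e in auto)
qed

text \<open>\<open>a n\<close> is the Laurent coefficient at \<eta>^(-n). Cauchy's formula expresses
  v 1 by the integrals of v(\<zeta>)/(\<zeta> - 1) over the circles of radius \<rho> and 1/\<rho>;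
  expanding 1/(\<zeta> - 1) in a geometric series on each circle produces the two sums.\<close>

lemma annulus_laurent:
  assumes V: "open V" and v: "v holomorphic_on V" and \<rho>: "\<rho> > 1"
    and ann: "\<And>\<eta>. 1 / \<rho> \<le> norm \<eta> \<Longrightarrow> norm \<eta> \<le> \<rho> \<Longrightarrow> \<eta> \<in> V"
    and M: "\<And>\<eta>. 1 / \<rho> \<le> norm \<eta> \<Longrightarrow> norm \<eta> \<le> \<rho> \<Longrightarrow> norm (v \<eta>) \<le> M"
  defines "a \<equiv> \<lambda>n::int. contour_integral (circlepath 0 1) (\<lambda>\<eta>. v \<eta> * \<eta> powi (n - 1)) / (2 * of_real pi * \<i>)"
  shows "norm (a n) \<le> M * (1 / \<rho>) ^ nat \<bar>n\<bar>"
    and "v 1 = (\<Sum>k. a (int k)) + (\<Sum>k. a (- int (Suc k)))"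
proof -
  have \<rho>1: "0 < 1 / \<rho>" "1 / \<rho> < 1" "1 / \<rho> \<le> \<rho>" "1 / \<rho> \<in> {1 / \<rho>..\<rho>}" "\<rho> \<in> {1 / \<rho>..\<rho>}" "1 \<in> {1 / \<rho>..\<rho>}"
    using \<rho> by (auto simp: field_simps intro: order_trans[of _ 1] mult_mono[of 1 \<rho> 1 \<rho>, simplified])
  have M0: "M \<ge> 0"
    using M[of 1] \<rho>1 by (auto intro: order_trans[OF norm_ge_zero])
  \<comment> \<open>V may contain 0, where negative powers of \<eta> fail to be holomorphic.\<close>
  define V' where "V' = V - {0}"
  have V': "open V'" using V by (simp add: V'_def open_delete)
  have ann': "\<eta> \<in> V'" if "1 / \<rho> \<le> norm \<eta>" "norm \<eta> \<le> \<rho>" for \<eta>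
    using ann[OF that] that(1) \<rho>1(1) by (auto simp: V'_def)
  have v': "v holomorphic_on V'" using v by (rule holomorphic_on_subset) (auto simp: V'_def)
  have hol: "(\<lambda>\<eta>. v \<eta> * \<eta> powi m) holomorphic_on V'" for m
    by (intro holomorphic_intros v') (auto simp: V'_def)
  have a_eq: "contour_integral (circlepath 0 R) (\<lambda>\<eta>. v \<eta> * \<eta> powi m) = 2 * of_real pi * \<i> * a (m + 1)"
    if "R \<in> {1 / \<rho>..\<rho>}" for R m
    using contour_integral_circlepath_annulus[OF V' hol ann' \<rho>1(1) that \<rho>1(6), of m]
    by (simp add: a_def)
  have bound: "norm (a n) \<le> M * R powi n" if R: "R \<in> {1 / \<rho>..\<rho>}" for n R
  proof -
    have Rpos: "R > 0" using R \<rho>1(1) by (meson atLeastAtMost_iff less_le_trans)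
    have "(\<lambda>\<eta>. v \<eta> * \<eta> powi (n - 1)) contour_integrable_on circlepath 0 R"
      using Rpos R ann' by (intro contour_integrable_holomorphic_simple[OF hol V']) auto
    then have "((\<lambda>\<eta>. v \<eta> * \<eta> powi (n - 1)) has_contour_integral 2 * of_real pi * \<i> * a n) (circlepath 0 R)"
      using a_eq[OF R, of "n - 1"] by (metis diff_add_cancel has_contour_integral_integral)
    then have "norm (2 * of_real pi * \<i> * a n) \<le> M * R powi (n - 1) * (2 * pi * R)"
    proof (rule has_contour_integral_bound_circlepath)
      show "norm (v x * x powi (n - 1)) \<le> M * R powi (n - 1)" if "norm (x - 0) = R" for x
        using that R M[of x] by (auto simp: norm_mult norm_power_int intro!: mult_right_mono)
    qed (use M0 Rpos in auto)
    then have "2 * pi * norm (a n) \<le> 2 * pi * (M * (R powi (n - 1) * R))"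
      by (simp add: norm_mult mult_ac)
    moreover have "R powi (n - 1) * R = R powi n"
      using Rpos by (simp add: power_int_diff)
    ultimately show ?thesis by simp
  qed
  \<comment> \<open>The sign of n chooses the circle, radius 1/\<rho> for n \<ge> 0 and \<rho> for n
    < 0, so that R^n is \<rho>^(-|n|) in both cases.\<close>
  show decay: "norm (a n) \<le> M * (1 / \<rho>) ^ nat \<bar>n\<bar>" for n
  proof (cases "n \<ge> 0")
    case True
    then show ?thesis using bound[OF \<rho>1(4), of n] by (simp add: power_int_def)
  next
    case False
    then show ?thesis using bound[OF \<rho>1(5), of n] by (simp add: power_int_def inverse_eq_divide)
  qed
  have "summable (\<lambda>k. M * (1 / \<rho>) ^ k)"
    using \<rho>1 by (intro summable_mult summable_geometric) auto
  note summ = this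
  have V1: "1 \<in> interior V" using ann[of 1] \<rho>1 V by (simp add: interior_open)
  \<comment> \<open>The difference quotient at 1 with its singularity removed; being holomorphic on
    the whole annulus, it has equal integrals over the two circles.\<close>
  define h where "h = (\<lambda>z. if z = 1 then deriv v 1 else (v z - v 1) / (z - 1))"
  have h: "h holomorphic_on V'"
    unfolding h_def by (rule holomorphic_on_subset[OF pole_lemma[OF v V1]]) (auto simp: V'_def)
  have ne1: "\<zeta> \<noteq> 1" if "norm \<zeta> = R" "R \<noteq> 1" for \<zeta> :: complex and R
    using that by auto
  have split: "contour_integral (circlepath 0 R) h =
      contour_integral (circlepath 0 R) (\<lambda>\<zeta>. v \<zeta> / (\<zeta> - 1)) - v 1 * contour_integral (circlepath 0 R) (\<lambda>\<zeta>. 1 / (\<zeta> - 1))"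
    if R: "R \<in> {1 / \<rho>..\<rho>}" "R \<noteq> 1" for R
  proof -
    have Rpos: "R > 0" using R \<rho>1(1) by (meson atLeastAtMost_iff less_le_trans)
    have c: "continuous_on (sphere 0 R) v"
      by (rule continuous_on_subset[OF holomorphic_on_imp_continuous_on[OF v]]) (use R ann in auto)
    have i1: "(\<lambda>\<zeta>. v \<zeta> / (\<zeta> - 1)) contour_integrable_on circlepath 0 R"
      using Rpos ne1[OF _ R(2)]
      by (intro contour_integrable_continuous_circlepath continuous_intros) (auto intro: c)
    have i2: "(\<lambda>\<zeta>. 1 / (\<zeta> - 1)) contour_integrable_on circlepath 0 R"
      using Rpos ne1[OF _ R(2)]
      by (intro contour_integrable_continuous_circlepath continuous_intros) auto
    have "contour_integral (circlepath 0 R) h = contour_integral (circlepath 0 R) (\<lambda>\<zeta>. v \<zeta> / (\<zeta> - 1) - v 1 * (1 / (\<zeta> - 1)))"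
      by (rule contour_integral_cong) (use Rpos ne1[OF _ R(2)] in \<open>auto simp: h_def diff_divide_distrib\<close>)
    also have "\<dots> = contour_integral (circlepath 0 R) (\<lambda>\<zeta>. v \<zeta> / (\<zeta> - 1)) - contour_integral (circlepath 0 R) (\<lambda>\<zeta>. v 1 * (1 / (\<zeta> - 1)))"
      by (intro contour_integral_diff i1 contour_integrable_lmul i2)
    also have "contour_integral (circlepath 0 R) (\<lambda>\<zeta>. v 1 * (1 / (\<zeta> - 1))) = v 1 * contour_integral (circlepath 0 R) (\<lambda>\<zeta>. 1 / (\<zeta> - 1))"
      by (rule contour_integral_lmul[OF i2])
    finally show ?thesis .
  qed
  \<comment> \<open>1/(\<zeta> - 1) integrates to 2\<pi>i over the outer circle and to 0 over the
    inner one; the equality of the integrals of h therefore isolates v 1.\<close>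
  have out: "contour_integral (circlepath 0 \<rho>) (\<lambda>\<zeta>. 1 / (\<zeta> - 1)) = 2 * of_real pi * \<i>"
    using Cauchy_integral_circlepath_simple[of "\<lambda>_. 1" 0 \<rho> 1] \<rho>
    by (simp add: contour_integral_unique holomorphic_on_const)
  have inn: "contour_integral (circlepath 0 (1 / \<rho>)) (\<lambda>\<zeta>. 1 / (\<zeta> - 1)) = 0"
  proof (rule contour_integral_unique, rule Cauchy_theorem_disc_simple[of _ 0 1])
    show "(\<lambda>\<zeta>. 1 / (\<zeta> - 1)) holomorphic_on ball 0 1"
      by (intro holomorphic_intros) auto
  qed (use \<rho>1 in auto)
  have main: "contour_integral (circlepath 0 \<rho>) (\<lambda>\<zeta>. v \<zeta> / (\<zeta> - 1)) -
      contour_integral (circlepath 0 (1 / \<rho>)) (\<lambda>\<zeta>. v \<zeta> / (\<zeta> - 1)) = 2 * of_real pi * \<i> * v 1"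
    using contour_integral_circlepath_annulus[OF V' h ann' \<rho>1(1) \<rho>1(5) \<rho>1(4)]
      split[OF \<rho>1(4)] split[OF \<rho>1(5)] out inn \<rho> \<rho>1(2) by (simp add: algebra_simps)
  have contR: "continuous_on (sphere 0 R) (\<lambda>\<zeta>. v \<zeta> * \<zeta> powi m)" if "R \<in> {1 / \<rho>..\<rho>}" for R m
    by (rule continuous_on_subset[OF holomorphic_on_imp_continuous_on[OF hol]]) (use that ann' in auto)
  \<comment> \<open>For |\<zeta>| > 1, 1/(\<zeta> - 1) is the sum of \<zeta>^(-k-1), and the
    exponent -k-1 belongs to the coefficient a (-k).\<close>
  have A: "(\<lambda>k. 2 * of_real pi * \<i> * a (- int k)) sums contour_integral (circlepath 0 \<rho>) (\<lambda>\<zeta>. v \<zeta> / (\<zeta> - 1))"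
  proof -
    have "(\<lambda>k. contour_integral (circlepath 0 \<rho>) (\<lambda>\<zeta>. v \<zeta> * \<zeta> powi (- int k - 1))) sums
        contour_integral (circlepath 0 \<rho>) (\<lambda>\<zeta>. v \<zeta> / (\<zeta> - 1))"
    proof (rule sums_contour_integral_circlepath[where m = "\<lambda>k. M * (1 / \<rho>) ^ k"])
      fix \<zeta> :: complex assume \<zeta>: "norm \<zeta> = \<rho>"
      then have z0: "\<zeta> \<noteq> 0" "\<zeta> \<noteq> 1" using \<rho> by auto
      have pe: "\<zeta> powi (- int k - 1) = (1 / \<zeta>) ^ Suc k" for k
      proof -
        have "- int k - 1 = - int (Suc k)" by simp
        then show ?thesis by (simp only: power_int_minus power_int_of_nat power_one_over inverse_eq_divide)
      qed
      show "norm (v \<zeta> * \<zeta> powi (- int k - 1)) \<le> M * (1 / \<rho>) ^ k" for k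
        unfolding norm_mult
      proof (intro mult_mono)
        show "norm (v \<zeta>) \<le> M" using M[of \<zeta>] \<zeta> \<rho>1 by auto
        have "norm (\<zeta> powi (- int k - 1)) = (1 / \<rho>) * (1 / \<rho>) ^ k"
          by (simp add: pe norm_power norm_divide norm_mult \<zeta>)
        also have "\<dots> \<le> 1 * (1 / \<rho>) ^ k"
          using \<rho>1 by (intro mult_right_mono) auto
        finally show "norm (\<zeta> powi (- int k - 1)) \<le> (1 / \<rho>) ^ k" by simp
      qed (use M0 in auto)
      have "(\<lambda>k. (1 / \<zeta>) ^ k) sums (1 / (1 - 1 / \<zeta>))"
        using \<rho>1 \<zeta> by (intro geometric_sums) (simp add: norm_divide)
      from sums_mult[OF this, of "v \<zeta> * (1 / \<zeta>)"]
      have "(\<lambda>k. v \<zeta> * (1 / \<zeta>) * (1 / \<zeta>) ^ k) sums (v \<zeta> * (1 / \<zeta>) * (1 / (1 - 1 / \<zeta>)))" .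
      moreover have "v \<zeta> * (1 / \<zeta>) * (1 / (1 - 1 / \<zeta>)) = v \<zeta> / (\<zeta> - 1)"
        using z0 by (simp add: field_simps)
      ultimately have "(\<lambda>k. v \<zeta> * (1 / \<zeta>) * (1 / \<zeta>) ^ k) sums (v \<zeta> / (\<zeta> - 1))"
        by (simp only:)
      then show "(\<lambda>k. v \<zeta> * \<zeta> powi (- int k - 1)) sums (v \<zeta> / (\<zeta> - 1))"
        by (simp only: pe power_Suc mult.assoc)
    qed (use \<rho> summ contR[OF \<rho>1(5)] in auto)
    then show ?thesis by (simp add: a_eq[OF \<rho>1(5)])
  qed
  \<comment> \<open>For |\<zeta>| < 1, 1/(\<zeta> - 1) is minus the sum of \<zeta>^k, and the
    exponent k belongs to a (k+1).\<close>
  have B: "(\<lambda>k. - (2 * of_real pi * \<i> * a (int k + 1))) sums contour_integral (circlepath 0 (1 / \<rho>)) (\<lambda>\<zeta>. v \<zeta> / (\<zeta> - 1))"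
  proof -
    have "(\<lambda>k. contour_integral (circlepath 0 (1 / \<rho>)) (\<lambda>\<zeta>. - (v \<zeta> * \<zeta> powi int k))) sums
        contour_integral (circlepath 0 (1 / \<rho>)) (\<lambda>\<zeta>. v \<zeta> / (\<zeta> - 1))"
    proof (rule sums_contour_integral_circlepath[where m = "\<lambda>k. M * (1 / \<rho>) ^ k"])
      fix \<zeta> :: complex assume \<zeta>: "norm \<zeta> = 1 / \<rho>"
      then have z0: "\<zeta> \<noteq> 1" using \<rho>1 by auto
      show "norm (- (v \<zeta> * \<zeta> powi int k)) \<le> M * (1 / \<rho>) ^ k" for k
        using M[of \<zeta>] \<zeta> \<rho>1 by (auto simp: norm_mult norm_power intro!: mult_right_mono)
      have "(\<lambda>k. \<zeta> ^ k) sums (1 / (1 - \<zeta>))"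
        using \<rho>1 \<zeta> by (intro geometric_sums) simp
      from sums_mult[OF this, of "- v \<zeta>"]
      have "(\<lambda>k. - v \<zeta> * \<zeta> ^ k) sums (- v \<zeta> * (1 / (1 - \<zeta>)))" .
      moreover have "- v \<zeta> * (1 / (1 - \<zeta>)) = v \<zeta> / (\<zeta> - 1)"
        using z0 by (simp add: divide_simps) (simp add: algebra_simps)
      ultimately show "(\<lambda>k. - (v \<zeta> * \<zeta> powi int k)) sums (v \<zeta> / (\<zeta> - 1))" by simp
    next
      show "continuous_on (sphere 0 (1 / \<rho>)) (\<lambda>\<zeta>. - (v \<zeta> * \<zeta> powi int k))" for k
        by (intro continuous_on_minus contR \<rho>1)
    qed (use \<rho>1 summ in auto)
    moreover have "contour_integral (circlepath 0 (1 / \<rho>)) (\<lambda>\<zeta>. - (v \<zeta> * \<zeta> powi int k)) = - (2 * of_real pi * \<i> * a (int k + 1))" for k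
    proof -
      have "contour_integral (circlepath 0 (1 / \<rho>)) (\<lambda>\<zeta>. - (v \<zeta> * \<zeta> powi int k)) =
        - contour_integral (circlepath 0 (1 / \<rho>)) (\<lambda>\<zeta>. v \<zeta> * \<zeta> powi int k)"
        by (rule contour_integral_neg)
      then show ?thesis by (simp only: a_eq[OF \<rho>1(4)])
    qed
    ultimately show ?thesis by simp
  qed
  have "(\<lambda>k. 2 * of_real pi * \<i> * (a (- int k) + a (int k + 1))) sums (2 * of_real pi * \<i> * v 1)"
    using sums_diff[OF A B] unfolding main diff_minus_eq_add distrib_left[symmetric] .
  then have S: "(\<lambda>k. a (- int k) + a (int k + 1)) sums v 1"
    by (subst (asm) sums_mult_iff) auto
  have sm: "summable (\<lambda>k. a (int k))" "summable (\<lambda>k. a (- int (Suc k)))"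
    "summable (\<lambda>k. a (- int k))" "summable (\<lambda>k. a (int k + 1))"
  proof -
    show 1: "summable (\<lambda>k. a (int k))"
      by (rule summable_comparison_test'[OF summ, of 0]) (use decay[of "int _"] in simp)
    show 2: "summable (\<lambda>k. a (- int k))"
      by (rule summable_comparison_test'[OF summ, of 0]) (use decay[of "- int _"] in simp)
    show "summable (\<lambda>k. a (- int (Suc k)))" using summable_Suc_iff[of "\<lambda>k. a (- int k)"] 2 by simp
    show "summable (\<lambda>k. a (int k + 1))" using summable_Suc_iff[of "\<lambda>k. a (int k)"] 1 by (simp add: add.commute)
  qed
  \<comment> \<open>The contours group index 0 with the negative indices, the claim with the
    positive ones; a 0 is moved across.\<close>
  have "v 1 = (\<Sum>k. a (- int k)) + (\<Sum>k. a (int k + 1))"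
    using sums_unique[OF S] suminf_add[OF sm(3,4)] by simp
  also have "(\<Sum>k. a (- int k)) = a 0 + (\<Sum>k. a (- int (Suc k)))"
    using suminf_split_head[OF sm(3)] by simp
  also have "(\<Sum>k. a (int k + 1)) = (\<Sum>k. a (int k)) - a 0"
    using suminf_split_head[OF sm(1)] by (simp add: add.commute)
  finally show "v 1 = (\<Sum>k. a (int k)) + (\<Sum>k. a (- int (Suc k)))" by simp
qed

lemma fourier_mean_contour:
  "fourier_mean n f q = contour_integral (circlepath 0 1) (\<lambda>\<eta>. f (rot2 \<eta> q) * \<eta> powi (n - 1)) / (2 * of_real pi * \<i>)"
proof -
  have "contour_integral (circlepath 0 1) (\<lambda>\<eta>. f (rot2 \<eta> q) * \<eta> powi (n - 1)) =
    integral {0..2*pi} (\<lambda>t. f (rot2 (cis t) q) * cis t powi (n - 1) * \<i> * cis t)"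
    unfolding circlepath_def by (subst contour_integral_part_circlepath_eq) auto
  also have "\<dots> = integral {0..2*pi} (\<lambda>t. \<i> * (cis (n * t) * f (rot2 (cis t) q)))"
  proof (rule integral_cong)
    fix t :: real
    have "cis t powi (n - 1) * cis t = cis (n * t)"
      by (simp add: cis_power_int cis_mult algebra_simps)
    then show "f (rot2 (cis t) q) * cis t powi (n - 1) * \<i> * cis t = \<i> * (cis (n * t) * f (rot2 (cis t) q))"
      by (metis mult.assoc mult.commute)
  qed
  finally show ?thesis by (simp add: fourier_mean_def)
qed

text \<open>The Laurent expansion of \<eta> -> f(rot2 \<eta> q), evaluated at \<eta> = 1. The tube
  around the orbit of q0 supplies the same annulus and the same M for all nearby q, so the geometric
  decay is locally uniform.\<close>

lemma fourier_mean_series: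
  assumes S: "open S" and f: "f holomorphic2_on S" and q0: "q0 \<in> S"
    and inv: "\<And>\<eta>. norm \<eta> = 1 \<Longrightarrow> rot2 \<eta> q0 \<in> S"
  obtains U M r where "open U" "q0 \<in> U" "U \<subseteq> S" "0 < r" "r < 1"
    "\<And>n q. q \<in> U \<Longrightarrow> norm (fourier_mean n f q) \<le> M * r ^ nat \<bar>n\<bar>"
    "\<And>q. q \<in> U \<Longrightarrow> f q = (\<Sum>k. fourier_mean (int k) f q) + (\<Sum>k. fourier_mean (- int (Suc k)) f q)"
proof -
  obtain \<rho> \<delta> M where \<rho>: "\<rho> > 1" "\<delta> > 0" "M \<ge> 0"
    and inS: "\<And>\<eta> q. 1 / \<rho> \<le> norm \<eta> \<Longrightarrow> norm \<eta> \<le> \<rho> \<Longrightarrow> q \<in> ball q0 \<delta> \<Longrightarrow> rot2 \<eta> q \<in> S"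
    and M: "\<And>\<eta> q. 1 / \<rho> \<le> norm \<eta> \<Longrightarrow> norm \<eta> \<le> \<rho> \<Longrightarrow> q \<in> ball q0 \<delta> \<Longrightarrow> norm (f (rot2 \<eta> q)) \<le> M"
    using rotation_tube[OF S holomorphic2_on_imp_continuous_on[OF f] inv] by metis
  have one: "rot2 1 q = q" for q by (simp add: rot2_def)
  have L: "norm (fourier_mean n f q) \<le> M * (1 / \<rho>) ^ nat \<bar>n\<bar>"
    "f q = (\<Sum>k. fourier_mean (int k) f q) + (\<Sum>k. fourier_mean (- int (Suc k)) f q)"
    if q: "q \<in> ball q0 \<delta>" for n q
  proof -
    define V where "V = {\<eta>. \<eta> \<noteq> 0 \<and> rot2 \<eta> q \<in> S}"
    have "V = (- {0}) \<inter> (\<lambda>\<eta>. rot2 \<eta> q) -` S" by (auto simp: V_def)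
    moreover have "continuous_on (- {0}) (\<lambda>\<eta>. rot2 \<eta> q)"
      unfolding rot2_def by (intro continuous_intros) auto
    ultimately have V: "open V"
      using continuous_open_preimage[OF _ _ S, of "- {0}" "\<lambda>\<eta>. rot2 \<eta> q"] by auto
    have hol: "(\<lambda>\<eta>. f (rot2 \<eta> q)) holomorphic_on V"
    proof (rule holomorphic_on_atI)
      fix \<eta> assume "\<eta> \<in> V"
      then have "\<eta> \<noteq> 0" "(\<eta> * fst q, snd q / \<eta>) \<in> S" by (auto simp: V_def rot2_def)
      then show "(\<lambda>\<eta>. f (rot2 \<eta> q)) field_differentiable at \<eta>"
        unfolding rot2_def
        by (intro holomorphic2_on_compose[OF f S]) (auto intro!: derivative_eq_intros)
    qed
    have ann: "\<eta> \<in> V" if "1 / \<rho> \<le> norm \<eta>" "norm \<eta> \<le> \<rho>" for \<eta>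
      using inS[OF that q] that(1) \<rho>(1) by (auto simp: V_def)
    note laurent = annulus_laurent[OF V hol \<rho>(1) ann M[OF _ _ q]]
    show "norm (fourier_mean n f q) \<le> M * (1 / \<rho>) ^ nat \<bar>n\<bar>"
      unfolding fourier_mean_contour by (rule laurent(1))
    show "f q = (\<Sum>k. fourier_mean (int k) f q) + (\<Sum>k. fourier_mean (- int (Suc k)) f q)"
      using laurent(2) unfolding fourier_mean_contour one .
  qed
  show ?thesis
  proof (rule that[of "ball q0 \<delta>" "1 / \<rho>" M])
    show "ball q0 \<delta> \<subseteq> S" using inS[of 1] \<rho> by (auto simp: one)
  qed (use \<rho> L in auto)
qed

section \<open>Charts of the manifold\<close>

lemma topspace_sphere_top [simp]: "topspace sphere_top = UNIV"
  by (auto simp: sphere_top_def) (metis not_None_eq rangeI)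

lemma topspace_sphere2_top [simp]: "topspace sphere2_top = UNIV"
  by (simp add: sphere2_top_def)

section \<open>Topology near infinity and the two parametrizations\<close>

lemma openin_sphere_top:
  "openin sphere_top T \<longleftrightarrow>
     (\<exists>U. open U \<and> T = Some ` U) \<or> (\<exists>C. compact C \<and> T = insert None (Some ` (- C)))"
  by (auto simp: sphere_top_def openin_Alexandroff_compactification compact_imp_closed Compl_eq_Diff_UNIV)

lemma sphere_inverse_involution [simp]: "sphere_inverse (sphere_inverse x) = x"
  by (cases x) auto

lemma open_inverse_preimage:
  fixes U :: "complex set"
  assumes "open U"
  shows "open {z. z \<noteq> 0 \<and> inverse z \<in> U}"
proof -
  have "open (- {0} \<inter> inverse -` U)"
    by (intro continuous_open_preimage assms continuous_intros) auto
  then show ?thesis by (simp add: Int_def vimage_def)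
qed

lemma continuous_map_sphere_inverse_Some:
  "continuous_map euclidean sphere_top (\<lambda>z. sphere_inverse (Some z))"
  unfolding continuous_map_def
proof (intro conjI allI impI)
  fix T assume "openin sphere_top T"
  then consider (fin) U where "open U" "T = Some ` U" | (inf) C where "compact C" "T = insert None (Some ` (- C))"
    by (auto simp: openin_sphere_top)
  then have "open {z. sphere_inverse (Some z) \<in> T}"
  proof cases
    case fin
    then have "{z. sphere_inverse (Some z) \<in> T} = {z. z \<noteq> 0 \<and> inverse z \<in> U}" by auto
    then show ?thesis using open_inverse_preimage[OF fin(1)] by simp
  next
    case inf
    obtain R where R: "R > 0" "\<And>x. x \<in> C \<Longrightarrow> norm x \<le> R"
      using compact_imp_bounded[OF inf(1)] by (auto simp: bounded_pos)
    \<comment> \<open>C lies in the disk of radius R, so inversion sends the disk of radius 1/R into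
      the complement of C: the preimage is open at 0 as well.\<close>
    have "inverse z \<notin> C" if "norm z < 1 / R" "z \<noteq> 0" for z
    proof
      assume "inverse z \<in> C"
      then have "inverse (norm z) \<le> R" using R(2) by (metis norm_inverse)
      then show False using that R(1) by (simp add: field_simps)
    qed
    then have "{z. sphere_inverse (Some z) \<in> T} = ball 0 (1 / R) \<union> {z. z \<noteq> 0 \<and> inverse z \<in> - C}"
      using R(1) by (auto simp: inf(2))
    then show ?thesis
      using open_inverse_preimage[of "- C"] compact_imp_closed[OF inf(1)] by (simp add: open_Un open_Compl)
  qed
  then show "openin euclidean {x \<in> topspace euclidean. sphere_inverse (Some x) \<in> T}" by simp
qed simp

lemma openin_image_sphere_inverse_Some:
  assumes V: "open V"
  shows "openin sphere_top ((\<lambda>z. sphere_inverse (Some z)) ` V)"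
proof -
  define W where "W = {z. z \<noteq> 0 \<and> inverse z \<in> V}"
  have W: "open W" unfolding W_def by (rule open_inverse_preimage[OF V])
  have im: "(\<lambda>z. sphere_inverse (Some z)) ` V = (if 0 \<in> V then {None} else {}) \<union> Some ` W"
  proof -
    have "sphere_inverse (Some z) \<in> (if 0 \<in> V then {None} else {}) \<union> Some ` W" if "z \<in> V" for z
      using that by (auto simp: W_def)
    moreover have "Some z \<in> (\<lambda>z. sphere_inverse (Some z)) ` V" if "z \<in> W" for z
      using that by (auto simp: W_def intro!: image_eqI[of _ _ "inverse z"])
    moreover have "None \<in> (\<lambda>z. sphere_inverse (Some z)) ` V" if "0 \<in> V"
      using that by (auto intro!: image_eqI[of _ _ 0])
    ultimately show ?thesis
      by (intro equalityI image_subsetI Un_least) (simp_all add: image_subset_iff del: sphere_inverse.simps)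
  qed
  show ?thesis
  proof (cases "0 \<in> V")
    case True
    then obtain e where e: "e > 0" "ball 0 e \<subseteq> V" using V openE by blast
    \<comment> \<open>A disk of radius e inside V contains the inverses of all points beyond 1/e;
      hence the complement of W is bounded, and V is mapped onto a neighbourhood of
      infinity.\<close>
    have "norm z \<le> 1 / e" if "z \<notin> W" for z
    proof (rule ccontr)
      assume *: "\<not> norm z \<le> 1 / e"
      then have "norm z > 0" using e(1) by (smt (verit) divide_pos_pos)
      then have "inverse (norm z) < e"
        using * e(1) by (simp add: field_simps)
      then have "inverse z \<in> ball 0 e" by (simp add: norm_inverse)
      then have "z \<in> W" using e(2) \<open>norm z > 0\<close> by (auto simp: W_def)
      then show False using that by contradiction
    qed
    then have "compact (- W)"
      using W by (auto simp: compact_eq_bounded_closed closed_Compl bounded_iff)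
    moreover have "(\<lambda>z. sphere_inverse (Some z)) ` V = insert None (Some ` (- (- W)))"
      using True im by simp
    ultimately show ?thesis unfolding openin_sphere_top by blast
  next
    case False
    then show ?thesis using im W by (auto simp: openin_sphere_top)
  qed
qed

lemma flip_par_eq: "flip_par q = (sphere_inverse (Some (snd q)), sphere_inverse (Some (fst q)))"
  by (simp add: flip_par_def flip_def std_par_def)

lemma continuous_map_std_par: "continuous_map euclidean sphere2_top std_par"
  and continuous_map_flip_par: "continuous_map euclidean sphere2_top flip_par"
proof -
  have fs: "continuous_map euclidean euclidean (fst :: complex \<times> complex \<Rightarrow> complex)"
    "continuous_map euclidean euclidean (snd :: complex \<times> complex \<Rightarrow> complex)"
    by (auto intro!: continuous_intros)
  have S: "continuous_map euclidean sphere_top Some"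
    unfolding sphere_top_def by (rule continuous_map_Some)
  show "continuous_map euclidean sphere2_top std_par"
    unfolding sphere2_top_def continuous_map_pairwise std_par_def
    using continuous_map_compose[OF fs(1) S] continuous_map_compose[OF fs(2) S] by (simp add: o_def)
  show "continuous_map euclidean sphere2_top flip_par"
    unfolding sphere2_top_def continuous_map_pairwise flip_par_eq[abs_def]
    using continuous_map_compose[OF fs(1) continuous_map_sphere_inverse_Some]
      continuous_map_compose[OF fs(2) continuous_map_sphere_inverse_Some] by (simp add: o_def)
qed

lemma openin_sphere2_image:
  assumes a: "\<And>V. open V \<Longrightarrow> openin sphere_top (a ` V)" and b: "\<And>V. open V \<Longrightarrow> openin sphere_top (b ` V)"
    and "open U"
  shows "openin sphere2_top ((\<lambda>q :: complex \<times> complex. (a (fst q), b (snd q))) ` U)"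
  unfolding sphere2_top_def openin_prod_topology_alt
proof (intro allI impI)
  fix x y assume "(x, y) \<in> (\<lambda>q. (a (fst q), b (snd q))) ` U"
  then obtain z w where q: "(z, w) \<in> U" "x = a z" "y = b w" by auto
  obtain A B where AB: "open A" "open B" "z \<in> A" "w \<in> B" "A \<times> B \<subseteq> U"
    using open_prod_elim[OF assms(3) q(1)] by (metis SigmaE2)
  have "a ` A \<times> b ` B \<subseteq> (\<lambda>q. (a (fst q), b (snd q))) ` U"
  proof
    fix p assume "p \<in> a ` A \<times> b ` B"
    then obtain s t where "s \<in> A" "t \<in> B" "p = (a s, b t)" by auto
    then show "p \<in> (\<lambda>q. (a (fst q), b (snd q))) ` U"
      using AB(5) by (intro image_eqI[of _ _ "(s, t)"]) auto
  qed
  then show "\<exists>A B. openin sphere_top A \<and> openin sphere_top B \<and> x \<in> A \<and> y \<in> B \<and>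
      A \<times> B \<subseteq> (\<lambda>q. (a (fst q), b (snd q))) ` U"
    using q a[OF AB(1)] b[OF AB(2)] AB(3,4) by blast
qed

lemma std_par_in_Omega: "std_par q \<in> Omega \<longleftrightarrow> fst q * snd q \<noteq> 1"
  by (simp add: Omega_def std_par_def)

lemma flip_par_in_Omega: "flip_par q \<in> Omega \<longleftrightarrow> fst q * snd q \<noteq> 1"
  by (auto simp: Omega_def flip_par_eq field_simps)

text \<open>The convention that 0 times infinity is 1 removes the pairs (0, \<infinity>) and
  (\<infinity>, 0). A point of \<open>Omega\<close> with an infinite coordinate thus has no zero
  coordinate and lies in the flip chart.\<close>

lemma Omega_cases:
  assumes "p \<in> Omega"
  obtains q where "p = std_par q" | q where "p = flip_par q"
proof (cases "fst p = None \<or> snd p = None")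
  case True
  then have "fst p \<noteq> Some 0" "snd p \<noteq> Some 0"
    using assms by (cases p; auto simp: Omega_def)+
  then obtain a b where "sphere_inverse (fst p) = Some a" "sphere_inverse (snd p) = Some b"
    by (cases "fst p"; cases "snd p") auto
  then have "p = flip_par (b, a)"
    by (metis flip_par_eq fst_conv prod.collapse snd_conv sphere_inverse_involution)
  then show ?thesis by (rule that(2))
next
  case False
  then have "p = std_par (the (fst p), the (snd p))" by (simp add: std_par_def)
  then show ?thesis by (rule that(1))
qed

lemma open_chart_domain:
  assumes "openin Omega_top D"
  shows "open {q. std_par q \<in> D}" and "open {q. flip_par q \<in> D}"
proof -
  obtain T where T: "openin sphere2_top T" "D = T \<inter> Omega"
    using assms by (auto simp: Omega_top_def openin_subtopology)
  have "open {q :: complex \<times> complex. fst q * snd q \<noteq> 1}"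
    by (intro open_Collect_neq continuous_intros)
  moreover have "open {q. std_par q \<in> T}" "open {q. flip_par q \<in> T}"
    using openin_continuous_map_preimage[OF continuous_map_std_par T(1)]
      openin_continuous_map_preimage[OF continuous_map_flip_par T(1)] by simp_all
  moreover have "{q. std_par q \<in> D} = {q. std_par q \<in> T} \<inter> {q. fst q * snd q \<noteq> 1}"
    "{q. flip_par q \<in> D} = {q. flip_par q \<in> T} \<inter> {q. fst q * snd q \<noteq> 1}"
    by (auto simp: T(2) std_par_in_Omega flip_par_in_Omega)
  ultimately show "open {q. std_par q \<in> D}" "open {q. flip_par q \<in> D}" by (simp_all add: open_Int)
qed

lemma openin_chart_image:
  assumes "open U"
  shows "std_par ` U \<subseteq> Omega \<Longrightarrow> openin Omega_top (std_par ` U)"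
    and "flip_par ` U \<subseteq> Omega \<Longrightarrow> openin Omega_top (flip_par ` U)"
proof -
  have "openin sphere_top (Some ` V)" if "open V" for V
    using that by (auto simp: openin_sphere_top)
  then have 1: "openin sphere2_top (std_par ` U)"
    unfolding std_par_def[abs_def] using assms by (intro openin_sphere2_image)
  \<comment> \<open>\<open>flip_par\<close> exchanges the coordinates before inverting them, so the
    image lemma is applied to the swapped set.\<close>
  have "open (prod.swap -` U)"
    unfolding prod.swap_def using assms by (intro open_vimage continuous_intros)
  moreover have "prod.swap ` U = prod.swap -` U" by force
  ultimately have "open (prod.swap ` U)" by simp
  from openin_sphere2_image[OF openin_image_sphere_inverse_Some openin_image_sphere_inverse_Some this]
  have 2: "openin sphere2_top (flip_par ` U)"
    by (simp add: image_image flip_par_eq[abs_def] prod.swap_def del: sphere_inverse.simps)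
  show "std_par ` U \<subseteq> Omega \<Longrightarrow> openin Omega_top (std_par ` U)"
    "flip_par ` U \<subseteq> Omega \<Longrightarrow> openin Omega_top (flip_par ` U)"
    using 1 2 unfolding Omega_top_def openin_subtopology by (metis inf.absorb1)+
qed

section \<open>Rotations and Fourier terms on the sphere\<close>

definition rot_sphere :: "complex \<Rightarrow> csphere \<times> csphere \<Rightarrow> csphere \<times> csphere" where
  "rot_sphere \<eta> p = (sphere_mult (Some \<eta>) (fst p), sphere_mult (snd p) (Some (inverse \<eta>)))"

text \<open>Inversion turns multiplication by \<eta> into division by \<eta>, and the exchange of
  coordinates turns it back; so the rotation looks the same in both charts.\<close>

lemma rot_sphere_par:
  assumes "\<eta> \<noteq> 0"
  shows "rot_sphere \<eta> (std_par q) = std_par (rot2 \<eta> q)" and "rot_sphere \<eta> (flip_par q) = flip_par (rot2 \<eta> q)"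
  using assms by (auto simp: rot_sphere_def std_par_def rot2_def flip_par_eq divide_inverse mult_ac)

text \<open>The globally defined term of the expansion. Being formed on the sphere itself, it needs
  no gluing of the two charts.\<close>

definition fourier_component :: "int \<Rightarrow> (csphere \<times> csphere \<Rightarrow> complex) \<Rightarrow> csphere \<times> csphere \<Rightarrow> complex" where
  "fourier_component n f p = integral {0..2 * pi} (\<lambda>t. cis (n * t) * f (rot_sphere (cis t) p)) / (2 * of_real pi)"

lemma fourier_component_par:
  "fourier_component n f (std_par q) = fourier_mean n (f \<circ> std_par) q"
  "fourier_component n f (flip_par q) = fourier_mean n (f \<circ> flip_par) q"
  by (simp_all add: fourier_component_def fourier_mean_def rot_sphere_par)

section \<open>Uniqueness of the coefficients through restriction to the axes\<close>

lemma powser_unique: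
  fixes a b :: "nat \<Rightarrow> complex"
  assumes "r > 0" and a: "\<And>z. norm z < r \<Longrightarrow> (\<lambda>k. a k * z ^ k) sums F z"
    and b: "\<And>z. norm z < r \<Longrightarrow> (\<lambda>k. b k * z ^ k) sums F z"
  shows "a = b"
proof
  have d: "(\<lambda>k. (a k - b k) * z ^ k) sums 0" if "norm z < r" for z
    using sums_diff[OF a[OF that] b[OF that]] by (simp add: left_diff_distrib)
  fix k
  show "a k = b k"
  proof (cases "k = 0")
    case True
    have "(\<lambda>k. (a k - b k) * 0 ^ k) sums (a 0 - b 0)" by (rule powser_sums_zero)
    then show ?thesis using d[of 0] assms(1) True sums_unique2 by fastforce
  next
    case False
    show ?thesis
    proof (rule ccontr)
      assume "a k \<noteq> b k"
      then obtain s where "0 < s" "\<And>z::complex. z \<in> cball 0 s - {0} \<Longrightarrow> (\<lambda>_. 0::complex) z \<noteq> 0"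
        using powser_0_nonzero[OF assms(1), where a = "\<lambda>k. a k - b k" and \<xi> = 0 and f = "\<lambda>_. 0" and m = k] d False
        by (auto simp: dist_norm)
      from this(2)[of "of_real s"] \<open>0 < s\<close> show False by auto
    qed
  qed
qed

lemma holomorphic2_on_subset: "f holomorphic2_on S \<Longrightarrow> T \<subseteq> S \<Longrightarrow> f holomorphic2_on T"
  unfolding holomorphic2_on_def by (meson has_derivative_subset subsetD)

lemma connected_component_bidisk:
  assumes "ball 0 r \<times> ball 0 r \<subseteq> S" "q \<in> ball 0 r \<times> ball (0::complex) r"
  shows "q \<in> connected_component_set S (0::complex, 0)"
proof -
  have "ball 0 r \<times> ball 0 r \<subseteq> connected_component_set S (0::complex, 0)"
    using assms
    by (intro connected_component_maximal convex_connected convex_Times convex_ball)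
       (auto intro: le_less_trans[OF norm_ge_zero])
  then show ?thesis using assms(2) by blast
qed

lemma poisson_mode_fst:
  assumes "norm z < 1"
  shows "poisson_mode \<mu> n (z, 0) = (if n \<le> 0 then poisson_coeff \<mu> (nat (- n)) * z ^ nat (- n) else 0)"
  using poisson_mode_bidisk[of "(z, 0)"] fourier_mean_kernel_fst[OF assms] assms by simp

lemma poisson_mode_snd:
  assumes "norm w < 1"
  shows "poisson_mode \<mu> n (0, w) = (if n \<ge> 0 then poisson_coeff \<mu> (nat n) * w ^ nat n else 0)"
  using poisson_mode_bidisk[of "(0, w)"] fourier_mean_kernel_snd[OF assms] assms by simp

text \<open>On w = 0 only indices n \<le> 0 survive and on z = 0 only n \<ge> 0, each mode being a
  monomial there, so the two-sided expansion becomes an ordinary power series on each axis.\<close>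

lemma poisson_series_axes:
  assumes r: "r \<le> 1" "ball 0 r \<times> ball 0 r \<subseteq> {q. std_par q \<in> D} \<inter> Omega_star"
    and g: "\<And>n. poisson_term_on D \<mu> n (c n) (g n)"
    and conv: "abs_loc_unif_convergent_on (\<lambda>k. g (int k)) D" "abs_loc_unif_convergent_on (\<lambda>k. g (- int (Suc k))) D"
    and f: "\<And>p. p \<in> D \<Longrightarrow> f p = (\<Sum>k. g (int k) p) + (\<Sum>k. g (- int (Suc k)) p)"
    and z: "norm z < r"
  shows "(\<lambda>k. c (- int k) * poisson_coeff \<mu> k * z ^ k) sums f (std_par (z, 0))"
    and "(\<lambda>k. c (int k) * poisson_coeff \<mu> k * z ^ k) sums f (std_par (0, z))"
proof -
  have z1: "norm z < 1" using z r(1) by simp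
  have rpos: "r > 0" using z by (rule le_less_trans[OF norm_ge_zero])
  have q: "(z, 0) \<in> ball 0 r \<times> ball 0 r" "(0, z) \<in> ball 0 r \<times> ball 0 r"
    using z rpos by auto
  then have D: "std_par (z, 0) \<in> D" "std_par (0, z) \<in> D" using r(2) by blast+
  have gP: "g n (std_par (z, 0)) = c n * poisson_mode \<mu> n (z, 0)" "g n (std_par (0, z)) = c n * poisson_mode \<mu> n (0, z)" for n
    using g[of n] connected_component_bidisk[OF r(2) q(1)] connected_component_bidisk[OF r(2) q(2)]
    unfolding poisson_term_on_def by blast+
  have s: "summable (\<lambda>k. g (int k) p)" "summable (\<lambda>k. g (- int (Suc k)) p)" if "p \<in> D" for p
    using conv that unfolding abs_loc_unif_convergent_on_def by (auto intro: summable_norm_cancel)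
  show "(\<lambda>k. c (- int k) * poisson_coeff \<mu> k * z ^ k) sums f (std_par (z, 0))"
  proof -
    define d where "d = (\<lambda>k. c (- int k) * poisson_coeff \<mu> k * z ^ k)"
    have d: "g (- int (Suc k)) (std_par (z, 0)) = d (Suc k)" for k
    proof -
      have "nat (- (- int (Suc k))) = Suc k" by simp
      then show ?thesis by (simp only: gP(1) poisson_mode_fst[OF z1] d_def) (simp add: mult.assoc)
    qed
    have "(\<lambda>k. d (Suc k)) sums (\<Sum>k. g (- int (Suc k)) (std_par (z, 0)))"
      using summable_sums[OF s(2)[OF D(1)]] unfolding d .
    \<comment> \<open>The first series contributes only its index 0, which is the constant term of
      d; the second series supplies d from index 1 on.\<close>
    moreover have "(\<Sum>k. g (int k) (std_par (z, 0))) = d 0"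
    proof -
      have "(\<Sum>k. g (int k) (std_par (z, 0))) = (\<Sum>k\<in>{0}. g (int k) (std_par (z, 0)))"
        by (rule suminf_finite) (auto simp: gP(1) poisson_mode_fst[OF z1])
      then show ?thesis by (simp add: gP(1) poisson_mode_fst[OF z1] d_def)
    qed
    ultimately have "d sums f (std_par (z, 0))"
      unfolding f[OF D(1)] by (simp add: sums_Suc_iff add.commute)
    then show ?thesis by (simp add: d_def)
  qed
  show "(\<lambda>k. c (int k) * poisson_coeff \<mu> k * z ^ k) sums f (std_par (0, z))"
  proof -
    have "(\<lambda>k. c (int k) * poisson_coeff \<mu> k * z ^ k) sums (\<Sum>k. g (int k) (std_par (0, z)))"
      using summable_sums[OF s(1)[OF D(2)]] by (simp add: gP(2) poisson_mode_snd[OF z1] mult.assoc)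
    moreover have "g (- int (Suc k)) (std_par (0, z)) = 0" for k
      by (simp add: gP(2) poisson_mode_snd[OF z1])
    ultimately show ?thesis unfolding f[OF D(2)] by simp
  qed
qed

section \<open>Existence and uniqueness of the expansion\<close>

theorem theorem5p1:
  fixes D :: "(csphere \<times> csphere) set"
    and f :: "csphere \<times> csphere \<Rightarrow> complex"
    and lam \<mu> :: complex
  assumes "subdomain_Omega D"
    and "rotationally_invariant D"
    and "(Some 0, Some 0) \<in> D"
    and "f holomorphic_Omega_on D"
    and "\<forall>p\<in>D. Delta f p = lam * f p"
    and "lam = 4 * \<mu> * (\<mu> - 1)"
    and "Re \<mu> \<ge> 1 / 2"
  shows "\<exists>!c :: int \<Rightarrow> complex.
    \<exists>g :: int \<Rightarrow> csphere \<times> csphere \<Rightarrow> complex.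
      (\<forall>n. poisson_term_on D \<mu> n (c n) (g n)) \<and>
      abs_loc_unif_convergent_on (\<lambda>k. g (int k)) D \<and>
      abs_loc_unif_convergent_on (\<lambda>k. g (- int (Suc k))) D \<and>
      (\<forall>p\<in>D. f p = (\<Sum>k. g (int k) p) + (\<Sum>k. g (- int (Suc k)) p))"
proof -
  define S1 where "S1 = {q. std_par q \<in> D}"
  define S2 where "S2 = {q. flip_par q \<in> D}"
  define \<phi> where "\<phi> = f \<circ> std_par"
  define \<kappa> where "\<kappa> = \<mu> * (\<mu> - 1)"
  have D: "openin Omega_top D" using assms(1) by (simp add: subdomain_Omega_def)
  have D\<Omega>: "D \<subseteq> Omega"
    using openin_subset[OF D] by (simp add: Omega_top_def)
  have S: "open S1" "open S2"
    unfolding S1_def S2_def by (rule open_chart_domain[OF D])+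
  have rot: "rot_sphere \<eta> p \<in> D" if "p \<in> D" "norm \<eta> = 1" for p \<eta>
    using assms(2) that unfolding rotationally_invariant_def rot_sphere_def by (auto simp: case_prod_unfold)
  have inv: "q \<in> S1 \<Longrightarrow> rot2 \<eta> q \<in> S1" "q \<in> S2 \<Longrightarrow> rot2 \<eta> q \<in> S2" if "norm \<eta> = 1" for q \<eta>
  proof -
    have "\<eta> \<noteq> 0" using that by auto
    note p = rot_sphere_par[OF this, of q]
    show "q \<in> S1 \<Longrightarrow> rot2 \<eta> q \<in> S1" "q \<in> S2 \<Longrightarrow> rot2 \<eta> q \<in> S2"
      using rot[of "std_par q", OF _ that] rot[of "flip_par q", OF _ that] p by (simp_all add: S1_def S2_def)
  qed
  have hol: "\<phi> holomorphic2_on S1" "(f \<circ> flip_par) holomorphic2_on S2"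
    using assms(4) by (simp_all add: holomorphic_Omega_on_def \<phi>_def S1_def S2_def)
  define g where "g = (\<lambda>n. fourier_component n f)"
  have g_par: "g n (std_par q) = fourier_mean n \<phi> q" "g n (flip_par q) = fourier_mean n (f \<circ> flip_par) q" for n q
    by (simp_all add: g_def \<phi>_def fourier_component_par)
  have g_hol: "g n holomorphic_Omega_on D" for n
    using holomorphic2_on_fourier_mean[OF S(1) hol(1), of n] holomorphic2_on_fourier_mean[OF S(2) hol(2), of n] inv
    by (simp add: holomorphic_Omega_on_def g_par o_def flip: S1_def S2_def)

  \<comment> \<open>Each point is treated in a chart containing it; W is the chart image of the
    neighbourhood from \<open>fourier_mean_series\<close>.\<close>
  have local: "\<exists>W M r. openin Omega_top W \<and> p \<in> W \<and> W \<subseteq> D \<and> 0 < r \<and> r < 1 \<and>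
      (\<forall>n. \<forall>x\<in>W. norm (g n x) \<le> M * r ^ nat \<bar>n\<bar>) \<and>
      (\<forall>x\<in>W. f x = (\<Sum>k. g (int k) x) + (\<Sum>k. g (- int (Suc k)) x))" if p: "p \<in> D" for p
    using subsetD[OF D\<Omega> p]
  proof (cases rule: Omega_cases)
    case (1 q)
    then have q: "q \<in> S1" using p by (simp add: S1_def)
    from fourier_mean_series[OF S(1) hol(1) q inv(1)[OF _ q]]
    obtain U M r where U: "open U" "q \<in> U" "U \<subseteq> S1" "0 < r" "r < 1"
      "\<And>n q. q \<in> U \<Longrightarrow> norm (fourier_mean n \<phi> q) \<le> M * r ^ nat \<bar>n\<bar>"
      "\<And>q. q \<in> U \<Longrightarrow> \<phi> q = (\<Sum>k. fourier_mean (int k) \<phi> q) + (\<Sum>k. fourier_mean (- int (Suc k)) \<phi> q)"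
      by metis
    have "std_par ` U \<subseteq> D" using U(3) by (auto simp: S1_def)
    moreover have "openin Omega_top (std_par ` U)"
      using openin_chart_image(1)[OF U(1)] calculation D\<Omega> by blast
    moreover have "f (std_par q) = (\<Sum>k. g (int k) (std_par q)) + (\<Sum>k. g (- int (Suc k)) (std_par q))" if "q \<in> U" for q
      using U(7)[OF that] unfolding g_par by (simp add: \<phi>_def)
    ultimately show ?thesis
      using U(2,4-6) 1 by (intro exI[of _ "std_par ` U"] exI[of _ M] exI[of _ r]) (auto simp: g_par(1))
  next
    case (2 q)
    then have q: "q \<in> S2" using p by (simp add: S2_def)
    from fourier_mean_series[OF S(2) hol(2) q inv(2)[OF _ q]]
    obtain U M r where U: "open U" "q \<in> U" "U \<subseteq> S2" "0 < r" "r < 1"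
      "\<And>n q. q \<in> U \<Longrightarrow> norm (fourier_mean n (f \<circ> flip_par) q) \<le> M * r ^ nat \<bar>n\<bar>"
      "\<And>q. q \<in> U \<Longrightarrow> (f \<circ> flip_par) q = (\<Sum>k. fourier_mean (int k) (f \<circ> flip_par) q) + (\<Sum>k. fourier_mean (- int (Suc k)) (f \<circ> flip_par) q)"
      by metis
    have "flip_par ` U \<subseteq> D" using U(3) by (auto simp: S2_def)
    moreover have "openin Omega_top (flip_par ` U)"
      using openin_chart_image(2)[OF U(1)] calculation D\<Omega> by blast
    moreover have "f (flip_par q) = (\<Sum>k. g (int k) (flip_par q)) + (\<Sum>k. g (- int (Suc k)) (flip_par q))" if "q \<in> U" for q
      using U(7)[OF that] unfolding g_par by simp
    ultimately show ?thesis
      using U(2,4-6) 2 by (intro exI[of _ "flip_par ` U"] exI[of _ M] exI[of _ r]) (auto simp: g_par(2))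
  qed
  \<comment> \<open>One argument for both series, \<nu> k = k and \<nu> k = -(k+1): since |\<nu> k|
    \<ge> k and r < 1, the bound M r^|\<nu> k| is at most M r^k.\<close>
  have conv: "abs_loc_unif_convergent_on (\<lambda>k. g (\<nu> k)) D" if \<nu>: "\<And>k. nat \<bar>\<nu> k\<bar> \<ge> k" for \<nu>
  proof -
    have *: "\<exists>W M r. openin Omega_top W \<and> p \<in> W \<and> W \<subseteq> D \<and> summable (\<lambda>k. M * r ^ k) \<and>
      (\<forall>k. \<forall>x\<in>W. norm (g (\<nu> k) x) \<le> M * r ^ k)" if p: "p \<in> D" for p
    proof -
      obtain W M r where W: "openin Omega_top W" "p \<in> W" "W \<subseteq> D" "0 < r" "r < 1"
        "\<And>n x. x \<in> W \<Longrightarrow> norm (g n x) \<le> M * r ^ nat \<bar>n\<bar>"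
        using local[OF p] by blast
      have "M \<ge> 0" using W(6)[OF W(2), of 0] by (auto intro: order_trans[OF norm_ge_zero])
      have "norm (g (\<nu> k) x) \<le> M * r ^ k" if "x \<in> W" for k x
        by (rule order_trans[OF W(6)[OF that]])
           (use \<nu>[of k] W(4,5) \<open>M \<ge> 0\<close> in \<open>auto intro!: mult_left_mono power_decreasing\<close>)
      then show ?thesis
        using W by (intro exI[of _ W] exI[of _ M] exI[of _ r]) (auto intro!: summable_mult summable_geometric)
    qed
    show ?thesis
      unfolding abs_loc_unif_convergent_on_def
    proof (intro conjI ballI)
      fix p assume p: "p \<in> D"
      obtain W M r where W: "openin Omega_top W" "p \<in> W" "W \<subseteq> D" "summable (\<lambda>k. M * r ^ k)"
        "\<And>k x. x \<in> W \<Longrightarrow> norm (g (\<nu> k) x) \<le> M * r ^ k"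
        using *[OF p] by blast
      show "summable (\<lambda>k. norm (g (\<nu> k) p))"
        by (rule summable_comparison_test'[OF W(4), of 0]) (use W(5)[OF W(2)] in simp)
      have "uniform_limit W (\<lambda>N x. \<Sum>k<N. g (\<nu> k) x) (\<lambda>x. \<Sum>k. g (\<nu> k) x) sequentially"
        by (rule Weierstrass_m_test[OF W(5) W(4)])
      with W(1-3) show "\<exists>U. openin Omega_top U \<and> p \<in> U \<and> U \<subseteq> D \<and>
         uniform_limit U (\<lambda>N x. \<Sum>k<N. g (\<nu> k) x) (\<lambda>x. \<Sum>k. g (\<nu> k) x) sequentially"
        by (intro exI[of _ W] conjI)
    qed
  qed

  have O: "open (S1 \<inter> Omega_star)" using S(1) open_Omega_star by (rule open_Int)
  have "(0, 0) \<in> S1 \<inter> Omega_star"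
    using assms(3) by (simp add: S1_def std_par_def Omega_star_slit slit_plane_0)
  from open_Times_ball[OF O this] obtain r' where r': "r' > 0" "cball 0 r' \<times> cball 0 r' \<subseteq> S1 \<inter> Omega_star" .
  \<comment> \<open>The cap 1 places the bidisk of radius r inside \<open>bidisk\<close>, where the
    modes are means of the kernel.\<close>
  define r where "r = min r' 1"
  have r: "r > 0" "r \<le> 1" "ball 0 r \<times> ball 0 r \<subseteq> S1 \<inter> Omega_star"
    using r' by (auto simp: r_def)
  define B :: "(complex \<times> complex) set" where "B = ball 0 r \<times> ball 0 r"

  have "eigen2 \<kappa> S1 \<phi>"
    unfolding eigen2_def
  proof (intro conjI hol(1) ballI)
    fix q assume "q \<in> S1"
    then have "Delta f (std_par q) = lam * \<phi> q"
      using assms(5) by (simp add: S1_def \<phi>_def)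
    moreover have "std_coord (std_par q) = q" by (simp add: std_coord_def std_par_def)
    ultimately have "4 * ((1 - fst q * snd q)\<^sup>2 * D1 (D2 \<phi>) q) = 4 * (\<kappa> * \<phi> q)"
      by (simp add: Delta_def Delta_chart_def D1_def D2_def assms(6) \<kappa>_def flip: \<phi>_def)
    then show "(1 - fst q * snd q)\<^sup>2 * D1 (D2 \<phi>) q = \<kappa> * \<phi> q" by simp
  qed
  then have eG: "eigen2 \<kappa> S1 (fourier_mean n \<phi>)" for n
    using eigen2_fourier_mean[OF S(1)] inv(1) by simp
  have hz: "(\<lambda>z. \<phi> (z, 0)) holomorphic_on ball 0 r" "(\<lambda>w. \<phi> (0, w)) holomorphic_on ball 0 r"
  proof -
    have mem: "(z, 0) \<in> S1" "(0, z) \<in> S1" if "z \<in> ball 0 r" for z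
    proof -
      have "(z, 0) \<in> ball 0 r \<times> ball 0 r" "(0, z) \<in> ball 0 r \<times> ball 0 r" using that r(1) by auto
      then show "(z, 0) \<in> S1" "(0, z) \<in> S1" using r(3) by blast+
    qed
    show "(\<lambda>z. \<phi> (z, 0)) holomorphic_on ball 0 r" "(\<lambda>w. \<phi> (0, w)) holomorphic_on ball 0 r"
      using holomorphic2_on_DERIV(1)[OF S(1) hol(1) mem(1)] holomorphic2_on_DERIV(2)[OF S(1) hol(1) mem(2)]
      by (meson field_differentiable_def holomorphic_on_atI)+
  qed
  \<comment> \<open>The quotient of the Taylor coefficients of f and of the mode on the axis where
    the mode does not vanish: the w-axis for n \<ge> 0, the z-axis for n < 0.\<close>
  define c where "c = (\<lambda>n. (deriv ^^ nat \<bar>n\<bar>) (if n \<ge> 0 then (\<lambda>w. \<phi> (0, w)) else (\<lambda>z. \<phi> (z, 0))) 0 /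
     fact (nat \<bar>n\<bar>) / poisson_coeff \<mu> (nat \<bar>n\<bar>))"
  have pc: "poisson_coeff \<mu> k \<noteq> 0" for k
    using assms(7) by (intro poisson_coeff_nonzero) simp
  have term_on: "poisson_term_on D \<mu> n (c n) (g n)" for n
    unfolding poisson_term_on_def S1_def[symmetric]
  proof (intro conjI ballI g_hol)
    let ?C = "connected_component_set (S1 \<inter> Omega_star) (0, 0)"
    fix q assume q: "q \<in> ?C"
    have BS: "B \<subseteq> S1" and BD: "B \<subseteq> bidisk" using r by (auto simp: B_def)
    have ax: "fourier_mean n \<phi> (z, 0) = c n * fourier_mean n (poisson_kernel \<mu>) (z, 0)"
      "fourier_mean n \<phi> (0, z) = c n * fourier_mean n (poisson_kernel \<mu>) (0, z)" if z: "z \<in> ball 0 r" for z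
    proof -
      have z1: "norm z < 1" using z r(2) by simp
      show "fourier_mean n \<phi> (z, 0) = c n * fourier_mean n (poisson_kernel \<mu>) (z, 0)"
        unfolding fourier_mean_fst[OF hz(1) z] fourier_mean_kernel_fst[OF z1]
        \<comment> \<open>At n = 0 both axes contribute the value at the origin, while the
          definition of c refers to the w-axis.\<close>
        using pc by (cases "n = 0") (auto simp: c_def)
      show "fourier_mean n \<phi> (0, z) = c n * fourier_mean n (poisson_kernel \<mu>) (0, z)"
        unfolding fourier_mean_snd[OF hz(2) z] fourier_mean_kernel_snd[OF z1]
        using pc by (auto simp: c_def)
    qed
    obtain s where s: "s > 0" "s \<le> r"
      "\<And>z w. z \<in> ball 0 s \<Longrightarrow> w \<in> ball 0 s \<Longrightarrow> fourier_mean n \<phi> (z, w) = c n * fourier_mean n (poisson_kernel \<mu>) (z, w)"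
      using eigen2_eq_near_0[OF r(1) eigen2_subset[OF eG BS[unfolded B_def]]
          eigen2_subset[OF eigen2_fourier_mean_kernel[of \<mu> n, folded \<kappa>_def] BD[unfolded B_def]] ax]
      by blast
    have sub: "?C \<subseteq> S1 \<inter> Omega_star" by (rule connected_component_subset)
    have "fourier_mean n \<phi> q = c n * poisson_mode \<mu> n q"
    \<comment> \<open>Equality is known on a small bidisk about the origin. It extends over the
      component and no further, which is why \<open>poisson_term_on\<close> refers to the component
      only.\<close>
    proof (rule holomorphic2_identity[of ?C _ _ "(0, 0)"])
      show "open ?C" by (rule open_connected_component[OF O])
      show "connected ?C" by simp
      show "fourier_mean n \<phi> holomorphic2_on ?C"
        using eG[of n] sub by (auto simp: eigen2_def elim: holomorphic2_on_subset)
      show "(\<lambda>q. c n * poisson_mode \<mu> n q) holomorphic2_on ?C"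
        using sub by (intro holomorphic2_on_cmult holomorphic2_on_subset[OF poisson_mode_holomorphic]) auto
      show "(0, 0) \<in> ?C" using \<open>(0, 0) \<in> S1 \<inter> Omega_star\<close> by simp
      have "\<forall>\<^sub>F q in nhds (0, 0). q \<in> ball 0 s \<times> ball 0 s"
        using s by (intro eventually_nhds_in_open) (auto simp: open_Times)
      then show "\<forall>\<^sub>F q in nhds (0, 0). fourier_mean n \<phi> q = c n * poisson_mode \<mu> n q"
      proof eventually_elim
        case (elim q)
        then have "q \<in> bidisk" using s(2) r(2) by auto
        with elim show ?case
          using s(3)[of "fst q" "snd q"] by (auto simp: poisson_mode_bidisk)
      qed
      show "q \<in> ?C" by (rule q)
    qed
    then show "g n (std_par q) = c n * poisson_mode \<mu> n q" by (simp add: g_par)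
  qed
  have f_sum: "f p = (\<Sum>k. g (int k) p) + (\<Sum>k. g (- int (Suc k)) p)" if "p \<in> D" for p
      using local[OF that] by blast
  have conv': "abs_loc_unif_convergent_on (\<lambda>k. g (int k)) D" "abs_loc_unif_convergent_on (\<lambda>k. g (- int (Suc k))) D"
      by (rule conv; simp)+
  show ?thesis
  proof (rule ex1I[of _ c])
    show "\<exists>g. (\<forall>n. poisson_term_on D \<mu> n (c n) (g n)) \<and>
      abs_loc_unif_convergent_on (\<lambda>k. g (int k)) D \<and>
      abs_loc_unif_convergent_on (\<lambda>k. g (- int (Suc k))) D \<and>
      (\<forall>p\<in>D. f p = (\<Sum>k. g (int k) p) + (\<Sum>k. g (- int (Suc k)) p))"
      using term_on conv' f_sum by (intro exI[of _ g] conjI ballI allI)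
  next
    fix c' assume "\<exists>g. (\<forall>n. poisson_term_on D \<mu> n (c' n) (g n)) \<and>
      abs_loc_unif_convergent_on (\<lambda>k. g (int k)) D \<and>
      abs_loc_unif_convergent_on (\<lambda>k. g (- int (Suc k))) D \<and>
      (\<forall>p\<in>D. f p = (\<Sum>k. g (int k) p) + (\<Sum>k. g (- int (Suc k)) p))"
    then obtain g' where g': "\<And>n. poisson_term_on D \<mu> n (c' n) (g' n)"
      "abs_loc_unif_convergent_on (\<lambda>k. g' (int k)) D" "abs_loc_unif_convergent_on (\<lambda>k. g' (- int (Suc k))) D"
      "\<And>p. p \<in> D \<Longrightarrow> f p = (\<Sum>k. g' (int k) p) + (\<Sum>k. g' (- int (Suc k)) p)"
      by blast
    \<comment> \<open>Any two admissible expansions have the same sum f, so on each axis two power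
      series agree. The axis w = 0 yields the indices -k, the axis z = 0 the indices k.\<close>
    note ax = poisson_series_axes[OF r(2) r(3)[unfolded S1_def]]
    have "(\<lambda>k. c' (- int k) * poisson_coeff \<mu> k) = (\<lambda>k. c (- int k) * poisson_coeff \<mu> k)"
      by (rule powser_unique[OF r(1) ax(1)[OF g'] ax(1)[OF term_on conv' f_sum]])
    then have neg: "c' (- int k) = c (- int k)" for k
      using pc by (simp add: fun_eq_iff)
    have "(\<lambda>k. c' (int k) * poisson_coeff \<mu> k) = (\<lambda>k. c (int k) * poisson_coeff \<mu> k)"
      by (rule powser_unique[OF r(1) ax(2)[OF g'] ax(2)[OF term_on conv' f_sum]])
    then have pos: "c' (int k) = c (int k)" for k
      using pc by (simp add: fun_eq_iff)
    show "c' = c"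
    proof
      show "c' n = c n" for n by (cases n rule: int_cases2) (auto simp: pos neg)
    qed
  qed
qed

end
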